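(* Let the $A_i$, $i\in I$, be nearly closed, and let $$\sum_{i\in I}a_i\,g_{i,\inf}^{-1}<\infty,\qquad \sup_{(x,y)\in\breve A^+\times\breve A^-}\kappa(x,y)<\infty,\qquad \sup_{x\in\breve A_i}g_i(x)<\infty\ \text{ for all } i\in I,$$ where $g_{i,\inf}:=\inf_{x\in A_i}g_i(x)$. Assume also that for every $i\in I_0$, $$\xi^i|_K\in\mathcal E^+_\kappa(X)\ \text{ for every compact } K\subset A_i^\circ,\qquad \xi^i(A_i\setminus A_i^\circ)=0,$$ where $A_i^\circ:=\{x\in A_i:\ |f_i(x)|<\infty\}$. If, moreover, the restrictions $f_i|_{\breve A_i}$, $i\in I$, are lower bounded, then for any $\boldsymbol\lambda\in\mathcal E^{\boldsymbol\sigma}_{\kappa,\mathbf f}(\mathbf A,\mathbf a,\mathbf g)$ the following two assertions are equivalent: (i) $\boldsymbol\lambda\in\mathfrak S^{\boldsymbol\sigma}_{\kappa,\mathbf f}(\mathbf A,\mathbf a,\mathbf g)$. (ii) There exists $(w^i_{\boldsymbol\lambda})_{i\in I}\in\mathbb R^{\mathrm{Card}\,I}$ such that for all $i\in I_0$, $$W^{\boldsymbol\lambda,i}_{\kappa,\mathbf f}\geqslant w^i_{\boldsymbol\lambda}g_i\quad(\xi^i-\lambda^i)\text{-a.e.},\qquad W^{\boldsymbol\lambda,i}_{\kappa,\mathbf f}\leqslant w^i_{\boldsymbol\lambda}g_i\quad\lambda^i\text{-a.e.},$$ while for all $i\in I\setminus I_0$, $$W^{\boldsymbol\lambda,i}_{\kappa,\mathbf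 f}\geqslant w^i_{\boldsymbol\lambda}g_i\quad\text{n.e. on }A_i,\qquad W^{\boldsymbol\lambda,i}_{\kappa,\mathbf f}=w^i_{\boldsymbol\lambda}g_i\quad\lambda^i\text{-a.e.}$$
   Context: **Measures and kernels.** $X$ is a locally compact Hausdorff space, $\mathfrak M(X)$ the space of real-valued (signed) Radon measures on $X$, $\mathfrak M^+(X)$ its positive elements. Continuous functions are finite-valued. $\nu\in\mathfrak M^+(X)$ is carried by $Q\subset X$ if $X\setminus Q$ is locally $\nu$-negligible (equivalently, $Q$ is $\nu$-measurable and $\nu=\nu|_Q$); $\mathfrak M^+(Q)$ is the set of such $\nu$. $\langle\psi,\nu\rangle:=\int\psi\,d\nu$. For a topological space $Y$, $\Psi(Y)$ is the set of l.s.c. functions $Y\to(-\infty,\infty]$, required to be nonnegative unless $Y$ is compact. A kernel is a symmetric $\kappa\in\Psi(X\times X)$. Write $\kappa(\mu,\nu):=\int\kappa\,d(\mu\otimes\nu)$ and $\kappa(x,\nu):=\int\kappa(x,y)\,d\nu(y)$. The kernel is assumed positive definite: $\kappa(\nu,\nu)\geqslant0$ for every $\nu\in\mathfrak M(X)$ for which it is defined (i.e. $\kappa(\nu^+,\nu^+)+\kappa(\nu^-,\nu^-)$ or $\kappa(\nu^+,\nu^-)$ is finite). $\mathcal E_\kappa(X):=\{\nu\in\mathfrak M(X):\kappa(\nu,\nu)\text{ finite}\}$; $\mathcal E^+_\kappa(Q):=\mathcal E_\kappa(X)\cap\mathfrak M^+(Q)$. The inner capacity is $c_\kappa(Q):=\bigl[\inf\{\kappa(\nu,\nu):\nu\in\mathcal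 E_\kappa^+(Q),\ \nu(Q)=1\}\bigr]^{-1}$ ($\inf\varnothing=+\infty$, $1/(+\infty)=0$, $1/0=+\infty$). A property holds nearly everywhere (n.e.) on $Q$ if the set of exceptional points in $Q$ has $c_\kappa$-capacity zero. Potentials of measures in $\mathcal E_\kappa(X)$ are well defined and finite n.e. **Condenser.** $I=I^+\cup I^-$ is a countable index set, $I^+\cap I^-=\varnothing$ ($I^-$ may be empty), $s_i:=+1$ for $i\in I^+$, $s_i:=-1$ for $i\in I^-$. $\mathbf A=(A_i)_{i\in I}$ is a generalized condenser: nonempty Borel sets $A_i\subset X$ such that every compact set meets at most finitely many $A_i$, and $A_i\cap A_j=\varnothing$ for $i\in I^+$, $j\in I^-$. A set $Q\subset X$ is nearly closed if there is a closed set $\breve Q$ with $c_\kappa(Q\bigtriangleup\breve Q)=0$. For nearly closed $A_i$, $\breve A_i$ denotes such a closed set, with $(\breve A_i)_{i\in I}$ locally finite, and $\breve A^{\pm}:=\bigcup_{i\in I^\pm}\breve A_i$. **Vector measures.** $\mathfrak M^+(\mathbf A):=\prod_{i\in I}\mathfrak M^+(A_i)$. A numerical series over $I$ is finite iff it has finite terms and converges absolutely. The energy of $\boldsymbol\mu=(\mu^i)_{i\in I}\in\mathfrak M^+(\mathbf A)$ is $\kappa(\boldsymbol\mu,\boldsymbol\mu):=\sum_{i,j\in I}s_is_j\kappa(\mu^i,\mu^j)$; $\mathcal E^+_\kappa(\mathbf A)$ is the set of $\boldsymbol\mu$ with finite energy. For $\boldsymbol\mu\in\mathcal E^+_\kappa(\mathbf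 A)$ the vector potential has components $\kappa^i_{\boldsymbol\mu}(x):=\sum_{j\in I}s_is_j\kappa(x,\mu^j)$, $i\in I$ (well defined and finite n.e.), and the $\mathbf f$-weighted vector potential has components $W^{\boldsymbol\mu,i}_{\kappa,\mathbf f}:=\kappa^i_{\boldsymbol\mu}+f_i$, $i\in I$. **The problem.** Given: $\mathbf a=(a_i)_{i\in I}$, $a_i>0$; $\mathbf g=(g_i)_{i\in I}$ with continuous $g_i:X\to(0,\infty)$; an external field $\mathbf f=(f_i)_{i\in I}$, $f_i:X\to[-\infty,\infty]$ universally measurable; $I_0\subset I$ (possibly empty); constraints $\xi^i\in\mathfrak M^+(A_i)$, $i\in I_0$, with $\langle g_i,\xi^i\rangle>a_i$. Put $\sigma^i=\xi^i$ for $i\in I_0$, $\sigma^i=\infty$ (no constraint) for $i\in I\setminus I_0$, $\boldsymbol\sigma=(\sigma^i)_{i\in I}$. $\mathcal E^{\boldsymbol\sigma}_{\kappa,\mathbf f}(\mathbf A,\mathbf a,\mathbf g)$ is the set of $\boldsymbol\mu\in\mathcal E_\kappa^+(\mathbf A)$ with $\langle g_i,\mu^i\rangle=a_i$ for all $i\in I$, $\mu^i\leqslant\xi^i$ for all $i\in I_0$, and $\langle\mathbf f,\boldsymbol\mu\rangle:=\sum_{i\in I}\langle f_i,\mu^i\rangle$ finite. $G_{\kappa,\mathbf f}(\boldsymbol\mu):=\kappa(\boldsymbol\mu,\boldsymbol\mu)+2\langle\mathbf f,\boldsymbol\mu\rangle$; $G^{\boldsymbol\sigma}_{\kappa,\mathbf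 f}(\mathbf A,\mathbf a,\mathbf g):=\inf G_{\kappa,\mathbf f}$ over $\mathcal E^{\boldsymbol\sigma}_{\kappa,\mathbf f}(\mathbf A,\mathbf a,\mathbf g)$. $\mathfrak S^{\boldsymbol\sigma}_{\kappa,\mathbf f}(\mathbf A,\mathbf a,\mathbf g)$ is the class of all $\boldsymbol\lambda\in\mathcal E^{\boldsymbol\sigma}_{\kappa,\mathbf f}(\mathbf A,\mathbf a,\mathbf g)$ attaining this infimum. **Permanent assumptions.** $\mathcal E^{\boldsymbol\sigma}_{\kappa,\mathbf f}(\mathbf A,\mathbf a,\mathbf g)\ne\varnothing$, i.e. $G^{\boldsymbol\sigma}_{\kappa,\mathbf f}(\mathbf A,\mathbf a,\mathbf g)<\infty$. Either $X$ is countable at infinity (a countable union of compact sets), or $\inf_{A_i}g_i>0$ for all $i\in I$. One of the following holds: Case I: $f_i\in\Psi(X)$ for all $i\in I$; Case II: $f_i=s_i\kappa(\cdot,\zeta)$ for all $i\in I$, where $\zeta\in\mathcal E_\kappa(X)$ is a given signed measure. *)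

theory Defs
  imports "HOL-Analysis.Analysis"
begin

section \<open>Semicontinuous functions and extended integrals\<close>

text \<open>The space \<open>X\<close> is the type \<open>'a\<close>.  \<open>Psi\<close> is the class of l.s.c. functions into
  \<open>]-\<infinity>, \<infinity>]\<close>, nonnegative unless the space is compact.\<close>

definition Psi :: "('b::topological_space \<Rightarrow> ereal) set" where
  "Psi = {\<psi>. (\<forall>c. open {x. c < \<psi> x}) \<and> (\<forall>x. \<psi> x \<noteq> -\<infinity>)
             \<and> (compact (UNIV :: 'b set) \<or> (\<forall>x. 0 \<le> \<psi> x))}"

text \<open>Extended integral of an \<open>[-\<infinity>, \<infinity>]\<close>-valued function as integral of the positive part minus
  integral of the negative part (\<open>e2ennreal\<close> sends negative numbers to \<open>0\<close>); meaningful unless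
  both are infinite.  Passing to the completion of \<open>M\<close> changes nothing
  (\<open>nn_integral_completion\<close>).  With \<open>M = count_space I\<close> this is the numerical series over \<open>I\<close>,
  and \<open>eint_finite\<close> then says that its terms are finite and it converges absolutely.\<close>

definition eint_defined :: "'b measure \<Rightarrow> ('b \<Rightarrow> ereal) \<Rightarrow> bool" where
  "eint_defined M f \<longleftrightarrow>
     (\<integral>\<^sup>+x. e2ennreal (f x) \<partial>M) < \<infinity> \<or> (\<integral>\<^sup>+x. e2ennreal (- f x) \<partial>M) < \<infinity>"

definition eint_finite :: "'b measure \<Rightarrow> ('b \<Rightarrow> ereal) \<Rightarrow> bool" where
  "eint_finite M f \<longleftrightarrow>
     (\<integral>\<^sup>+x. e2ennreal (f x) \<partial>M) < \<infinity> \<and> (\<integral>\<^sup>+x. e2ennreal (- f x) \<partial>M) < \<infinity>"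

definition eint :: "'b measure \<Rightarrow> ('b \<Rightarrow> ereal) \<Rightarrow> ereal" where
  "eint M f = enn2ereal (\<integral>\<^sup>+x. e2ennreal (f x) \<partial>M) - enn2ereal (\<integral>\<^sup>+x. e2ennreal (- f x) \<partial>M)"


section \<open>Radon measures\<close>

text \<open>A positive Radon measure on the locally compact Hausdorff space is represented by the
  corresponding Borel measure that is finite on compact sets and inner regular with respect to
  compact sets on all Borel sets.  For this (essential) version, a Borel set is negligible iff
  it is locally negligible.\<close>

definition radon :: "'a::t2_space measure \<Rightarrow> bool" where
  "radon \<nu> \<longleftrightarrow> sets \<nu> = sets borel
     \<and> (\<forall>K. compact K \<longrightarrow> emeasure \<nu> K < \<infinity>)
     \<and> (\<forall>B \<in> sets borel. emeasure \<nu> B = (SUP K \<in> {K. compact K \<and> K \<subseteq> B}. emeasure \<nu> K))"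

text \<open>\<open>- Q\<close> is locally negligible; \<open>Q\<close> need not be Borel.\<close>

definition carried_by :: "'a::t2_space measure \<Rightarrow> 'a set \<Rightarrow> bool" where
  "carried_by \<nu> Q \<longleftrightarrow> (\<forall>K. compact K \<longrightarrow> K - Q \<in> null_sets (completion \<nu>))"

definition restrict_measure :: "'a measure \<Rightarrow> 'a set \<Rightarrow> 'a measure" where
  "restrict_measure \<nu> B = density \<nu> (indicator B)"

text \<open>\<open>\<xi> - \<nu>\<close> for \<open>\<nu> \<le> \<xi>\<close>.  (The library's \<open>diff_measure\<close> is unsuitable when both measures
  can be infinite.)\<close>

definition radon_diff :: "'a::t2_space measure \<Rightarrow> 'a measure \<Rightarrow> 'a measure" where
  "radon_diff \<xi> \<nu> = (THE \<tau>. radon \<tau> \<and>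
     (\<forall>B \<in> sets borel. emeasure \<xi> B = emeasure \<nu> B + emeasure \<tau> B))"

definition universally_measurable :: "('a::t2_space \<Rightarrow> ereal) \<Rightarrow> bool" where
  "universally_measurable f \<longleftrightarrow> (\<forall>\<nu>. radon \<nu> \<longrightarrow>
     (\<forall>K. compact K \<longrightarrow> f \<in> borel_measurable (restrict_space (completion \<nu>) K)))"

text \<open>A signed Radon measure is a linear functional on the compactly supported continuous
  functions that need not come from a signed set function; it is represented by its Jordan
  decomposition \<open>(p, n)\<close>, i.e. two positive Radon measures whose infimum in the lattice of Radon
  measures is \<open>0\<close>.\<close>

definition signed_radon :: "'a::t2_space measure \<Rightarrow> 'a measure \<Rightarrow> bool" where
  "signed_radon p n \<longleftrightarrow> radon p \<and> radon n \<and>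
     (\<forall>\<tau>. radon \<tau> \<and> \<tau> \<le> p \<and> \<tau> \<le> n \<longrightarrow> \<tau> = null_measure borel)"


section \<open>Kernels, energies, potentials, capacity\<close>

definition energy_kernel :: "('a::t2_space \<times> 'a \<Rightarrow> ereal) \<Rightarrow> bool" where
  "energy_kernel \<kappa> \<longleftrightarrow> \<kappa> \<in> Psi \<and> (\<forall>x y. \<kappa> (x, y) = \<kappa> (y, x))"

text \<open>\<open>\<integral>\<psi> d(\<mu> \<otimes> \<nu>)\<close> for \<open>\<psi> \<in> Psi\<close>.  The product is that of Radon measures, i.e. the functional
  sending a continuous \<open>h\<close> with compact support on \<open>X \<times> X\<close> to its iterated integral, and the
  integral of an l.s.c. \<open>\<psi>\<close> with respect to a Radon measure is by definition the supremum over such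
  \<open>h \<le> \<psi>\<close>.  The product \<open>\<mu> \<Otimes>\<^sub>M \<nu>\<close> of the library would not do: without a countable base a Borel
  (even l.s.c.) function on \<open>X \<times> X\<close> need not be measurable for the product sigma-algebra, and
  Radon measures need not be sigma-finite.\<close>

definition Cc :: "('b::topological_space \<Rightarrow> real) set" where
  "Cc = {h. continuous_on UNIV h \<and> compact (closure {x. h x \<noteq> 0})}"

definition prod_integral :: "'a::t2_space measure \<Rightarrow> 'a measure \<Rightarrow> ('a \<times> 'a \<Rightarrow> ereal) \<Rightarrow> ereal" where
  "prod_integral \<mu> \<nu> \<psi> =
     (SUP h \<in> {h \<in> Cc. \<forall>z. ereal (h z) \<le> \<psi> z}. ereal (\<integral>x. (\<integral>y. h (x, y) \<partial>\<nu>) \<partial>\<mu>))"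

abbreviation mutual_energy :: "('a::t2_space \<times> 'a \<Rightarrow> ereal) \<Rightarrow> 'a measure \<Rightarrow> 'a measure \<Rightarrow> ereal" where
  "mutual_energy \<kappa> \<mu> \<nu> \<equiv> prod_integral \<mu> \<nu> \<kappa>"

definition potential :: "('a::t2_space \<times> 'a \<Rightarrow> ereal) \<Rightarrow> 'a measure \<Rightarrow> 'a \<Rightarrow> ereal" where
  "potential \<kappa> \<nu> x = eint \<nu> (\<lambda>y. \<kappa> (x, y))"

definition signed_energy_defined ::
    "('a::t2_space \<times> 'a \<Rightarrow> ereal) \<Rightarrow> 'a measure \<Rightarrow> 'a measure \<Rightarrow> bool" where
  "signed_energy_defined \<kappa> p n \<longleftrightarrow>
     \<bar>mutual_energy \<kappa> p p + mutual_energy \<kappa> n n\<bar> \<noteq> \<infinity> \<or> \<bar>mutual_energy \<kappa> p n\<bar> \<noteq> \<infinity>"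

definition signed_energy :: "('a::t2_space \<times> 'a \<Rightarrow> ereal) \<Rightarrow> 'a measure \<Rightarrow> 'a measure \<Rightarrow> ereal" where
  "signed_energy \<kappa> p n = mutual_energy \<kappa> p p + mutual_energy \<kappa> n n - 2 * mutual_energy \<kappa> p n"

definition positive_definite :: "('a::t2_space \<times> 'a \<Rightarrow> ereal) \<Rightarrow> bool" where
  "positive_definite \<kappa> \<longleftrightarrow> (\<forall>p n. signed_radon p n \<and> signed_energy_defined \<kappa> p n \<longrightarrow>
     0 \<le> signed_energy \<kappa> p n)"

definition signed_finite_energy ::
    "('a::t2_space \<times> 'a \<Rightarrow> ereal) \<Rightarrow> 'a measure \<Rightarrow> 'a measure \<Rightarrow> bool" where
  "signed_finite_energy \<kappa> p n \<longleftrightarrow> signed_radon p n \<and> signed_energy_defined \<kappa> p n \<and>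
     \<bar>signed_energy \<kappa> p n\<bar> \<noteq> \<infinity>"

text \<open>\<open>\<E>\<^sup>+\<^sub>\<kappa>(Q)\<close>; for a positive measure the definition of finite signed energy reduces to this.\<close>

definition pos_finite_energy :: "('a::t2_space \<times> 'a \<Rightarrow> ereal) \<Rightarrow> 'a set \<Rightarrow> 'a measure set" where
  "pos_finite_energy \<kappa> Q = {\<nu>. radon \<nu> \<and> carried_by \<nu> Q \<and> \<bar>mutual_energy \<kappa> \<nu> \<nu>\<bar> \<noteq> \<infinity>}"

definition capacity :: "('a::t2_space \<times> 'a \<Rightarrow> ereal) \<Rightarrow> 'a set \<Rightarrow> ereal" where
  "capacity \<kappa> Q = inverse (INF \<nu> \<in> {\<nu> \<in> pos_finite_energy \<kappa> Q. emeasure (completion \<nu>) Q = 1}.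
     mutual_energy \<kappa> \<nu> \<nu>)"

definition nearly_everywhere ::
    "('a::t2_space \<times> 'a \<Rightarrow> ereal) \<Rightarrow> 'a set \<Rightarrow> ('a \<Rightarrow> bool) \<Rightarrow> bool" where
  "nearly_everywhere \<kappa> Q P \<longleftrightarrow> capacity \<kappa> {x \<in> Q. \<not> P x} = 0"


section \<open>Condensers and vector measures\<close>

definition generalized_condenser :: "'i set \<Rightarrow> 'i set \<Rightarrow> ('i \<Rightarrow> 'a::t2_space set) \<Rightarrow> bool" where
  "generalized_condenser Ipos Ineg A \<longleftrightarrow>
     countable (Ipos \<union> Ineg) \<and> Ipos \<inter> Ineg = {}
     \<and> (\<forall>i \<in> Ipos \<union> Ineg. A i \<noteq> {} \<and> A i \<in> sets borel)
     \<and> (\<forall>K. compact K \<longrightarrow> finite {i \<in> Ipos \<union> Ineg. A i \<inter> K \<noteq> {}})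
     \<and> (\<forall>i \<in> Ipos. \<forall>j \<in> Ineg. A i \<inter> A j = {})"

text \<open>The \<open>A i\<close> are nearly closed, and \<open>B\<close> is a locally finite choice of associated closed sets.\<close>

definition nearly_closed_via ::
    "('a::t2_space \<times> 'a \<Rightarrow> ereal) \<Rightarrow> 'i set \<Rightarrow> ('i \<Rightarrow> 'a set) \<Rightarrow> ('i \<Rightarrow> 'a set) \<Rightarrow> bool" where
  "nearly_closed_via \<kappa> I A B \<longleftrightarrow>
     (\<forall>i \<in> I. closed (B i) \<and> capacity \<kappa> ((A i - B i) \<union> (B i - A i)) = 0)
     \<and> (\<forall>x. \<exists>U. open U \<and> x \<in> U \<and> finite {i \<in> I. B i \<inter> U \<noteq> {}})"

definition plate_sign :: "'i set \<Rightarrow> 'i \<Rightarrow> ereal" where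
  "plate_sign Ipos i = (if i \<in> Ipos then 1 else - 1)"

abbreviation energy_terms ::
    "('a::t2_space \<times> 'a \<Rightarrow> ereal) \<Rightarrow> 'i set \<Rightarrow> ('i \<Rightarrow> 'a measure) \<Rightarrow> 'i \<times> 'i \<Rightarrow> ereal" where
  "energy_terms \<kappa> Ipos \<mu> \<equiv>
     (\<lambda>(i, j). plate_sign Ipos i * plate_sign Ipos j * mutual_energy \<kappa> (\<mu> i) (\<mu> j))"

definition vector_energy ::
    "('a::t2_space \<times> 'a \<Rightarrow> ereal) \<Rightarrow> 'i set \<Rightarrow> 'i set \<Rightarrow> ('i \<Rightarrow> 'a measure) \<Rightarrow> ereal" where
  "vector_energy \<kappa> Ipos Ineg \<mu> =
     eint (count_space ((Ipos \<union> Ineg) \<times> (Ipos \<union> Ineg))) (energy_terms \<kappa> Ipos \<mu>)"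

text \<open>\<open>\<E>\<^sup>+\<^sub>\<kappa>(A)\<close>.  A vector measure is a function on the index type; only its values on
  \<open>Ipos \<union> Ineg\<close> matter.\<close>

definition vector_finite_energy ::
    "('a::t2_space \<times> 'a \<Rightarrow> ereal) \<Rightarrow> 'i set \<Rightarrow> 'i set \<Rightarrow> ('i \<Rightarrow> 'a set) \<Rightarrow> ('i \<Rightarrow> 'a measure) set" where
  "vector_finite_energy \<kappa> Ipos Ineg A =
     {\<mu>. (\<forall>i \<in> Ipos \<union> Ineg. radon (\<mu> i) \<and> carried_by (\<mu> i) (A i))
         \<and> eint_finite (count_space ((Ipos \<union> Ineg) \<times> (Ipos \<union> Ineg))) (energy_terms \<kappa> Ipos \<mu>)}"

abbreviation potential_terms ::
    "('a::t2_space \<times> 'a \<Rightarrow> ereal) \<Rightarrow> 'i set \<Rightarrow> ('i \<Rightarrow> 'a measure) \<Rightarrow> 'i \<Rightarrow> 'a \<Rightarrow> 'i \<Rightarrow> ereal" where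
  "potential_terms \<kappa> Ipos \<mu> i x \<equiv>
     (\<lambda>j. plate_sign Ipos i * plate_sign Ipos j * potential \<kappa> (\<mu> j) x)"

definition vector_potential ::
    "('a::t2_space \<times> 'a \<Rightarrow> ereal) \<Rightarrow> 'i set \<Rightarrow> 'i set \<Rightarrow> ('i \<Rightarrow> 'a measure) \<Rightarrow> 'i \<Rightarrow> 'a \<Rightarrow> ereal" where
  "vector_potential \<kappa> Ipos Ineg \<mu> i x = eint (count_space (Ipos \<union> Ineg)) (potential_terms \<kappa> Ipos \<mu> i x)"

definition weighted_potential ::
    "('a::t2_space \<times> 'a \<Rightarrow> ereal) \<Rightarrow> ('i \<Rightarrow> 'a \<Rightarrow> ereal) \<Rightarrow> 'i set \<Rightarrow> 'i set \<Rightarrow> ('i \<Rightarrow> 'a measure)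
      \<Rightarrow> 'i \<Rightarrow> 'a \<Rightarrow> ereal" where
  "weighted_potential \<kappa> f Ipos Ineg \<mu> i x = vector_potential \<kappa> Ipos Ineg \<mu> i x + f i x"

text \<open>Points at which neither the series of potentials nor the sum with \<open>f i\<close> produces
  \<open>\<infinity> - \<infinity>\<close>.  Points outside count as exceptional in any (in)equality for the weighted
  potential.\<close>

definition weighted_potential_defined ::
    "('a::t2_space \<times> 'a \<Rightarrow> ereal) \<Rightarrow> ('i \<Rightarrow> 'a \<Rightarrow> ereal) \<Rightarrow> 'i set \<Rightarrow> 'i set \<Rightarrow> ('i \<Rightarrow> 'a measure)
      \<Rightarrow> 'i \<Rightarrow> 'a \<Rightarrow> bool" where
  "weighted_potential_defined \<kappa> f Ipos Ineg \<mu> i x \<longleftrightarrow>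
     eint_defined (count_space (Ipos \<union> Ineg)) (potential_terms \<kappa> Ipos \<mu> i x)
     \<and> \<not> (vector_potential \<kappa> Ipos Ineg \<mu> i x = \<infinity> \<and> f i x = -\<infinity>)
     \<and> \<not> (vector_potential \<kappa> Ipos Ineg \<mu> i x = -\<infinity> \<and> f i x = \<infinity>)"


section \<open>The constrained Gauss variational problem\<close>

text \<open>\<open>Case II\<close>: the potential of the signed measure \<open>(p, n)\<close> is undefined where both parts have
  infinite potential (a set of capacity zero if the energy is finite); there the values of
  \<open>f i\<close> are left arbitrary.\<close>

definition field_case_I :: "'i set \<Rightarrow> ('i \<Rightarrow> 'a::t2_space \<Rightarrow> ereal) \<Rightarrow> bool" where
  "field_case_I I f \<longleftrightarrow> (\<forall>i \<in> I. f i \<in> Psi)"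

definition field_case_II ::
    "('a::t2_space \<times> 'a \<Rightarrow> ereal) \<Rightarrow> 'i set \<Rightarrow> 'i set \<Rightarrow> ('i \<Rightarrow> 'a \<Rightarrow> ereal) \<Rightarrow> bool" where
  "field_case_II \<kappa> Ipos Ineg f \<longleftrightarrow> (\<exists>p n. signed_finite_energy \<kappa> p n \<and>
     (\<forall>i \<in> Ipos \<union> Ineg. \<forall>x. \<not> (potential \<kappa> p x = \<infinity> \<and> potential \<kappa> n x = \<infinity>) \<longrightarrow>
        f i x = plate_sign Ipos i * (potential \<kappa> p x - potential \<kappa> n x)))"

definition admissible ::
    "('a::t2_space \<times> 'a \<Rightarrow> ereal) \<Rightarrow> ('i \<Rightarrow> 'a \<Rightarrow> ereal) \<Rightarrow> 'i set \<Rightarrow> 'i set \<Rightarrow> 'i set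
      \<Rightarrow> ('i \<Rightarrow> 'a measure) \<Rightarrow> ('i \<Rightarrow> 'a set) \<Rightarrow> ('i \<Rightarrow> real) \<Rightarrow> ('i \<Rightarrow> 'a \<Rightarrow> real)
      \<Rightarrow> ('i \<Rightarrow> 'a measure) set" where
  "admissible \<kappa> f Ipos Ineg I0 \<xi> A a g =
     {\<mu> \<in> vector_finite_energy \<kappa> Ipos Ineg A.
        (\<forall>i \<in> Ipos \<union> Ineg. eint (\<mu> i) (\<lambda>x. ereal (g i x)) = ereal (a i))
        \<and> (\<forall>i \<in> I0. \<mu> i \<le> \<xi> i)
        \<and> (\<forall>i \<in> Ipos \<union> Ineg. eint_finite (\<mu> i) (f i))
        \<and> eint_finite (count_space (Ipos \<union> Ineg)) (\<lambda>i. eint (\<mu> i) (f i))}"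

definition gauss_functional ::
    "('a::t2_space \<times> 'a \<Rightarrow> ereal) \<Rightarrow> ('i \<Rightarrow> 'a \<Rightarrow> ereal) \<Rightarrow> 'i set \<Rightarrow> 'i set \<Rightarrow> ('i \<Rightarrow> 'a measure)
      \<Rightarrow> ereal" where
  "gauss_functional \<kappa> f Ipos Ineg \<mu> =
     vector_energy \<kappa> Ipos Ineg \<mu> + 2 * eint (count_space (Ipos \<union> Ineg)) (\<lambda>i. eint (\<mu> i) (f i))"

definition gauss_value ::
    "('a::t2_space \<times> 'a \<Rightarrow> ereal) \<Rightarrow> ('i \<Rightarrow> 'a \<Rightarrow> ereal) \<Rightarrow> 'i set \<Rightarrow> 'i set \<Rightarrow> 'i set
      \<Rightarrow> ('i \<Rightarrow> 'a measure) \<Rightarrow> ('i \<Rightarrow> 'a set) \<Rightarrow> ('i \<Rightarrow> real) \<Rightarrow> ('i \<Rightarrow> 'a \<Rightarrow> real) \<Rightarrow> ereal" where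
  "gauss_value \<kappa> f Ipos Ineg I0 \<xi> A a g =
     (INF \<mu> \<in> admissible \<kappa> f Ipos Ineg I0 \<xi> A a g. gauss_functional \<kappa> f Ipos Ineg \<mu>)"

definition gauss_solutions ::
    "('a::t2_space \<times> 'a \<Rightarrow> ereal) \<Rightarrow> ('i \<Rightarrow> 'a \<Rightarrow> ereal) \<Rightarrow> 'i set \<Rightarrow> 'i set \<Rightarrow> 'i set
      \<Rightarrow> ('i \<Rightarrow> 'a measure) \<Rightarrow> ('i \<Rightarrow> 'a set) \<Rightarrow> ('i \<Rightarrow> real) \<Rightarrow> ('i \<Rightarrow> 'a \<Rightarrow> real)
      \<Rightarrow> ('i \<Rightarrow> 'a measure) set" where
  "gauss_solutions \<kappa> f Ipos Ineg I0 \<xi> A a g =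
     {\<mu> \<in> admissible \<kappa> f Ipos Ineg I0 \<xi> A a g.
        gauss_functional \<kappa> f Ipos Ineg \<mu> = gauss_value \<kappa> f Ipos Ineg I0 \<xi> A a g}"

text \<open>The finiteness set of the field component \<open>f i\<close> in \<open>A i\<close>.\<close>

definition finite_part :: "('i \<Rightarrow> 'a \<Rightarrow> ereal) \<Rightarrow> ('i \<Rightarrow> 'a set) \<Rightarrow> 'i \<Rightarrow> 'a set" where
  "finite_part f A i = {x \<in> A i. \<bar>f i x\<bar> < \<infinity>}"

end

theory Submission
  imports Defs
begin

text \<open>The components of admissible vector measures are finite Radon measures.  Radon measures are
  \<open>\<tau>\<close>-smooth on lower semicontinuous functions, so mutual energies are iterated integrals, and
  \<open>\<kappa>(\<mu> - \<nu>, \<mu> - \<nu>) \<ge> 0\<close> for \<open>\<mu>\<close>, \<open>\<nu>\<close> of finite energy.  Adding up the components of a vector measure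
  with the same sign turns the Gauss functional into a convex quadratic functional of one signed
  measure.  Its derivative at \<open>\<lambda>\<close> in the direction \<open>\<mu> - \<lambda>\<close> is twice the sum of the integrals of the
  weighted potentials \<open>W\<^sup>i\<close> with respect to \<open>\<mu>\<^sup>i - \<lambda>\<^sup>i\<close>, so \<open>\<lambda>\<close> is a solution iff no single component can
  be varied in a decreasing direction.  For a free component this is tested by moving mass to a set
  where \<open>W\<^sup>i < w g\<^sub>i\<close>, for a constrained one by exchanging mass of \<open>\<xi>\<^sup>i - \<lambda>\<^sup>i\<close> where \<open>W\<^sup>i / g\<^sub>i\<close> is small
  against mass of \<open>\<lambda>\<^sup>i\<close> where it is large.  The measures \<open>\<xi>\<^sup>i - \<lambda>\<^sup>i\<close> need not be \<open>\<sigma>\<close>-finite; the exceptional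
  sets can still be taken Borel because \<open>f\<^sub>i\<close> is Borel off a Borel set that no measure of finite
  energy charges.\<close>

section \<open>Semicontinuous functions and Radon measures\<close>

text \<open>Without a countable base, monotone convergence does not reach suprema over uncountable
  families, and an l.s.c. kernel need not be measurable for a product sigma-algebra. Compactness
  closes both gaps: inner regularity reduces a directed supremum of l.s.c. functions to finitely
  many members, and a nonnegative l.s.c. function is a supremum of continuous functions with compact
  support. Subtraction is the second obstacle. Integrals live in \<open>ennreal\<close>, so every
  inequality about a difference of measures is phrased as one between sums of positive measures, and
  only real numbers already known to be finite are subtracted. Masses are finite because component i
  has mass at most a_i divided by the infimum of g_i on A_i, and these quotients are summable. The
  multipliers have different origins. For a free component, integrating the equality W = w g against
  \<lambda> leaves only w = (integral of W) / a_i. For a constrained component w is a Dedekind cut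
  between lower bounds of W / g under \<xi> - \<lambda> and upper bounds under \<lambda>; it need
  not be unique.\<close>

definition lsc :: "('b::topological_space \<Rightarrow> ennreal) \<Rightarrow> bool" where
  "lsc f \<longleftrightarrow> (\<forall>c. open {x. c < f x})"

lemma lsc_measurable:
  assumes "lsc f" "sets M = sets borel"
  shows "f \<in> borel_measurable M"
proof -
  have "f \<in> borel_measurable borel"
    using assms(1) by (intro borel_measurableI_greater) (auto simp: lsc_def)
  then show ?thesis using assms(2) measurable_cong_sets by blast
qed

lemma lsc_SUP:
  assumes "\<And>j. j \<in> J \<Longrightarrow> lsc (F j)"
  shows "lsc (\<lambda>x. SUP j\<in>J. F j x)"
proof -
  have "{x. c < (SUP j\<in>J. F j x)} = (\<Union>j\<in>J. {x. c < F j x})" for c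
    by (auto simp: less_SUP_iff)
  then show ?thesis using assms by (auto simp: lsc_def)
qed

lemma lsc_continuous:
  fixes f :: "'b::topological_space \<Rightarrow> ennreal"
  assumes "continuous_on UNIV f"
  shows "lsc f"
  unfolding lsc_def
proof
  fix c
  have "open (f -` {c<..})" using assms by (intro open_vimage) auto
  then show "open {x. c < f x}" by (simp add: vimage_def)
qed

lemma lsc_section:
  assumes "lsc \<psi>"
  shows "lsc (\<lambda>y. \<psi> (x, y))"
  unfolding lsc_def
proof
  fix c
  have "open (Pair x -` {z. c < \<psi> z})"
    using assms by (intro open_vimage continuous_intros) (auto simp: lsc_def)
  then show "open {y. c < \<psi> (x, y)}" by (simp add: vimage_def)
qed

text \<open>Induction on the binary rule; the index \<open>l\<close> has to serve all members of
  \<open>C\<close> at once, which is why directedness is assumed jointly. Used for the finitely many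
  values of a simple function and for finitely many measures tested on compact sets.\<close>

lemma SUP_sum_directed_ennreal:
  fixes f :: "'c \<Rightarrow> 'j \<Rightarrow> ennreal"
  assumes "finite C" "J \<noteq> {}"
    and dir: "\<And>i j. i \<in> J \<Longrightarrow> j \<in> J \<Longrightarrow> \<exists>l\<in>J. \<forall>c\<in>C. f c i \<le> f c l \<and> f c j \<le> f c l"
  shows "(\<Sum>c\<in>C. SUP j\<in>J. f c j) = (SUP j\<in>J. \<Sum>c\<in>C. f c j)"
  using assms(1) dir
proof (induction C)
  case empty
  then show ?case using assms(2) by simp
next
  case (insert a C)
  have IH: "(\<Sum>c\<in>C. SUP j\<in>J. f c j) = (SUP j\<in>J. \<Sum>c\<in>C. f c j)"
  proof (rule insert.IH)
    fix i j assume "i \<in> J" "j \<in> J"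
    then show "\<exists>l\<in>J. \<forall>c\<in>C. f c i \<le> f c l \<and> f c j \<le> f c l"
      using insert.prems[of i j] by auto
  qed
  have "(SUP j\<in>J. f a j) + (SUP j\<in>J. \<Sum>c\<in>C. f c j) = (SUP j\<in>J. f a j + (\<Sum>c\<in>C. f c j))"
  proof (rule SUP_add_directed_ennreal[symmetric])
    fix i j assume "i \<in> J" "j \<in> J"
    then obtain l where "l \<in> J" "\<forall>c\<in>insert a C. f c i \<le> f c l \<and> f c j \<le> f c l"
      using insert.prems[of i j] by blast
    then show "\<exists>k\<in>J. f a i + (\<Sum>c\<in>C. f c j) \<le> f a k + (\<Sum>c\<in>C. f c k)"
      by (intro bexI[of _ l] add_mono sum_mono) auto
  qed
  with IH insert.hyps show ?case by simp
qed

lemma directed_finite_bound: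
  assumes "finite J'" "J' \<subseteq> J" "J \<noteq> {}"
    and dir: "\<And>i j. i \<in> J \<Longrightarrow> j \<in> J \<Longrightarrow> \<exists>l\<in>J. U i \<subseteq> U l \<and> U j \<subseteq> U l"
  shows "\<exists>l\<in>J. (\<Union>j\<in>J'. U j) \<subseteq> U l"
  using assms(1,2)
proof (induction J')
  case empty
  then show ?case using \<open>J \<noteq> {}\<close> by auto
next
  case (insert j J')
  then obtain l where l: "l \<in> J" "(\<Union>j\<in>J'. U j) \<subseteq> U l" by auto
  obtain m where "m \<in> J" "U j \<subseteq> U m" "U l \<subseteq> U m" using dir[of j l] insert.prems l by auto
  with l show ?case by auto
qed

section \<open>Inner regularity and \<tau>-smoothness of Radon measures\<close>

lemma
  assumes "radon \<nu>"
  shows radon_sets: "sets \<nu> = sets borel"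
    and radon_space: "space \<nu> = UNIV"
    and radon_compact: "compact K \<Longrightarrow> emeasure \<nu> K < \<infinity>"
    and radon_inner: "E \<in> sets borel \<Longrightarrow> emeasure \<nu> E = (SUP K \<in> {K. compact K \<and> K \<subseteq> E}. emeasure \<nu> K)"
proof -
  note r = assms[unfolded radon_def]
  show *: "sets \<nu> = sets borel" using r by (rule conjunct1)
  show "space \<nu> = UNIV" using sets_eq_imp_space_eq[OF *] by simp
  show "compact K \<Longrightarrow> emeasure \<nu> K < \<infinity>" using r[THEN conjunct2, THEN conjunct1] by simp
  show "E \<in> sets borel \<Longrightarrow> emeasure \<nu> E = (SUP K \<in> {K. compact K \<and> K \<subseteq> E}. emeasure \<nu> K)"
    using r[THEN conjunct2, THEN conjunct2] by (rule bspec)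
qed

lemma radon_inner_less:
  assumes "radon \<nu>" "E \<in> sets borel" "c < emeasure \<nu> E"
  obtains K where "compact K" "K \<subseteq> E" "c < emeasure \<nu> K"
proof -
  have "c < (SUP K \<in> {K. compact K \<and> K \<subseteq> E}. emeasure \<nu> K)"
    using assms(3) radon_inner[OF assms(1,2)] by simp
  then show ?thesis using that by (auto simp: less_SUP_iff)
qed

text \<open>By inner regularity it is enough to bound the measure of compact parts of
  \<open>E\<close>. Such a part is covered by finitely many \<open>U j\<close>, hence by a single
  one. The index set may be uncountable, so continuity from below would not suffice.\<close>

lemma radon_directed_open:
  assumes "radon \<nu>" "E \<in> sets borel" "J \<noteq> {}" "\<And>j. j \<in> J \<Longrightarrow> open (U j)"
    and dir: "\<And>i j. i \<in> J \<Longrightarrow> j \<in> J \<Longrightarrow> \<exists>l\<in>J. U i \<subseteq> U l \<and> U j \<subseteq> U l"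
    and cover: "E \<subseteq> (\<Union>j\<in>J. U j)"
  shows "emeasure \<nu> E \<le> (SUP j\<in>J. emeasure \<nu> (E \<inter> U j))"
proof (rule ccontr)
  assume "\<not> ?thesis"
  then have "(SUP j\<in>J. emeasure \<nu> (E \<inter> U j)) < emeasure \<nu> E" by simp
  then obtain K where K: "compact K" "K \<subseteq> E" "(SUP j\<in>J. emeasure \<nu> (E \<inter> U j)) < emeasure \<nu> K"
    by (rule radon_inner_less[OF assms(1,2)])
  obtain J' where J': "J' \<subseteq> J" "finite J'" "K \<subseteq> (\<Union>j\<in>J'. U j)"
  proof (rule compactE_image[OF K(1)])
    show "K \<subseteq> (\<Union>j\<in>J. U j)" using K(2) cover by (rule order_trans)
  qed (use assms(4) in auto)
  obtain l where l: "l \<in> J" "(\<Union>j\<in>J'. U j) \<subseteq> U l"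
    using directed_finite_bound[OF J'(2,1) assms(3) dir] by blast
  have "emeasure \<nu> K \<le> emeasure \<nu> (E \<inter> U l)"
    using K J' l assms(1,2,4) by (intro emeasure_mono) (auto simp: radon_sets)
  also have "\<dots> \<le> (SUP j\<in>J. emeasure \<nu> (E \<inter> U j))" using l by (intro SUP_upper)
  finally show False using K(3) by simp
qed

text \<open>Works level by level: where a simple minorant takes the value c, the open sets {r c < F
  j} cover the level set for every r < 1, so \<open>radon_directed_open\<close> applies there. The
  finitely many levels can share one index.\<close>

lemma radon_tau_smooth:
  assumes \<nu>: "radon \<nu>" and "J \<noteq> {}" and lsc: "\<And>j. j \<in> J \<Longrightarrow> lsc (F j)"
    and dir: "\<And>i j. i \<in> J \<Longrightarrow> j \<in> J \<Longrightarrow> \<exists>l\<in>J. \<forall>x. F i x \<le> F l x \<and> F j x \<le> F l x"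
  shows "(\<integral>\<^sup>+x. (SUP j\<in>J. F j x) \<partial>\<nu>) = (SUP j\<in>J. \<integral>\<^sup>+x. F j x \<partial>\<nu>)"
proof (rule antisym)
  show "(SUP j\<in>J. \<integral>\<^sup>+x. F j x \<partial>\<nu>) \<le> (\<integral>\<^sup>+x. (SUP j\<in>J. F j x) \<partial>\<nu>)"
    by (intro SUP_least nn_integral_mono SUP_upper)
next
  have meas: "F j \<in> borel_measurable \<nu>" if "j \<in> J" for j
    using lsc_measurable[OF lsc[OF that]] radon_sets[OF \<nu>] by simp
  have "integral\<^sup>S \<nu> s \<le> (SUP j\<in>J. \<integral>\<^sup>+x. F j x \<partial>\<nu>)"
    if s: "simple_function \<nu> s" "s \<le> (\<lambda>x. SUP j\<in>J. F j x)" "\<And>x. s x < top" for s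
  proof (rule ennreal_approx_unit)
    \<comment> \<open>The factor \<open>r\<close> turns c \<le> SUP into r c < SUP, so that at each
      point some single \<open>F j\<close> exceeds r c. This strictness needs 0 < c < top: the level
      c = 0 contributes nothing, and finite values are granted by
      \<open>nn_integral_def_finite\<close>.\<close>
    fix r :: ennreal assume r: "0 < r" "r < 1"
    define L where "L c = s -` {c}" for c
    define U where "U c j = {x. r * c < F j x}" for c j
    have L: "L c \<in> sets borel" for c
      using simple_functionD(2)[OF s(1), of "{c}"] radon_sets[OF \<nu>] radon_space[OF \<nu>]
      by (simp add: L_def)
    have U: "open (U c j)" if "j \<in> J" for c j using lsc[OF that] by (simp add: lsc_def U_def)
    have step: "r * (c * emeasure \<nu> (L c)) \<le> (SUP j\<in>J. r * c * emeasure \<nu> (L c \<inter> U c j))" for c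
    proof (cases "c = 0 \<or> L c = {}")
      case True
      then show ?thesis by auto
    next
      case False
      then obtain x0 where "s x0 = c" by (auto simp: L_def)
      then have c: "0 < c" "c < top" using False s(3)[of x0] by (auto simp: zero_less_iff_neq_zero)
      have rc: "r * c < c"
        using ennreal_mult_strict_right_mono[OF r(2), of c] c by simp
      have "L c \<subseteq> (\<Union>j\<in>J. U c j)"
      proof
        fix x assume "x \<in> L c"
        then have "r * c < (SUP j\<in>J. F j x)" using rc s(2) by (auto simp: L_def le_fun_def intro: less_le_trans)
        then show "x \<in> (\<Union>j\<in>J. U c j)" by (auto simp: less_SUP_iff U_def)
      qed
      moreover have "\<exists>l\<in>J. U c i \<subseteq> U c l \<and> U c j \<subseteq> U c l" if ij: "i \<in> J" "j \<in> J" for i j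
      proof -
        obtain l where "l \<in> J" "\<forall>x. F i x \<le> F l x \<and> F j x \<le> F l x" using dir[OF ij] by blast
        then show ?thesis by (intro bexI[of _ l]) (auto simp: U_def intro: less_le_trans)
      qed
      ultimately have "emeasure \<nu> (L c) \<le> (SUP j\<in>J. emeasure \<nu> (L c \<inter> U c j))"
        using U by (intro radon_directed_open[OF \<nu> L \<open>J \<noteq> {}\<close>]) auto
      then have "r * c * emeasure \<nu> (L c) \<le> r * c * (SUP j\<in>J. emeasure \<nu> (L c \<inter> U c j))"
        by (rule mult_left_mono) simp
      then show ?thesis by (simp add: SUP_mult_left_ennreal mult.assoc)
    qed
    have fin: "finite (range s)" using simple_functionD(1)[OF s(1)] radon_space[OF \<nu>] by simp
    have "r * integral\<^sup>S \<nu> s = (\<Sum>c\<in>range s. r * (c * emeasure \<nu> (L c)))"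
      by (simp add: simple_integral_def sum_distrib_left radon_space[OF \<nu>] L_def)
    also have "\<dots> \<le> (\<Sum>c\<in>range s. SUP j\<in>J. r * c * emeasure \<nu> (L c \<inter> U c j))"
      by (intro sum_mono step)
    also have "\<dots> = (SUP j\<in>J. \<Sum>c\<in>range s. r * c * emeasure \<nu> (L c \<inter> U c j))"
    proof (rule SUP_sum_directed_ennreal[OF fin \<open>J \<noteq> {}\<close>])
      fix i j assume ij: "i \<in> J" "j \<in> J"
      then obtain l where l: "l \<in> J" "\<forall>x. F i x \<le> F l x \<and> F j x \<le> F l x" using dir by blast
      have "U c i \<subseteq> U c l" "U c j \<subseteq> U c l" for c
        using l(2) by (auto simp: U_def intro: less_le_trans)
      then show "\<exists>l\<in>J. \<forall>c\<in>range s. r * c * emeasure \<nu> (L c \<inter> U c i) \<le> r * c * emeasure \<nu> (L c \<inter> U c l)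
          \<and> r * c * emeasure \<nu> (L c \<inter> U c j) \<le> r * c * emeasure \<nu> (L c \<inter> U c l)"
        using l(1) L U radon_sets[OF \<nu>]
        by (intro bexI[of _ l] ballI conjI mult_left_mono emeasure_mono) auto
    qed
    also have "\<dots> \<le> (SUP j\<in>J. \<integral>\<^sup>+x. F j x \<partial>\<nu>)"
    proof (rule SUP_subset_mono[OF order_refl])
      fix j assume j: "j \<in> J"
      have [measurable]: "L c \<inter> U c j \<in> sets \<nu>" for c
        using L U[OF j] radon_sets[OF \<nu>] by auto
      have "(\<Sum>c\<in>range s. r * c * emeasure \<nu> (L c \<inter> U c j))
          = (\<integral>\<^sup>+x. (\<Sum>c\<in>range s. r * c * indicator (L c \<inter> U c j) x) \<partial>\<nu>)"
        by (subst nn_integral_sum) (auto simp: nn_integral_cmult_indicator)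
      also have "\<dots> \<le> (\<integral>\<^sup>+x. F j x \<partial>\<nu>)"
      proof (rule nn_integral_mono)
        fix x
        have "(\<Sum>c\<in>range s. r * c * indicator (L c \<inter> U c j) x)
            = (\<Sum>c\<in>{s x}. r * c * indicator (L c \<inter> U c j) x)"
          using fin by (intro sum.mono_neutral_right) (auto simp: L_def split: split_indicator)
        also have "\<dots> = r * s x * indicator (L (s x) \<inter> U (s x) j) x"
          by (subst sum.insert) auto
        also have "\<dots> \<le> F j x"
          by (cases "x \<in> U (s x) j") (auto simp: U_def split: split_indicator)
        finally show "(\<Sum>c\<in>range s. r * c * indicator (L c \<inter> U c j) x) \<le> F j x" .
      qed
      finally show "(\<Sum>c\<in>range s. r * c * emeasure \<nu> (L c \<inter> U c j)) \<le> (\<integral>\<^sup>+x. F j x \<partial>\<nu>)" .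
    qed
    finally show "r * integral\<^sup>S \<nu> s \<le> (SUP j\<in>J. \<integral>\<^sup>+x. F j x \<partial>\<nu>)" .
  qed
  then show "(\<integral>\<^sup>+x. (SUP j\<in>J. F j x) \<partial>\<nu>) \<le> (SUP j\<in>J. \<integral>\<^sup>+x. F j x \<partial>\<nu>)"
    unfolding nn_integral_def_finite by (intro SUP_least) auto
qed

section \<open>Compactly supported functions and iterated integrals\<close>

lemma CcI:
  fixes h :: "'b::t2_space \<Rightarrow> real"
  assumes "continuous_on UNIV h" "compact K" "\<And>z. z \<notin> K \<Longrightarrow> h z = 0"
  shows "h \<in> Cc"
proof -
  have "closure {z. h z \<noteq> 0} \<subseteq> K"
    using assms(2,3) by (intro closure_minimal) (auto intro: compact_imp_closed)
  then have "compact (closure {z. h z \<noteq> 0})"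
    using compact_Int_closed[OF assms(2) closed_closure, of "{z. h z \<noteq> 0}"] by (simp add: Int_absorb1)
  then show ?thesis using assms(1) by (simp add: Cc_def)
qed

lemma CcE:
  fixes h :: "'b::t2_space \<Rightarrow> real"
  assumes "h \<in> Cc"
  obtains K where "continuous_on UNIV h" "compact K" "\<And>z. z \<notin> K \<Longrightarrow> h z = 0"
proof
  show "compact (closure {z. h z \<noteq> 0})" "continuous_on UNIV h" using assms by (auto simp: Cc_def)
  show "h z = 0" if "z \<notin> closure {z. h z \<noteq> 0}" for z
    using that closure_subset[of "{z. h z \<noteq> 0}"] by auto
qed

lemma Cc_max_zero:
  fixes h :: "'b::t2_space \<Rightarrow> real"
  assumes "h \<in> Cc"
  shows "(\<lambda>z. max (h z) 0) \<in> Cc"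
proof -
  obtain K where "continuous_on UNIV h" "compact K" "\<And>z. z \<notin> K \<Longrightarrow> h z = 0"
    using CcE[OF assms] by metis
  then show ?thesis by (intro CcI[of _ K] continuous_intros) auto
qed

lemma Cc_bounded:
  fixes h :: "'b::t2_space \<Rightarrow> real"
  assumes "h \<in> Cc"
  obtains b where "0 \<le> b" "\<And>z. \<bar>h z\<bar> \<le> b"
proof -
  obtain K where K: "continuous_on UNIV h" "compact K" "\<And>z. z \<notin> K \<Longrightarrow> h z = 0"
    using CcE[OF assms] by metis
  have "bounded (h ` K)"
    using K by (intro compact_imp_bounded compact_continuous_image) (auto intro: continuous_on_subset)
  then obtain b where b: "\<And>z. z \<in> K \<Longrightarrow> \<bar>h z\<bar> \<le> b" by (auto simp: bounded_iff)
  have "\<bar>h z\<bar> \<le> max b 0" for z using b[of z] K(3)[of z] by (cases "z \<in> K") auto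
  then show ?thesis using that[of "max b 0"] by simp
qed

lemma Cc_integrable:
  assumes "h \<in> Cc" "radon \<nu>"
  shows "integrable \<nu> h"
proof -
  obtain K where K: "continuous_on UNIV h" "compact K" "\<And>z. z \<notin> K \<Longrightarrow> h z = 0"
    using CcE[OF assms(1)] by metis
  obtain b where b: "\<And>z. \<bar>h z\<bar> \<le> b" using Cc_bounded[OF assms(1)] by metis
  have "h \<in> borel_measurable \<nu>"
    using borel_measurable_continuous_onI[OF K(1)] radon_sets[OF assms(2)] measurable_cong_sets by blast
  then show ?thesis
    using K b radon_compact[OF assms(2) K(2)] radon_sets[OF assms(2)]
    by (intro integrableI_bounded_set[of K _ _ b]) (auto intro: borel_closed compact_imp_closed)
qed

lemma Cc_section:
  fixes h :: "'a::t2_space \<times> 'b::t2_space \<Rightarrow> real"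
  assumes "h \<in> Cc"
  shows "(\<lambda>y. h (x, y)) \<in> Cc"
proof -
  obtain K where K: "continuous_on UNIV h" "compact K" "\<And>z. z \<notin> K \<Longrightarrow> h z = 0"
    using CcE[OF assms] by metis
  show ?thesis
  proof (rule CcI[of _ "snd ` K"])
    show "continuous_on UNIV (\<lambda>y. h (x, y))"
      by (intro continuous_on_compose2[OF K(1)] continuous_intros) auto
    show "compact (snd ` K)" by (intro compact_continuous_image K continuous_intros)
    show "h (x, y) = 0" if "y \<notin> snd ` K" for y using that by (intro K(3)) force
  qed
qed

text \<open>Dominated convergence would give sequential continuity only, which is too weak without a
  countable base at each point. Instead, sections over nearby points are uniformly close on the
  compact projection of the support.\<close>

lemma Cc_partial_integral:
  fixes h :: "'a::t2_space \<times> 'b::t2_space \<Rightarrow> real"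
  assumes h: "h \<in> Cc" and \<nu>: "radon \<nu>"
  shows "(\<lambda>x. \<integral>y. h (x, y) \<partial>\<nu>) \<in> Cc"
proof -
  obtain K where K: "continuous_on UNIV h" "compact K" "\<And>z. z \<notin> K \<Longrightarrow> h z = 0"
    using CcE[OF h] by metis
  have C: "compact (fst ` K)" "compact (snd ` K)"
    by (intro compact_continuous_image K continuous_intros)+
  have snd: "snd ` K \<in> sets \<nu>" "emeasure \<nu> (snd ` K) < \<infinity>"
    using C(2) radon_compact[OF \<nu> C(2)] radon_sets[OF \<nu>] by (auto intro: borel_closed compact_imp_closed)
  have int: "integrable \<nu> (\<lambda>y. h (x, y))" for x by (intro Cc_integrable Cc_section h \<nu>)
  show ?thesis
  proof (rule CcI[OF _ C(1)])
    fix x assume "x \<notin> fst ` K"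
    then have "h (x, y) = 0" for y by (intro K(3)) force
    then show "(\<integral>y. h (x, y) \<partial>\<nu>) = 0" by simp
  next
    have "isCont (\<lambda>x. \<integral>y. h (x, y) \<partial>\<nu>) x0" for x0
      unfolding isCont_def
    proof (rule tendstoI)
      fix e :: real assume e: "0 < e"
      define m where "m = measure \<nu> (snd ` K)"
      \<comment> \<open>The summand 1 keeps the denominator positive when \<open>m\<close> = 0 and
        makes d m < e strict.\<close>
      define d where "d = e / (m + 1)"
      have m: "0 \<le> m" by (simp add: m_def)
      then have d: "0 < d" using e by (simp add: d_def)
      obtain X where X: "x0 \<in> X" "open X"
          "\<forall>x\<in>X \<inter> UNIV. \<forall>t\<in>snd ` K. dist (h (x, t)) (h (x0, t)) \<le> d"
        using continuous_on_prod_compactE[of UNIV "snd ` K" h x0 d] C(2) d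
          continuous_on_subset[OF K(1)] by (metis UNIV_I subset_UNIV)
      have "dist (\<integral>y. h (x, y) \<partial>\<nu>) (\<integral>y. h (x0, y) \<partial>\<nu>) < e" if "x \<in> X" for x
      proof -
        have le: "\<bar>h (x, y) - h (x0, y)\<bar> \<le> d * indicator (snd ` K) y" for y
        proof (cases "y \<in> snd ` K")
          case True
          then show ?thesis using X(3) that by (auto simp: dist_real_def)
        next
          case False
          then have "(x, y) \<notin> K" "(x0, y) \<notin> K" by force+
          then show ?thesis using K(3) False by simp
        qed
        have "\<bar>(\<integral>y. h (x, y) \<partial>\<nu>) - (\<integral>y. h (x0, y) \<partial>\<nu>)\<bar> = \<bar>\<integral>y. h (x, y) - h (x0, y) \<partial>\<nu>\<bar>"
          by (subst Bochner_Integration.integral_diff[OF int int]) simp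
        also have "\<dots> \<le> (\<integral>y. \<bar>h (x, y) - h (x0, y)\<bar> \<partial>\<nu>)" by (rule integral_abs_bound)
        also have "\<dots> \<le> (\<integral>y. d * indicator (snd ` K) y \<partial>\<nu>)"
          using snd int le by (intro integral_mono integrable_mult_right integrable_abs Bochner_Integration.integrable_diff) auto
        also have "\<dots> = d * m" using snd by (simp add: m_def)
        also have "\<dots> < e" using e m by (simp add: d_def field_simps)
        finally show ?thesis by (simp add: dist_real_def)
      qed
      then show "\<forall>\<^sub>F x in at x0. dist (\<integral>y. h (x, y) \<partial>\<nu>) (\<integral>y. h (x0, y) \<partial>\<nu>) < e"
        using X(1,2) by (auto simp: eventually_at_topological)
    qed
    then show "continuous_on UNIV (\<lambda>x. \<integral>y. h (x, y) \<partial>\<nu>)"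
      by (simp add: continuous_on_eq_continuous_at)
  qed
qed

lemma Cc_nn_integral:
  fixes h :: "'a::t2_space \<times> 'b::t2_space \<Rightarrow> real"
  assumes h: "h \<in> Cc" "\<And>z. 0 \<le> h z" and "radon \<mu>" "radon \<nu>"
  shows "(\<integral>\<^sup>+y. ennreal (h (x, y)) \<partial>\<nu>) = ennreal (\<integral>y. h (x, y) \<partial>\<nu>)"
    and "(\<integral>\<^sup>+x. \<integral>\<^sup>+y. ennreal (h (x, y)) \<partial>\<nu> \<partial>\<mu>) = ennreal (\<integral>x. \<integral>y. h (x, y) \<partial>\<nu> \<partial>\<mu>)"
proof -
  show *: "(\<integral>\<^sup>+y. ennreal (h (x, y)) \<partial>\<nu>) = ennreal (\<integral>y. h (x, y) \<partial>\<nu>)" for x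
    using assms by (intro nn_integral_eq_integral Cc_integrable Cc_section) auto
  show "(\<integral>\<^sup>+x. \<integral>\<^sup>+y. ennreal (h (x, y)) \<partial>\<nu> \<partial>\<mu>) = ennreal (\<integral>x. \<integral>y. h (x, y) \<partial>\<nu> \<partial>\<mu>)"
    unfolding * using assms
    by (intro nn_integral_eq_integral Cc_integrable Cc_partial_integral) auto
qed

text \<open>Without a countable base Borel sets of the product need not lie in the product
  sigma-algebra, but a compactly supported continuous function is a uniform limit of functions
  that are, in the first variable, constant on the cells of a finite Borel partition.\<close>

lemma Cc_product_measurable:
  fixes h :: "'a::t2_space \<times> 'b::t2_space \<Rightarrow> real"
  assumes "h \<in> Cc"
  shows "h \<in> borel_measurable (borel \<Otimes>\<^sub>M borel)"
proof -
  obtain K where K: "continuous_on UNIV h" "compact K" "\<And>z. z \<notin> K \<Longrightarrow> h z = 0"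
    using CcE[OF assms] by metis
  have C: "compact (fst ` K)" "compact (snd ` K)"
    by (intro compact_continuous_image K continuous_intros)+
  have "\<exists>u \<in> borel_measurable (borel \<Otimes>\<^sub>M borel). \<forall>z. \<bar>u z - h z\<bar> \<le> e" if e: "0 < e" for e :: real
  proof -
    have "\<exists>X. x0 \<in> X \<and> open X \<and> (\<forall>x\<in>X. \<forall>t. \<bar>h (x, t) - h (x0, t)\<bar> \<le> e)" for x0
    proof -
      obtain X where X: "x0 \<in> X" "open X"
          "\<forall>x\<in>X \<inter> UNIV. \<forall>t\<in>snd ` K. dist (h (x, t)) (h (x0, t)) \<le> e"
        using continuous_on_prod_compactE[of UNIV "snd ` K" h x0 e] C(2) e
          continuous_on_subset[OF K(1)] by (metis UNIV_I subset_UNIV)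
      have "\<bar>h (x, t) - h (x0, t)\<bar> \<le> e" if "x \<in> X" for x t
      proof (cases "t \<in> snd ` K")
        case True
        then show ?thesis using X(3) that by (auto simp: dist_real_def)
      next
        case False
        then have "(x, t) \<notin> K" "(x0, t) \<notin> K" by force+
        then show ?thesis using K(3) e by simp
      qed
      then show ?thesis using X(1,2) by blast
    qed
    then obtain X where X: "\<And>x0. x0 \<in> X x0" "\<And>x0. open (X x0)"
        "\<And>x0 x t. x \<in> X x0 \<Longrightarrow> \<bar>h (x, t) - h (x0, t)\<bar> \<le> e" by metis
    obtain F where F: "finite F" "fst ` K \<subseteq> (\<Union>p\<in>F. X p)"
    proof (rule compactE_image[OF C(1), of UNIV X])
      show "fst ` K \<subseteq> (\<Union>p\<in>UNIV. X p)" using X(1) by blast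
    qed (use X(2) in auto)
    have "\<exists>u \<in> borel_measurable (borel \<Otimes>\<^sub>M borel). \<forall>x y. x \<in> (\<Union>p\<in>F. X p) \<longrightarrow> \<bar>u (x, y) - h (x, y)\<bar> \<le> e"
      using F(1)
    proof induction
      case empty
      show ?case by (rule bexI[of _ "\<lambda>_. 0"]) auto
    next
      case (insert p F)
      then obtain u where [measurable]: "u \<in> borel_measurable (borel \<Otimes>\<^sub>M borel)"
        and u: "\<And>x y. x \<in> (\<Union>p\<in>F. X p) \<Longrightarrow> \<bar>u (x, y) - h (x, y)\<bar> \<le> e" by blast
      have [measurable]: "(\<lambda>y. h (p, y)) \<in> borel_measurable borel"
        by (intro borel_measurable_continuous_onI continuous_on_compose2[OF K(1)] continuous_intros) auto
      have [measurable]: "X p \<in> sets borel" using X(2) by simp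
      \<comment> \<open>On \<open>X p\<close> the new function is frozen at first coordinate
        \<open>p\<close>, so it depends on the second variable alone and is product measurable. The
        patch added last wins on overlaps; no disjoint partition has to be built.\<close>
      show ?case
      proof (intro bexI[of _ "\<lambda>z. if fst z \<in> X p then h (p, snd z) else u z"] allI impI)
        fix x y assume "x \<in> (\<Union>p\<in>insert p F. X p)"
        then show "\<bar>(if fst (x, y) \<in> X p then h (p, snd (x, y)) else u (x, y)) - h (x, y)\<bar> \<le> e"
          using u[of x y] X(3)[of x p y] by (auto simp: abs_minus_commute)
      qed measurable
    qed
    then obtain u where [measurable]: "u \<in> borel_measurable (borel \<Otimes>\<^sub>M borel)"
      and u: "\<And>x y. x \<in> (\<Union>p\<in>F. X p) \<Longrightarrow> \<bar>u (x, y) - h (x, y)\<bar> \<le> e" by blast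
    have [measurable]: "fst ` K \<in> sets borel" using C(1) by (auto intro: borel_closed compact_imp_closed)
    show ?thesis
    proof (intro bexI[of _ "\<lambda>z. if fst z \<in> fst ` K then u z else 0"] allI)
      fix z show "\<bar>(if fst z \<in> fst ` K then u z else 0) - h z\<bar> \<le> e"
      proof (cases "fst z \<in> fst ` K")
        case True
        then show ?thesis using u[of "fst z" "snd z"] F(2) by auto
      next
        case False
        then have "z \<notin> K" by auto
        then show ?thesis using K(3)[of z] False e by simp
      qed
    qed measurable
  qed
  then have "\<exists>u. u \<in> borel_measurable (borel \<Otimes>\<^sub>M borel) \<and> (\<forall>z. \<bar>u z - h z\<bar> \<le> 1 / real (Suc n))" for n
    by (metis of_nat_0_less_iff zero_less_Suc zero_less_divide_1_iff)
  then obtain u where u: "\<And>n. u n \<in> borel_measurable (borel \<Otimes>\<^sub>M borel)"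
      "\<And>n z. \<bar>u n z - h z\<bar> \<le> 1 / real (Suc n)" by metis
  show ?thesis
  proof (rule borel_measurable_LIMSEQ_real)
    fix z
    have "(\<lambda>n. u n z - h z) \<longlonglongrightarrow> 0"
      using LIMSEQ_inverse_real_of_nat u(2)
      by (intro Lim_null_comparison[of "\<lambda>n. u n z - h z" "\<lambda>n. inverse (real (Suc n))"]) (auto simp: inverse_eq_divide)
    then show "(\<lambda>n. u n z) \<longlonglongrightarrow> h z" by (simp add: LIM_zero_iff)
  qed (rule u(1))
qed

text \<open>\<open>Cc_product_measurable\<close> lets the ordinary Fubini theorem act on the product
  sigma-algebra. Finiteness of the measures supplies both sigma-finiteness and integrability of the
  bounded \<open>h\<close>.\<close>

lemma Cc_Fubini:
  fixes h :: "'a::t2_space \<times> 'b::t2_space \<Rightarrow> real"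
  assumes h: "h \<in> Cc" and "sets \<mu> = sets borel" "sets \<nu> = sets borel" "finite_measure \<mu>" "finite_measure \<nu>"
  shows "(\<integral>x. \<integral>y. h (x, y) \<partial>\<nu> \<partial>\<mu>) = (\<integral>y. \<integral>x. h (x, y) \<partial>\<mu> \<partial>\<nu>)"
proof -
  interpret \<mu>: finite_measure \<mu> by fact
  interpret \<nu>: finite_measure \<nu> by fact
  interpret pair_sigma_finite \<mu> \<nu> ..
  interpret P: finite_measure "\<mu> \<Otimes>\<^sub>M \<nu>" by (rule finite_measure_pair_measure) fact+
  obtain b where b: "\<And>z. \<bar>h z\<bar> \<le> b" using Cc_bounded[OF h] by metis
  have "sets (\<mu> \<Otimes>\<^sub>M \<nu>) = sets (borel \<Otimes>\<^sub>M borel)" using assms by (intro sets_pair_measure_cong) auto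
  then have "h \<in> borel_measurable (\<mu> \<Otimes>\<^sub>M \<nu>)"
    using Cc_product_measurable[OF h] measurable_cong_sets by blast
  then have "integrable (\<mu> \<Otimes>\<^sub>M \<nu>) (case_prod (\<lambda>x y. h (x, y)))"
    using b by (intro P.integrable_const_bound[of _ b]) auto
  from Fubini_integral[OF this] show ?thesis by simp
qed

section \<open>Approximation from below and iterated integrals of l.s.c. functions\<close>

definition bumps :: "('b::topological_space \<Rightarrow> ennreal) \<Rightarrow> ('b \<Rightarrow> real) set" where
  "bumps \<psi> = {h \<in> Cc. \<forall>z. 0 \<le> h z \<and> ennreal (h z) \<le> \<psi> z}"

lemma zero_in_bumps: "(\<lambda>_::'b::t2_space. 0) \<in> bumps \<psi>"
  by (auto simp: bumps_def intro!: CcI[of _ "{}"])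

lemma bumps_max:
  fixes h1 h2 :: "'b::t2_space \<Rightarrow> real"
  assumes "h1 \<in> bumps \<psi>" "h2 \<in> bumps \<psi>"
  shows "(\<lambda>z. max (h1 z) (h2 z)) \<in> bumps \<psi>"
proof -
  have h: "h1 \<in> Cc" "h2 \<in> Cc" using assms by (auto simp: bumps_def)
  obtain K1 where K1: "continuous_on UNIV h1" "compact K1" "\<And>z. z \<notin> K1 \<Longrightarrow> h1 z = 0"
    using CcE[OF h(1)] by metis
  obtain K2 where K2: "continuous_on UNIV h2" "compact K2" "\<And>z. z \<notin> K2 \<Longrightarrow> h2 z = 0"
    using CcE[OF h(2)] by metis
  have "(\<lambda>z. max (h1 z) (h2 z)) \<in> Cc"
    using K1 K2 by (intro CcI[of _ "K1 \<union> K2"] continuous_intros) auto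
  then show ?thesis using assms by (auto simp: bumps_def max_def)
qed

lemma bumps_directed:
  fixes h1 h2 :: "'b::t2_space \<Rightarrow> real"
  assumes "h1 \<in> bumps \<psi>" "h2 \<in> bumps \<psi>"
  shows "\<exists>h\<in>bumps \<psi>. \<forall>z. h1 z \<le> h z \<and> h2 z \<le> h z"
  using bumps_max[OF assms] by (intro bexI[of _ "\<lambda>z. max (h1 z) (h2 z)"]) auto

text \<open>A locally compact Hausdorff space is completely regular, so a continuous function
  separates \<open>z\<close> from the complement of a neighbourhood; a neighbourhood inside a
  compact set gives it compact support.\<close>

lemma SUP_bumps:
  fixes \<psi> :: "'b::t2_space \<Rightarrow> ennreal"
  assumes lc: "locally_compact_space (euclidean :: 'b topology)" and \<psi>: "lsc \<psi>"
  shows "(SUP h\<in>bumps \<psi>. ennreal (h z)) = \<psi> z"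
proof (rule antisym)
  show "(SUP h\<in>bumps \<psi>. ennreal (h z)) \<le> \<psi> z" by (auto simp: bumps_def intro!: SUP_least)
  show "\<psi> z \<le> (SUP h\<in>bumps \<psi>. ennreal (h z))"
  proof (rule dense_le)
    fix c assume "c < \<psi> z"
    then obtain e where e: "c < e" "e < \<psi> z" using dense by blast
    then obtain d where d: "0 \<le> d" "e = ennreal d" by (cases e) auto
    define W where "W = {x. e < \<psi> x}"
    have W: "open W" "z \<in> W" using \<psi> e by (auto simp: lsc_def W_def)
    obtain V K where V: "open V" "compact K" "z \<in> V" "V \<subseteq> K"
      using lc unfolding locally_compact_space_def by (metis UNIV_I compactin_euclidean_iff open_openin topspace_euclidean)
    have "Hausdorff_space (euclidean :: 'b topology)"
      unfolding Hausdorff_space_def by (metis disjnt_def hausdorff open_openin)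
    then have "completely_regular_space (euclidean :: 'b topology)"
      by (intro locally_compact_regular_imp_completely_regular_space lc) simp
    then obtain f where f: "continuous_map euclidean (top_of_set {0..1::real}) f" "f z = 0" "f ` (- (W \<inter> V)) \<subseteq> {1}"
      unfolding completely_regular_space_def using W V
      by (metis Compl_iff DiffI IntI UNIV_I closed_Compl closed_closedin open_Int topspace_euclidean)
    have fc: "continuous_on UNIV f" and f01: "0 \<le> f x" "f x \<le> 1" for x
      using f(1) by (auto simp: continuous_map_in_subtopology)
    \<comment> \<open>The separating \<open>f\<close> is 0 at \<open>z\<close> and 1 off
      \<open>W \<inter> V\<close>, so \<open>h\<close> attains its maximum \<open>d\<close> at
      \<open>z\<close>; \<open>W\<close> keeps \<open>h\<close> below \<psi> and \<open>V\<close>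
      keeps its support compact.\<close>
    define h where "h x = d * (1 - f x)" for x
    have h0: "h x = 0" if "x \<notin> W \<inter> V" for x using that f(3) by (auto simp: h_def)
    have "h \<in> Cc"
      unfolding h_def using h0 V by (intro CcI[OF _ V(2)] continuous_intros fc) (auto simp: h_def)
    moreover have "0 \<le> h x \<and> ennreal (h x) \<le> \<psi> x" for x
    proof (cases "x \<in> W \<inter> V")
      case True
      have "h x \<le> d" using d f01[of x] by (simp add: h_def mult_left_le)
      then have "ennreal (h x) \<le> e" using d by (simp add: ennreal_leI)
      also have "e \<le> \<psi> x" using True by (auto simp: W_def)
      finally show ?thesis using d f01[of x] by (simp add: h_def)
    qed (simp add: h0)
    ultimately have "h \<in> bumps \<psi>" by (simp add: bumps_def)
    moreover have "c \<le> ennreal (h z)" using e d f(2) by (simp add: h_def)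
    ultimately show "c \<le> (SUP h\<in>bumps \<psi>. ennreal (h z))" by (meson SUP_upper2)
  qed
qed

lemma locally_compact_product:
  assumes "locally_compact_space (euclidean :: 'a::t2_space topology)"
  shows "locally_compact_space (euclidean :: ('a \<times> 'a) topology)"
  using locally_compact_space_prod_topology[of "euclidean :: 'a topology" "euclidean :: 'a topology"] assms
  by simp

definition iterated :: "('a \<times> 'a \<Rightarrow> ennreal) \<Rightarrow> 'a measure \<Rightarrow> 'a measure \<Rightarrow> ennreal" where
  "iterated \<psi> \<mu> \<nu> = (\<integral>\<^sup>+x. \<integral>\<^sup>+y. \<psi> (x, y) \<partial>\<nu> \<partial>\<mu>)"

context
  fixes \<psi> :: "'a::t2_space \<times> 'a \<Rightarrow> ennreal"
  assumes lc: "locally_compact_space (euclidean :: 'a topology)" and \<psi>: "lsc \<psi>"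
begin

lemma partial_SUP_bumps:
  assumes "radon \<nu>"
  shows "(\<integral>\<^sup>+y. \<psi> (x, y) \<partial>\<nu>) = (SUP h\<in>bumps \<psi>. \<integral>\<^sup>+y. ennreal (h (x, y)) \<partial>\<nu>)"
proof -
  have "(\<integral>\<^sup>+y. \<psi> (x, y) \<partial>\<nu>) = (\<integral>\<^sup>+y. (SUP h\<in>bumps \<psi>. ennreal (h (x, y))) \<partial>\<nu>)"
    by (simp add: SUP_bumps[OF locally_compact_product[OF lc] \<psi>])
  also have "\<dots> = (SUP h\<in>bumps \<psi>. \<integral>\<^sup>+y. ennreal (h (x, y)) \<partial>\<nu>)"
  proof (rule radon_tau_smooth[OF assms])
    show "bumps \<psi> \<noteq> {}" using zero_in_bumps by auto
    show "lsc (\<lambda>y. ennreal (h (x, y)))" if "h \<in> bumps \<psi>" for h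
    proof (intro lsc_continuous continuous_on_ennreal)
      show "continuous_on UNIV (\<lambda>y. h (x, y))"
        using that Cc_section[of h x] by (auto simp: bumps_def Cc_def)
    qed
    show "\<exists>h\<in>bumps \<psi>. \<forall>y. ennreal (h1 (x, y)) \<le> ennreal (h (x, y)) \<and> ennreal (h2 (x, y)) \<le> ennreal (h (x, y))"
      if "h1 \<in> bumps \<psi>" "h2 \<in> bumps \<psi>" for h1 h2
      using bumps_directed[OF that] by (metis ennreal_leI)
  qed
  finally show ?thesis .
qed

lemma lsc_partial_bump:
  assumes "radon \<nu>" "h \<in> bumps \<psi>"
  shows "lsc (\<lambda>x. \<integral>\<^sup>+y. ennreal (h (x, y)) \<partial>\<nu>)"
proof -
  have h: "h \<in> Cc" "\<And>z. 0 \<le> h z" using assms(2) by (auto simp: bumps_def)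
  show ?thesis
    unfolding Cc_nn_integral(1)[OF h assms(1,1)]
    using Cc_partial_integral[OF h(1) assms(1)]
    by (intro lsc_continuous continuous_on_ennreal) (auto simp: Cc_def)
qed

text \<open>Measurability of potentials cannot come from Tonelli, as \<psi> need not be product
  measurable. It comes from writing the partial integral as a supremum of continuous
  functions.\<close>

lemma lsc_partial:
  assumes "radon \<nu>"
  shows "lsc (\<lambda>x. \<integral>\<^sup>+y. \<psi> (x, y) \<partial>\<nu>)"
  unfolding partial_SUP_bumps[OF assms] by (intro lsc_SUP lsc_partial_bump assms)

text \<open>\<tau>-smoothness is applied to the inner and then to the outer integral. The supremum
  is the Radon product integral of a nonnegative function, the iterated form is the one to compute
  with.\<close>

lemma iterated_SUP_bumps:
  assumes "radon \<mu>" "radon \<nu>"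
  shows "iterated \<psi> \<mu> \<nu> = (SUP h\<in>bumps \<psi>. ennreal (\<integral>x. \<integral>y. h (x, y) \<partial>\<nu> \<partial>\<mu>))"
proof -
  have "iterated \<psi> \<mu> \<nu> = (SUP h\<in>bumps \<psi>. \<integral>\<^sup>+x. \<integral>\<^sup>+y. ennreal (h (x, y)) \<partial>\<nu> \<partial>\<mu>)"
    unfolding iterated_def partial_SUP_bumps[OF assms(2)]
  proof (rule radon_tau_smooth[OF assms(1)])
    show "bumps \<psi> \<noteq> {}" using zero_in_bumps by auto
    show "lsc (\<lambda>x. \<integral>\<^sup>+y. ennreal (h (x, y)) \<partial>\<nu>)" if "h \<in> bumps \<psi>" for h
      by (rule lsc_partial_bump[OF assms(2) that])
    show "\<exists>h\<in>bumps \<psi>. \<forall>x. (\<integral>\<^sup>+y. ennreal (h1 (x, y)) \<partial>\<nu>) \<le> (\<integral>\<^sup>+y. ennreal (h (x, y)) \<partial>\<nu>)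
        \<and> (\<integral>\<^sup>+y. ennreal (h2 (x, y)) \<partial>\<nu>) \<le> (\<integral>\<^sup>+y. ennreal (h (x, y)) \<partial>\<nu>)"
      if h12: "h1 \<in> bumps \<psi>" "h2 \<in> bumps \<psi>" for h1 h2
    proof -
      obtain h where h: "h \<in> bumps \<psi>" "\<forall>z. h1 z \<le> h z \<and> h2 z \<le> h z"
        using bumps_directed[OF h12] by blast
      then show ?thesis by (intro bexI[of _ h] allI conjI nn_integral_mono ennreal_leI) auto
    qed
  qed
  also have "\<dots> = (SUP h\<in>bumps \<psi>. ennreal (\<integral>x. \<integral>y. h (x, y) \<partial>\<nu> \<partial>\<mu>))"
    using assms by (intro SUP_cong refl Cc_nn_integral(2)) (auto simp: bumps_def)
  finally show ?thesis .
qed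

end

text \<open>Fubini holds for each bump, and by symmetry of \<psi> the reflected bump again lies
  below \<psi>. One inequality for an arbitrary ordered pair yields both; finiteness is what
  \<open>Cc_Fubini\<close> asks for.\<close>

lemma iterated_swap:
  fixes \<psi> :: "'a::t2_space \<times> 'a \<Rightarrow> ennreal"
  assumes "locally_compact_space (euclidean :: 'a topology)" "lsc \<psi>" "\<And>x y. \<psi> (x, y) = \<psi> (y, x)"
    and rad: "radon \<mu>" "radon \<nu>" and fin: "finite_measure \<mu>" "finite_measure \<nu>"
  shows "iterated \<psi> \<mu> \<nu> = iterated \<psi> \<nu> \<mu>"
proof -
  have le: "iterated \<psi> \<mu> \<nu> \<le> iterated \<psi> \<nu> \<mu>"
    if rad: "radon \<mu>" "radon \<nu>" and fin: "finite_measure \<mu>" "finite_measure \<nu>" for \<mu> \<nu>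
    unfolding iterated_SUP_bumps[OF assms(1,2) rad(1,2)] iterated_SUP_bumps[OF assms(1,2) rad(2,1)]
  proof (rule SUP_least)
    fix h assume h: "h \<in> bumps \<psi>"
    define h' where "h' = (\<lambda>(x, y). h (y, x))"
    obtain K where K: "continuous_on UNIV h" "compact K" "\<And>z. z \<notin> K \<Longrightarrow> h z = 0"
      using CcE[of h] h unfolding bumps_def by blast
    have "h' \<in> Cc"
    proof (rule CcI[of _ "prod.swap ` K"])
      show "continuous_on UNIV h'"
        unfolding h'_def case_prod_beta
        by (intro continuous_on_compose2[OF K(1)] continuous_intros) auto
      show "compact (prod.swap ` K)"
        unfolding prod.swap_def by (intro compact_continuous_image K continuous_intros)
      show "h' z = 0" if "z \<notin> prod.swap ` K" for z
        using that K(3)[of "prod.swap z"] by (cases z) (force simp: h'_def)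
    qed
    then have "h' \<in> bumps \<psi>"
      using h by (auto simp: bumps_def h'_def split: prod.splits) (metis assms(3))
    moreover have "(\<integral>x. \<integral>y. h (x, y) \<partial>\<nu> \<partial>\<mu>) = (\<integral>y. \<integral>x. h' (y, x) \<partial>\<mu> \<partial>\<nu>)"
      using h rad fin by (simp add: h'_def bumps_def Cc_Fubini[of h \<mu> \<nu>] radon_sets)
    ultimately show "ennreal (\<integral>x. \<integral>y. h (x, y) \<partial>\<nu> \<partial>\<mu>) \<le> (SUP h\<in>bumps \<psi>. ennreal (\<integral>x. \<integral>y. h (x, y) \<partial>\<mu> \<partial>\<nu>))"
      by (auto intro: SUP_upper2)
  qed
  show ?thesis by (intro antisym le rad fin)
qed

text \<open>Under a nonnegative kernel the positive part of a minorant is again a minorant, with an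
  integral at least as large. So the suprema over all minorants and over nonnegative ones
  agree.\<close>

lemma prod_integral_nonneg:
  fixes \<kappa> :: "'a::t2_space \<times> 'a \<Rightarrow> ereal"
  assumes lc: "locally_compact_space (euclidean :: 'a topology)"
    and \<kappa>: "lsc (\<lambda>z. e2ennreal (\<kappa> z))" "\<And>z. 0 \<le> \<kappa> z" and rad: "radon \<mu>" "radon \<nu>"
  shows "prod_integral \<mu> \<nu> \<kappa> = enn2ereal (iterated (\<lambda>z. e2ennreal (\<kappa> z)) \<mu> \<nu>)"
proof -
  let ?\<psi> = "\<lambda>z. e2ennreal (\<kappa> z)"
  have bump: "0 \<le> (\<integral>x. \<integral>y. h (x, y) \<partial>\<nu> \<partial>\<mu>)" if "h \<in> bumps ?\<psi>" for h
    using that by (auto simp: bumps_def)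
  have ne: "bumps ?\<psi> \<noteq> {}" using zero_in_bumps by auto
  have "enn2ereal (iterated ?\<psi> \<mu> \<nu>) = sup 0 (SUP h\<in>bumps ?\<psi>. ereal (\<integral>x. \<integral>y. h (x, y) \<partial>\<nu> \<partial>\<mu>))"
    unfolding iterated_SUP_bumps[OF lc \<kappa>(1) rad] Sup_ennreal.rep_eq image_image
    using bump by (intro arg_cong[of _ _ "sup 0"] SUP_cong) auto
  also have "\<dots> = (SUP h\<in>bumps ?\<psi>. ereal (\<integral>x. \<integral>y. h (x, y) \<partial>\<nu> \<partial>\<mu>))"
    using zero_in_bumps[of ?\<psi>] by (intro sup_absorb2 SUP_upper2[OF zero_in_bumps]) simp
  also have "\<dots> = prod_integral \<mu> \<nu> \<kappa>"
    unfolding prod_integral_def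
  proof (intro antisym SUP_least)
    fix h assume h: "h \<in> bumps ?\<psi>"
    have "ereal (h z) \<le> \<kappa> z" for z
    proof -
      have "enn2ereal (ennreal (h z)) \<le> enn2ereal (e2ennreal (\<kappa> z))"
        unfolding less_eq_ennreal.rep_eq[symmetric] using h unfolding bumps_def by blast
      moreover have "0 \<le> h z" using h unfolding bumps_def by blast
      ultimately show ?thesis using \<kappa>(2) by (simp add: enn2ereal_e2ennreal)
    qed
    then show "ereal (\<integral>x. \<integral>y. h (x, y) \<partial>\<nu> \<partial>\<mu>)
        \<le> (SUP h\<in>{h \<in> Cc. \<forall>z. ereal (h z) \<le> \<kappa> z}. ereal (\<integral>x. \<integral>y. h (x, y) \<partial>\<nu> \<partial>\<mu>))"
      using h by (intro SUP_upper) (auto simp: bumps_def)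
  next
    fix h assume h: "h \<in> {h \<in> Cc. \<forall>z. ereal (h z) \<le> \<kappa> z}"
    define h' where "h' z = max (h z) 0" for z
    have Cc: "h \<in> Cc" "h' \<in> Cc" using h Cc_max_zero[of h] unfolding h'_def by blast+
    have "ennreal (h' z) \<le> ?\<psi> z" for z
    proof -
      have "ereal (h z) \<le> \<kappa> z" using h by blast
      then have "ereal (h' z) \<le> \<kappa> z" using \<kappa>(2)[of z] by (simp add: h'_def max_def zero_ereal_def)
      from e2ennreal_mono[OF this] show ?thesis by simp
    qed
    then have "h' \<in> bumps ?\<psi>" using Cc by (auto simp: bumps_def h'_def)
    moreover have "(\<integral>x. \<integral>y. h (x, y) \<partial>\<nu> \<partial>\<mu>) \<le> (\<integral>x. \<integral>y. h' (x, y) \<partial>\<nu> \<partial>\<mu>)"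
      by (intro integral_mono Cc_integrable Cc_partial_integral Cc_section Cc rad) (simp add: h'_def)
    ultimately show "ereal (\<integral>x. \<integral>y. h (x, y) \<partial>\<nu> \<partial>\<mu>)
        \<le> (SUP h\<in>bumps ?\<psi>. ereal (\<integral>x. \<integral>y. h (x, y) \<partial>\<nu> \<partial>\<mu>))"
      by (intro SUP_upper2) auto
  qed
  finally show ?thesis ..
qed

text \<open>On a compact space every continuous function has compact support, so adding
  \<open>M\<close> is a bijection from the minorants of \<kappa> to those of \<kappa> + M. This
  reduces kernels with negative values to nonnegative ones.\<close>

lemma prod_integral_shift:
  fixes \<kappa> :: "'a::t2_space \<times> 'a \<Rightarrow> ereal"
  assumes cpt: "compact (UNIV :: 'a set)" and M: "0 \<le> M" "\<And>z. - ereal M \<le> \<kappa> z" and rad: "radon \<mu>" "radon \<nu>"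
  shows "prod_integral \<mu> \<nu> \<kappa> = prod_integral \<mu> \<nu> (\<lambda>z. \<kappa> z + ereal M)
    - ereal (M * measure \<mu> UNIV * measure \<nu> UNIV)"
proof -
  define c where "c = M * measure \<mu> UNIV * measure \<nu> UNIV"
  let ?F = "\<lambda>\<kappa>. {h :: 'a \<times> 'a \<Rightarrow> real. h \<in> Cc \<and> (\<forall>z. ereal (h z) \<le> \<kappa> z)}"
  have Cc: "h \<in> Cc \<longleftrightarrow> continuous_on UNIV h" for h :: "'a \<times> 'a \<Rightarrow> real"
    using compact_Int_closed[of "UNIV :: ('a \<times> 'a) set" "closure {z. h z \<noteq> 0}"] compact_Times[OF cpt cpt]
    by (simp add: Cc_def)
  have fm: "finite_measure \<mu>" "finite_measure \<nu>"
    using radon_compact[OF rad(1) cpt] radon_compact[OF rad(2) cpt]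
    by (auto intro!: finite_measureI simp: radon_space rad)
  interpret \<mu>: finite_measure \<mu> by (rule fm)
  interpret \<nu>: finite_measure \<nu> by (rule fm)
  have int: "(\<integral>x. \<integral>y. h (x, y) + M \<partial>\<nu> \<partial>\<mu>) = (\<integral>x. \<integral>y. h (x, y) \<partial>\<nu> \<partial>\<mu>) + c" if "h \<in> Cc" for h
  proof -
    have "(\<integral>x. \<integral>y. h (x, y) + M \<partial>\<nu> \<partial>\<mu>) = (\<integral>x. (\<integral>y. h (x, y) \<partial>\<nu>) + M * measure \<nu> UNIV \<partial>\<mu>)"
      using Cc_integrable[OF Cc_section[OF that] rad(2)] by (simp add: radon_space rad mult.commute)
    also have "\<dots> = (\<integral>x. \<integral>y. h (x, y) \<partial>\<nu> \<partial>\<mu>) + c"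
      using Cc_integrable[OF Cc_partial_integral[OF that rad(2)] rad(1)]
      by (simp add: radon_space rad c_def algebra_simps)
    finally show ?thesis .
  qed
  \<comment> \<open>The constant -M is a minorant; a nonempty family is needed to pull
    \<open>c\<close> out of the supremum.\<close>
  have ne: "?F \<kappa> \<noteq> {}"
    using M(2) by (auto simp: Cc intro!: exI[of _ "\<lambda>_. - M"])
  have img: "?F (\<lambda>z. \<kappa> z + ereal M) = (\<lambda>h z. h z + M) ` ?F \<kappa>"
  proof (intro antisym subsetI)
    fix h assume h: "h \<in> ?F (\<lambda>z. \<kappa> z + ereal M)"
    have "ereal (h z - M) \<le> \<kappa> z" for z
    proof -
      have "ereal (h z) \<le> \<kappa> z + ereal M" using h by blast
      then show ?thesis by (cases "\<kappa> z") auto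
    qed
    then have "(\<lambda>z. h z - M) \<in> ?F \<kappa>" using h by (auto simp: Cc intro!: continuous_intros)
    then show "h \<in> (\<lambda>h z. h z + M) ` ?F \<kappa>" by (intro image_eqI[of _ _ "\<lambda>z. h z - M"]) auto
  next
    fix h assume "h \<in> (\<lambda>h z. h z + M) ` ?F \<kappa>"
    then obtain h' where h': "h' \<in> ?F \<kappa>" "h = (\<lambda>z. h' z + M)" by auto
    have "ereal (h' z + M) \<le> \<kappa> z + ereal M" for z
    proof -
      have "ereal (h' z) \<le> \<kappa> z" using h'(1) by blast
      then show ?thesis by (cases "\<kappa> z") auto
    qed
    then show "h \<in> ?F (\<lambda>z. \<kappa> z + ereal M)" using h' by (auto simp: Cc intro!: continuous_intros)
  qed
  have "prod_integral \<mu> \<nu> (\<lambda>z. \<kappa> z + ereal M) = (SUP h\<in>?F \<kappa>. ereal (\<integral>x. \<integral>y. h (x, y) \<partial>\<nu> \<partial>\<mu>) + ereal c)"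
    unfolding prod_integral_def img image_image using int by (intro SUP_cong) auto
  also have "\<dots> = prod_integral \<mu> \<nu> \<kappa> + ereal c"
    unfolding prod_integral_def using ne by (intro SUP_ereal_add_left) auto
  finally show ?thesis
    unfolding c_def[symmetric] by (cases "prod_integral \<mu> \<nu> \<kappa>") auto
qed

section \<open>Operations on finite Radon measures\<close>

text \<open>Truncation along an enumeration of \<open>J\<close>. It reduces inner regularity of a
  countable sum of measures to finitely many summands.\<close>

lemma count_space_finite_approx:
  fixes f :: "'i \<Rightarrow> ennreal"
  assumes "countable J" "c < (\<integral>\<^sup>+j. f j \<partial>count_space J)"
  obtains F where "finite F" "F \<subseteq> J" "c < (\<Sum>j\<in>F. f j)"
proof -
  define F where "F n = {j \<in> J. to_nat_on J j \<le> n}" for n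
  have F: "finite (F n)" "F n \<subseteq> J" for n
    using inj_on_subset[OF inj_on_to_nat_on[OF assms(1)], of "F n"]
    by (auto simp: F_def intro!: finite_imageD[of "to_nat_on J"] finite_subset[of _ "{..n}"])
  have "(\<integral>\<^sup>+j. f j \<partial>count_space J) = (\<integral>\<^sup>+j. (SUP n. f j * indicator (F n) j) \<partial>count_space J)"
  proof (rule nn_integral_cong)
    fix j assume "j \<in> space (count_space J)"
    then have "f j \<le> f j * indicator (F (to_nat_on J j)) j" by (simp add: F_def)
    then show "f j = (SUP n. f j * indicator (F n) j)"
      by (intro antisym SUP_least SUP_upper2[of "to_nat_on J j"]) (auto split: split_indicator)
  qed
  also have "\<dots> = (SUP n. \<integral>\<^sup>+j. f j * indicator (F n) j \<partial>count_space J)"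
    by (rule nn_integral_monotone_convergence_SUP)
      (auto simp: incseq_def le_fun_def F_def split: split_indicator)
  also have "\<dots> = (SUP n. \<Sum>j\<in>F n. f j)"
  proof (rule SUP_cong[OF refl])
    fix n
    show "(\<integral>\<^sup>+j. f j * indicator (F n) j \<partial>count_space J) = (\<Sum>j\<in>F n. f j)"
      using F[of n] by (subst nn_integral_count_space'[of "F n"]) auto
  qed
  finally obtain n where "c < (\<Sum>j\<in>F n. f j)" using assms(2) by (auto simp: less_SUP_iff)
  then show ?thesis using F by (intro that[of "F n"])
qed

text \<open>Summation is integration over \<open>count_space\<close>, so sums over any subset of the
  index set need no enumeration and obey the rules of integration. That \<open>measure_of\<close>
  receives a countably additive function is checked in \<open>emeasure_measure_sum\<close>.\<close>

definition measure_sum :: "'i set \<Rightarrow> ('i \<Rightarrow> 'a::topological_space measure) \<Rightarrow> 'a measure" where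
  "measure_sum J N = measure_of UNIV (sets borel) (\<lambda>E. \<integral>\<^sup>+j. emeasure (N j) E \<partial>count_space J)"

lemma sets_measure_sum [simp]: "sets (measure_sum J N) = sets borel"
  using sets.sigma_sets_eq[of borel] by (simp add: measure_sum_def)

lemma space_measure_sum [simp]: "space (measure_sum J N) = UNIV"
  by (simp add: measure_sum_def)

lemma emeasure_measure_sum:
  assumes "\<And>j. j \<in> J \<Longrightarrow> sets (N j) = sets borel" "E \<in> sets borel"
  shows "emeasure (measure_sum J N) E = (\<integral>\<^sup>+j. emeasure (N j) E \<partial>count_space J)"
  unfolding measure_sum_def
proof (rule emeasure_measure_of_sigma[OF _ _ _ assms(2)])
  show "sigma_algebra UNIV (sets (borel :: 'b measure))" by (metis sets.sigma_algebra_axioms space_borel)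
  show "positive (sets borel) (\<lambda>E. \<integral>\<^sup>+j. emeasure (N j) E \<partial>count_space J)" by (simp add: positive_def)
  show "countably_additive (sets borel) (\<lambda>E. \<integral>\<^sup>+j. emeasure (N j) E \<partial>count_space J)"
  proof (rule countably_additiveI)
    fix A :: "nat \<Rightarrow> 'b set" assume A: "range A \<subseteq> sets borel" "disjoint_family A" "(\<Union>i. A i) \<in> sets borel"
    have "(\<Sum>i. \<integral>\<^sup>+j. emeasure (N j) (A i) \<partial>count_space J)
        = (\<integral>\<^sup>+j. (\<Sum>i. emeasure (N j) (A i)) \<partial>count_space J)"
      by (rule nn_integral_suminf[symmetric]) simp
    also have "\<dots> = (\<integral>\<^sup>+j. emeasure (N j) (\<Union>i. A i) \<partial>count_space J)"
      using A assms(1) by (intro nn_integral_cong suminf_emeasure) auto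
    finally show "(\<Sum>i. \<integral>\<^sup>+j. emeasure (N j) (A i) \<partial>count_space J)
        = (\<integral>\<^sup>+j. emeasure (N j) (\<Union>i. A i) \<partial>count_space J)" .
  qed
qed

lemma nn_integral_measure_sum:
  assumes J: "\<And>j. j \<in> J \<Longrightarrow> sets (N j) = sets borel" and "f \<in> borel_measurable borel"
  shows "(\<integral>\<^sup>+x. f x \<partial>measure_sum J N) = (\<integral>\<^sup>+j. \<integral>\<^sup>+x. f x \<partial>N j \<partial>count_space J)"
  using assms(2)
proof (induction rule: borel_measurable_induct)
  case (cong f g)
  then show ?case by (simp cong: nn_integral_cong)
next
  case (set E)
  have "(\<integral>\<^sup>+x. indicator E x \<partial>measure_sum J N) = (\<integral>\<^sup>+j. emeasure (N j) E \<partial>count_space J)"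
    using set by (simp add: emeasure_measure_sum[OF J])
  also have "\<dots> = (\<integral>\<^sup>+j. \<integral>\<^sup>+x. indicator E x \<partial>N j \<partial>count_space J)"
    using set J by (intro nn_integral_cong) simp
  finally show ?case .
next
  case (mult u c)
  have m: "u \<in> borel_measurable (N j)" if "j \<in> J" for j
    using mult(2) J[OF that] measurable_cong_sets by blast
  have "u \<in> borel_measurable (measure_sum J N)" using mult(2) by (simp cong: measurable_cong_sets)
  then have "(\<integral>\<^sup>+x. c * u x \<partial>measure_sum J N) = c * (\<integral>\<^sup>+j. \<integral>\<^sup>+x. u x \<partial>N j \<partial>count_space J)"
    using mult by (simp add: nn_integral_cmult)
  also have "\<dots> = (\<integral>\<^sup>+j. c * (\<integral>\<^sup>+x. u x \<partial>N j) \<partial>count_space J)" by (simp add: nn_integral_cmult)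
  also have "\<dots> = (\<integral>\<^sup>+j. \<integral>\<^sup>+x. c * u x \<partial>N j \<partial>count_space J)"
    using m by (intro nn_integral_cong) (simp add: nn_integral_cmult)
  finally show ?case .
next
  case (add u v)
  have m: "u \<in> borel_measurable (N j)" "v \<in> borel_measurable (N j)" if "j \<in> J" for j
    using add(1,4) add J[OF that] measurable_cong_sets by blast+
  have "u \<in> borel_measurable (measure_sum J N)" "v \<in> borel_measurable (measure_sum J N)"
    using add by (simp_all cong: measurable_cong_sets)
  then have "(\<integral>\<^sup>+x. v x + u x \<partial>measure_sum J N)
      = (\<integral>\<^sup>+j. (\<integral>\<^sup>+x. v x \<partial>N j) + (\<integral>\<^sup>+x. u x \<partial>N j) \<partial>count_space J)"
    using add by (simp add: nn_integral_add)
  also have "\<dots> = (\<integral>\<^sup>+j. \<integral>\<^sup>+x. v x + u x \<partial>N j \<partial>count_space J)"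
    using m by (intro nn_integral_cong) (simp add: nn_integral_add)
  finally show ?case .
next
  case (seq U)
  have m: "U i \<in> borel_measurable (N j)" if "j \<in> J" for i j
    using seq(1) J[OF that] measurable_cong_sets by blast
  have mono: "incseq U" using seq by simp
  have "(\<integral>\<^sup>+x. (SUP i. U i) x \<partial>measure_sum J N) = (SUP i. \<integral>\<^sup>+x. U i x \<partial>measure_sum J N)"
    unfolding SUP_apply using seq(1) mono
    by (intro nn_integral_monotone_convergence_SUP) (simp_all cong: measurable_cong_sets)
  also have "\<dots> = (SUP i. \<integral>\<^sup>+j. \<integral>\<^sup>+x. U i x \<partial>N j \<partial>count_space J)" using seq by simp
  also have "\<dots> = (\<integral>\<^sup>+j. (SUP i. \<integral>\<^sup>+x. U i x \<partial>N j) \<partial>count_space J)"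
    using mono by (intro nn_integral_monotone_convergence_SUP[symmetric])
      (auto simp: incseq_def le_fun_def intro!: nn_integral_mono)
  also have "\<dots> = (\<integral>\<^sup>+j. \<integral>\<^sup>+x. (SUP i. U i) x \<partial>N j \<partial>count_space J)"
    unfolding SUP_apply using m mono
    by (intro nn_integral_cong nn_integral_monotone_convergence_SUP[symmetric]) auto
  finally show ?case .
qed

text \<open>A relation in place of an addition of measures: sums, differences and restrictions to
  complementary sets all produce instances. Infinite measures are allowed, as in \<xi> = \<lambda> +
  (\<xi> - \<lambda>).\<close>

definition splits :: "'a::topological_space measure \<Rightarrow> 'a measure \<Rightarrow> 'a measure \<Rightarrow> bool" where
  "splits \<mu> \<alpha> \<beta> \<longleftrightarrow> sets \<mu> = sets borel \<and> sets \<alpha> = sets borel \<and> sets \<beta> = sets borel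
     \<and> (\<forall>E \<in> sets borel. emeasure \<mu> E = emeasure \<alpha> E + emeasure \<beta> E)"

lemma nn_integral_splits:
  assumes "splits \<mu> \<alpha> \<beta>" "f \<in> borel_measurable borel"
  shows "(\<integral>\<^sup>+x. f x \<partial>\<mu>) = (\<integral>\<^sup>+x. f x \<partial>\<alpha>) + (\<integral>\<^sup>+x. f x \<partial>\<beta>)"
proof -
  define N where "N b = (if b then \<alpha> else \<beta>)" for b
  have s: "sets (N b) = sets borel" for b using assms(1) by (auto simp: N_def splits_def)
  have c: "(\<integral>\<^sup>+b. F b \<partial>count_space UNIV) = F True + F False" for F :: "bool \<Rightarrow> ennreal"
    by (subst nn_integral_count_space_finite) (auto simp: UNIV_bool)
  have "\<mu> = measure_sum UNIV N"
    using assms(1) s by (intro measure_eqI) (auto simp: splits_def emeasure_measure_sum c, simp_all add: N_def)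
  then show ?thesis using nn_integral_measure_sum[of UNIV N, OF s assms(2)] by (simp add: c N_def)
qed

section \<open>Finite Radon measures: domination, countable sums, multiples\<close>

definition finite_radon :: "'a::t2_space measure \<Rightarrow> bool" where
  "finite_radon \<mu> \<longleftrightarrow> radon \<mu> \<and> finite_measure \<mu>"

lemma finite_radonD:
  assumes "finite_radon \<mu>"
  shows "radon \<mu>" "finite_measure \<mu>" "sets \<mu> = sets borel" "space \<mu> = UNIV" "emeasure \<mu> E < \<infinity>"
    "emeasure \<mu> E = ennreal (measure \<mu> E)"
proof -
  show *: "radon \<mu>" "finite_measure \<mu>" using assms by (auto simp: finite_radon_def)
  show "sets \<mu> = sets borel" "space \<mu> = UNIV" using radon_sets[OF *(1)] radon_space[OF *(1)] .
  show "emeasure \<mu> E < \<infinity>" "emeasure \<mu> E = ennreal (measure \<mu> E)"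
    using finite_measure.emeasure_finite[OF *(2), of E] finite_measure.emeasure_eq_measure[OF *(2)]
    by (auto simp: top.not_eq_extremum)
qed

lemma finite_radonI:
  assumes "radon \<mu>" "emeasure \<mu> UNIV < \<infinity>"
  shows "finite_radon \<mu>"
  using assms radon_space[OF assms(1)] by (auto simp: finite_radon_def intro!: finite_measureI)

lemma radonI:
  assumes "sets \<nu> = sets borel" "\<And>K. compact K \<Longrightarrow> emeasure \<nu> K < \<infinity>"
    and "\<And>E c. E \<in> sets borel \<Longrightarrow> c < emeasure \<nu> E \<Longrightarrow> \<exists>K. compact K \<and> K \<subseteq> E \<and> c \<le> emeasure \<nu> K"
  shows "radon \<nu>"
  unfolding radon_def
proof (intro conjI ballI allI impI)
  fix E :: "'a set" assume E: "E \<in> sets borel"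
  show "emeasure \<nu> E = (SUP K \<in> {K. compact K \<and> K \<subseteq> E}. emeasure \<nu> K)"
  proof (rule antisym)
    show "emeasure \<nu> E \<le> (SUP K \<in> {K. compact K \<and> K \<subseteq> E}. emeasure \<nu> K)"
    proof (rule dense_le)
      fix c assume "c < emeasure \<nu> E"
      then obtain K where "compact K" "K \<subseteq> E" "c \<le> emeasure \<nu> K" using assms(3)[OF E] by blast
      then show "c \<le> (SUP K \<in> {K. compact K \<and> K \<subseteq> E}. emeasure \<nu> K)" by (auto intro!: SUP_upper2[of K])
    qed
    show "(SUP K \<in> {K. compact K \<and> K \<subseteq> E}. emeasure \<nu> K) \<le> emeasure \<nu> E"
      using E assms(1) by (intro SUP_least emeasure_mono) auto
  qed
qed (use assms in auto)

text \<open>A compact set that exhausts E up to a small amount for \<mu> does so for the smaller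
  \<nu>, because \<nu>(E - K) \<le> \<mu>(E - K).\<close>

lemma finite_radon_le:
  assumes \<mu>: "finite_radon \<mu>" and s: "sets \<nu> = sets borel"
    and le: "\<And>E. E \<in> sets borel \<Longrightarrow> emeasure \<nu> E \<le> emeasure \<mu> E"
  shows "finite_radon \<nu>"
proof (rule finite_radonI)
  show U: "emeasure \<nu> UNIV < \<infinity>" using le[of UNIV] finite_radonD(5)[OF \<mu>, of UNIV] by (auto intro: le_less_trans)
  interpret \<mu>: finite_measure \<mu> using finite_radonD(2)[OF \<mu>] .
  interpret \<nu>: finite_measure \<nu> using U sets_eq_imp_space_eq[OF s] by (auto intro!: finite_measureI)
  show "radon \<nu>"
  proof (rule radonI[OF s])
    show "emeasure \<nu> K < \<infinity>" for K by (simp add: top.not_eq_extremum[symmetric])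
    fix E :: "'a set" and c assume E: "E \<in> sets borel" and c: "c < emeasure \<nu> E"
    then obtain r where r: "0 \<le> r" "c = ennreal r" by (cases c) auto
    have rE: "r < measure \<nu> E" using c r by (simp add: \<nu>.emeasure_eq_measure ennreal_less_iff)
    \<comment> \<open>The loss that can be afforded: if \<mu>(E - K) < d, then K keeps \<nu>-mass at
      least \<open>r\<close>.\<close>
    define d where "d = measure \<nu> E - r"
    have "ennreal (measure \<mu> E - d) < emeasure \<mu> E"
    proof (cases "measure \<mu> E = 0")
      case True
      have "measure \<nu> E \<le> measure \<mu> E"
        using le[OF E] by (simp add: \<mu>.emeasure_eq_measure \<nu>.emeasure_eq_measure)
      then show ?thesis using True rE r by simp
    next
      case False
      then show ?thesis using rE by (auto simp: \<mu>.emeasure_eq_measure d_def intro!: ennreal_lessI simp: zero_less_measure_iff)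
    qed
    then obtain K where K: "compact K" "K \<subseteq> E" "ennreal (measure \<mu> E - d) < emeasure \<mu> K"
      by (rule radon_inner_less[OF finite_radonD(1)[OF \<mu>] E])
    have Kb: "K \<in> sets borel" using K(1) by (auto intro: borel_closed compact_imp_closed)
    have "measure \<mu> E - d < measure \<mu> K"
    proof (rule ccontr)
      assume "\<not> ?thesis"
      then have "ennreal (measure \<mu> K) \<le> ennreal (measure \<mu> E - d)" by (intro ennreal_leI) simp
      then show False using K(3) by (simp add: \<mu>.emeasure_eq_measure)
    qed
    moreover have "measure \<nu> (E - K) \<le> measure \<mu> (E - K)"
      using le[of "E - K"] E Kb by (simp add: \<mu>.emeasure_eq_measure \<nu>.emeasure_eq_measure)
    moreover have "measure \<mu> (E - K) = measure \<mu> E - measure \<mu> K"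
      using E K Kb finite_radonD(3)[OF \<mu>] by (intro \<mu>.finite_measure_Diff) auto
    moreover have "measure \<nu> (E - K) = measure \<nu> E - measure \<nu> K"
      using E K Kb s by (intro \<nu>.finite_measure_Diff) auto
    ultimately have "r \<le> measure \<nu> K" by (simp add: d_def)
    then show "\<exists>K. compact K \<and> K \<subseteq> E \<and> c \<le> emeasure \<nu> K"
      using K r by (auto simp: \<nu>.emeasure_eq_measure intro!: exI[of _ K] ennreal_leI)
  qed
qed

text \<open>The sum is first cut to finitely many indices. Compact subsets of E are directed under
  union, so one compact set then serves all remaining measures.\<close>

lemma finite_radon_measure_sum:
  assumes J: "countable J" "\<And>j. j \<in> J \<Longrightarrow> finite_radon (N j)"
    and fin: "(\<integral>\<^sup>+j. emeasure (N j) UNIV \<partial>count_space J) < \<infinity>"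
  shows "finite_radon (measure_sum J N)"
proof -
  have s: "sets (N j) = sets borel" if "j \<in> J" for j using finite_radonD(3)[OF J(2)[OF that]] .
  note em = emeasure_measure_sum[of J N, OF s]
  have U: "emeasure (measure_sum J N) UNIV < \<infinity>" using fin by (simp add: em)
  show ?thesis
  proof (rule finite_radonI[OF radonI U])
    fix K :: "'b set" show "emeasure (measure_sum J N) K < \<infinity>"
      using U emeasure_space[of "measure_sum J N" K] by (auto intro: le_less_trans)
  next
    fix E :: "'b set" and c assume E: "E \<in> sets borel" and c: "c < emeasure (measure_sum J N) E"
    obtain F where F: "finite F" "F \<subseteq> J" "c < (\<Sum>j\<in>F. emeasure (N j) E)"
      using count_space_finite_approx[OF J(1)] c em[OF _ E] by metis
    have "(\<Sum>j\<in>F. emeasure (N j) E) = (\<Sum>j\<in>F. SUP K \<in> {K. compact K \<and> K \<subseteq> E}. emeasure (N j) K)"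
      using F(2) J(2) E by (intro sum.cong radon_inner) (auto dest: finite_radonD)
    also have "\<dots> = (SUP K \<in> {K. compact K \<and> K \<subseteq> E}. \<Sum>j\<in>F. emeasure (N j) K)"
    proof (rule SUP_sum_directed_ennreal[OF F(1)])
      show "{K. compact K \<and> K \<subseteq> E} \<noteq> {}" by (auto intro: exI[of _ "{}"])
      fix K L assume "K \<in> {K. compact K \<and> K \<subseteq> E}" "L \<in> {K. compact K \<and> K \<subseteq> E}"
      then show "\<exists>H\<in>{K. compact K \<and> K \<subseteq> E}. \<forall>j\<in>F. emeasure (N j) K \<le> emeasure (N j) H
          \<and> emeasure (N j) L \<le> emeasure (N j) H"
        using F(2) s by (intro bexI[of _ "K \<union> L"] ballI conjI emeasure_mono)
          (auto intro!: borel_closed compact_imp_closed)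
    qed
    finally obtain K where K: "compact K" "K \<subseteq> E" "c < (\<Sum>j\<in>F. emeasure (N j) K)"
      using F(3) by (auto simp: less_SUP_iff)
    have "(\<Sum>j\<in>F. emeasure (N j) K) = (\<integral>\<^sup>+j. emeasure (N j) K * indicator F j \<partial>count_space J)"
      using F by (subst nn_integral_count_space'[of F]) auto
    also have "\<dots> \<le> (\<integral>\<^sup>+j. emeasure (N j) K \<partial>count_space J)"
      by (intro nn_integral_mono) (auto split: split_indicator)
    also have "\<dots> = emeasure (measure_sum J N) K"
      using K(1) by (subst em) (auto intro: borel_closed compact_imp_closed)
    finally show "\<exists>K. compact K \<and> K \<subseteq> E \<and> c \<le> emeasure (measure_sum J N) K"
      using K by (intro exI[of _ K]) (auto intro: less_imp_le less_le_trans)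
  qed simp
qed

lemma finite_radon_splits:
  assumes "finite_radon \<alpha>" "finite_radon \<beta>"
  obtains \<mu> where "splits \<mu> \<alpha> \<beta>" "finite_radon \<mu>"
proof -
  define N where "N b = (if b then \<alpha> else \<beta>)" for b
  have fr: "finite_radon (N b)" for b using assms by (auto simp: N_def)
  have s: "sets (N b) = sets borel" for b using finite_radonD(3)[OF fr] .
  have c: "(\<integral>\<^sup>+b. F b \<partial>count_space UNIV) = F True + F False" for F :: "bool \<Rightarrow> ennreal"
    by (subst nn_integral_count_space_finite) (auto simp: UNIV_bool)
  show ?thesis
  proof
    show "splits (measure_sum UNIV N) \<alpha> \<beta>"
      using assms[THEN finite_radonD(3)] by (auto simp: splits_def emeasure_measure_sum s c) (auto simp: N_def)
    show "finite_radon (measure_sum UNIV N)"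
      using fr finite_radonD(5)[OF fr] by (intro finite_radon_measure_sum) (auto simp: c)
  qed
qed

lemma finite_radon_scale:
  assumes "finite_radon \<mu>" "0 \<le> r"
  shows "finite_radon (scale_measure (ennreal r) \<mu>)"
proof (rule finite_radonI[OF radonI])
  show "sets (scale_measure (ennreal r) \<mu>) = sets borel" using finite_radonD(3)[OF assms(1)] by simp
  show U: "emeasure (scale_measure (ennreal r) \<mu>) E < \<infinity>" for E
    using finite_radonD(5)[OF assms(1), of E] by (simp add: ennreal_mult_less_top)
  show "emeasure (scale_measure (ennreal r) \<mu>) UNIV < \<infinity>" by (rule U)
  fix E :: "'a set" and c assume E: "E \<in> sets borel" and c: "c < emeasure (scale_measure (ennreal r) \<mu>) E"
  have "emeasure (scale_measure (ennreal r) \<mu>) E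
      = (SUP K \<in> {K. compact K \<and> K \<subseteq> E}. ennreal r * emeasure \<mu> K)"
    using radon_inner[OF finite_radonD(1)[OF assms(1)] E] by (simp add: SUP_mult_left_ennreal)
  then show "\<exists>K. compact K \<and> K \<subseteq> E \<and> c \<le> emeasure (scale_measure (ennreal r) \<mu>) K"
    using c by (auto simp: less_SUP_iff intro: less_imp_le)
qed

section \<open>Restrictions and differences\<close>

lemma emeasure_restrict_measure:
  assumes "sets \<mu> = sets borel" "B \<in> sets borel" "E \<in> sets borel"
  shows "emeasure (restrict_measure \<mu> B) E = emeasure \<mu> (E \<inter> B)"
  using assms unfolding restrict_measure_def
  by (subst emeasure_density) (auto simp flip: indicator_inter_arith simp: Int_commute)

lemma sets_restrict_measure [simp]: "sets (restrict_measure \<mu> B) = sets \<mu>"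
  by (simp add: restrict_measure_def)

lemma nn_integral_restrict_measure:
  assumes "sets \<mu> = sets borel" "B \<in> sets borel" "f \<in> borel_measurable borel"
  shows "(\<integral>\<^sup>+x. f x \<partial>restrict_measure \<mu> B) = (\<integral>\<^sup>+x. f x * indicator B x \<partial>\<mu>)"
proof -
  have "f \<in> borel_measurable \<mu>" using assms(1,3) measurable_cong_sets by blast
  then show ?thesis using assms unfolding restrict_measure_def
    by (subst nn_integral_density) (auto simp: mult.commute)
qed

lemma radon_restrict:
  assumes "radon \<mu>" "B \<in> sets borel"
  shows "radon (restrict_measure \<mu> B)"
proof (rule radonI)
  note em = emeasure_restrict_measure[OF radon_sets[OF assms(1)] assms(2)]
  show "sets (restrict_measure \<mu> B) = sets borel" using radon_sets[OF assms(1)] by simp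
  show "emeasure (restrict_measure \<mu> B) K < \<infinity>" if "compact K" for K
  proof -
    have "K \<in> sets borel" using that by (auto intro: borel_closed compact_imp_closed)
    then show ?thesis using radon_compact[OF assms(1) that] radon_sets[OF assms(1)]
        emeasure_mono[of "K \<inter> B" K \<mu>] by (auto simp: em intro: le_less_trans)
  qed
  fix E :: "'a set" and c assume E: "E \<in> sets borel" and c: "c < emeasure (restrict_measure \<mu> B) E"
  obtain K where K: "compact K" "K \<subseteq> E \<inter> B" "c < emeasure \<mu> K"
  proof (rule radon_inner_less[OF assms(1)])
    show "E \<inter> B \<in> sets borel" using E assms(2) by simp
    show "c < emeasure \<mu> (E \<inter> B)" using c em[OF E] by simp
  qed
  moreover have "emeasure (restrict_measure \<mu> B) K = emeasure \<mu> K"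
    using K by (subst em) (auto intro: borel_closed compact_imp_closed simp: Int_absorb2)
  ultimately show "\<exists>K. compact K \<and> K \<subseteq> E \<and> c \<le> emeasure (restrict_measure \<mu> B) K"
    by (intro exI[of _ K]) auto
qed

text \<open>Only \<nu> has to be finite: countable additivity of \<mu> - \<nu> follows by cancelling
  the finite \<nu>-measure of the union, also where \<mu> is infinite.\<close>

lemma measure_difference:
  assumes "sets \<nu> = sets \<mu>" "finite_measure \<nu>" and le: "\<And>E. E \<in> sets \<mu> \<Longrightarrow> emeasure \<nu> E \<le> emeasure \<mu> E"
  obtains \<delta> where "sets \<delta> = sets \<mu>" "\<And>E. E \<in> sets \<mu> \<Longrightarrow> emeasure \<mu> E = emeasure \<nu> E + emeasure \<delta> E"
proof -
  interpret \<nu>: finite_measure \<nu> by fact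
  let ?d = "\<lambda>E. emeasure \<mu> E - emeasure \<nu> E"
  have d: "emeasure \<mu> E = emeasure \<nu> E + ?d E" if "E \<in> sets \<mu>" for E
    using le[OF that] by (simp add: add_diff_inverse_ennreal)
  define \<delta> where "\<delta> = measure_of (space \<mu>) (sets \<mu>) ?d"
  have "emeasure \<delta> E = ?d E" if "E \<in> sets \<mu>" for E
    unfolding \<delta>_def
  proof (rule emeasure_measure_of_sigma[OF _ _ _ that])
    show "sigma_algebra (space \<mu>) (sets \<mu>)" ..
    show "positive (sets \<mu>) ?d" by (simp add: positive_def)
    show "countably_additive (sets \<mu>) ?d"
    proof (rule countably_additiveI)
      fix A :: "nat \<Rightarrow> 'a set" assume A: "range A \<subseteq> sets \<mu>" "disjoint_family A" "(\<Union>i. A i) \<in> sets \<mu>"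
      have "emeasure \<nu> (\<Union>i. A i) + (\<Sum>i. ?d (A i)) = (\<Sum>i. emeasure \<nu> (A i) + ?d (A i))"
        using A assms(1) by (simp add: suminf_emeasure flip: suminf_add)
      also have "\<dots> = (\<Sum>i. emeasure \<mu> (A i))" using A(1) d by (intro suminf_cong) auto
      also have "\<dots> = emeasure \<nu> (\<Union>i. A i) + ?d (\<Union>i. A i)"
        using A by (subst suminf_emeasure) (auto intro: d)
      finally show "(\<Sum>i. ?d (A i)) = ?d (\<Union>i. A i)"
        by (simp add: ennreal_add_left_cancel)
    qed
  qed
  then show ?thesis using d by (intro that[of \<delta>]) (auto simp: \<delta>_def)
qed

text \<open>Gives \<open>radon_diff\<close> its meaning: finiteness of \<nu> makes the difference
  unique, and a compact K inside E with \<xi>(K) > c + \<nu>(E) retains at least \<open>c\<close>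
  after \<nu> is removed, which is inner regularity.\<close>

lemma radon_difference:
  assumes \<xi>: "radon \<xi>" and \<nu>: "finite_radon \<nu>" and le: "\<And>E. E \<in> sets borel \<Longrightarrow> emeasure \<nu> E \<le> emeasure \<xi> E"
  shows "radon (radon_diff \<xi> \<nu>)" "splits \<xi> \<nu> (radon_diff \<xi> \<nu>)"
proof -
  interpret \<nu>: finite_measure \<nu> using finite_radonD(2)[OF \<nu>] .
  note s = radon_sets[OF \<xi>] finite_radonD(3)[OF \<nu>]
  obtain \<delta> where \<delta>: "sets \<delta> = sets borel" "\<And>E. E \<in> sets borel \<Longrightarrow> emeasure \<xi> E = emeasure \<nu> E + emeasure \<delta> E"
    using measure_difference[of \<nu> \<xi>] s le finite_radonD(2)[OF \<nu>] by metis
  have "radon \<delta>"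
  proof (rule radonI[OF \<delta>(1)])
    fix K :: "'a set" assume K: "compact K"
    then have Kb: "K \<in> sets borel" by (auto intro: borel_closed compact_imp_closed)
    have "emeasure \<delta> K \<le> emeasure \<xi> K" using \<delta>(2)[OF Kb] by simp
    then show "emeasure \<delta> K < \<infinity>" using radon_compact[OF \<xi> K] by (rule le_less_trans)
  next
    fix E :: "'a set" and c assume E: "E \<in> sets borel" and c: "c < emeasure \<delta> E"
    have "c + emeasure \<nu> E < emeasure \<xi> E"
      using c \<delta>(2)[OF E] by (simp add: add.commute[of c] ennreal_add_left_cancel_less)
    then obtain K where K: "compact K" "K \<subseteq> E" "c + emeasure \<nu> E < emeasure \<xi> K"
      by (rule radon_inner_less[OF \<xi> E])
    have Kb: "K \<in> sets borel" using K(1) by (auto intro: borel_closed compact_imp_closed)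
    have "emeasure \<nu> K + c \<le> emeasure \<nu> E + c"
      using K E s by (intro add_right_mono emeasure_mono) auto
    also have "\<dots> \<le> emeasure \<nu> K + emeasure \<delta> K" using K(3) \<delta>(2)[OF Kb] by (simp add: add.commute)
    finally have "c \<le> emeasure \<delta> K" by (simp add: ennreal_add_left_cancel_le)
    then show "\<exists>K. compact K \<and> K \<subseteq> E \<and> c \<le> emeasure \<delta> K" using K by blast
  qed
  moreover have "\<delta>' = \<delta>" if "radon \<delta>' \<and> (\<forall>B \<in> sets borel. emeasure \<xi> B = emeasure \<nu> B + emeasure \<delta>' B)" for \<delta>'
  proof (rule measure_eqI)
    show "sets \<delta>' = sets \<delta>" using that \<delta>(1) radon_sets by metis
    fix E assume "E \<in> sets \<delta>'"
    then have E: "E \<in> sets borel" using that radon_sets by metis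
    then have "emeasure \<nu> E + emeasure \<delta>' E = emeasure \<nu> E + emeasure \<delta> E" using that \<delta>(2) by metis
    then show "emeasure \<delta>' E = emeasure \<delta> E" by (simp add: ennreal_add_left_cancel)
  qed
  ultimately have "radon_diff \<xi> \<nu> = \<delta>"
    unfolding radon_diff_def using \<delta>(2) by (intro the_equality) blast+
  then show "radon (radon_diff \<xi> \<nu>)" "splits \<xi> \<nu> (radon_diff \<xi> \<nu>)"
    using \<open>radon \<delta>\<close> \<delta> s by (auto simp: splits_def)
qed

section \<open>Energies of finite Radon measures\<close>

text \<open>On a compact space the kernel may be negative; \<open>M\<close> is a constant such that \<open>\<kappa> + M\<close> is
  nonnegative, and energies are computed with \<open>\<kappa> + M\<close>, up to \<open>M\<close> times the total masses.\<close>

locale gauss_kernel =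
  fixes \<kappa> :: "'a::t2_space \<times> 'a \<Rightarrow> ereal" and M :: real
  assumes lc: "locally_compact_space (euclidean :: 'a topology)"
    and kernel: "energy_kernel \<kappa>" and pd: "positive_definite \<kappa>"
    and M_nonneg: "0 \<le> M" and kappa_bound: "\<And>z. - ereal M \<le> \<kappa> z"
    and M_cases: "M = 0 \<or> compact (UNIV :: 'a set)"
begin

definition k :: "'a \<times> 'a \<Rightarrow> ennreal" where "k z = e2ennreal (\<kappa> z + ereal M)"

definition pot :: "'a measure \<Rightarrow> 'a \<Rightarrow> ennreal" where "pot \<nu> x = (\<integral>\<^sup>+y. k (x, y) \<partial>\<nu>)"

definition energy :: "'a measure \<Rightarrow> 'a measure \<Rightarrow> ennreal" where "energy \<mu> \<nu> = (\<integral>\<^sup>+x. pot \<nu> x \<partial>\<mu>)"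

text \<open>Real-valued mutual energy for the original kernel; the shift by \<open>M\<close> is
  undone through the masses. As \<open>enn2real\<close> maps infinity to 0, this is meaningful only
  where \<open>energy\<close> is finite.\<close>

definition D :: "'a measure \<Rightarrow> 'a measure \<Rightarrow> real" where
  "D \<mu> \<nu> = enn2real (energy \<mu> \<nu>) - M * measure \<mu> UNIV * measure \<nu> UNIV"

lemma energy_iterated: "energy \<mu> \<nu> = iterated k \<mu> \<nu>"
  by (simp add: energy_def pot_def iterated_def)

lemma kappa_shift_nonneg: "0 \<le> \<kappa> z + ereal M"
  using kappa_bound[of z] by (cases "\<kappa> z") auto

lemma kappa_eq: "\<kappa> z = enn2ereal (k z) - ereal M"
  using kappa_shift_nonneg[of z] by (cases "\<kappa> z") (auto simp: k_def enn2ereal_e2ennreal)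

lemma less_k_iff: "c < k z \<longleftrightarrow> enn2ereal c - ereal M < \<kappa> z"
proof -
  have "c < k z \<longleftrightarrow> enn2ereal c < \<kappa> z + ereal M"
    using kappa_shift_nonneg[of z] by (simp add: k_def less_ennreal.rep_eq enn2ereal_e2ennreal)
  also have "\<dots> \<longleftrightarrow> enn2ereal c - ereal M < \<kappa> z"
    by (cases "\<kappa> z"; cases "enn2ereal c") auto
  finally show ?thesis .
qed

lemma lsc_k: "lsc k"
  using kernel by (simp add: lsc_def less_k_iff energy_kernel_def Psi_def)

lemma k_sym: "k (x, y) = k (y, x)"
  using kernel unfolding k_def energy_kernel_def by metis

lemma lsc_pot: "radon \<nu> \<Longrightarrow> lsc (pot \<nu>)"
  unfolding pot_def by (rule lsc_partial[OF lc lsc_k])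

lemma pot_measurable [measurable (raw)]: "radon \<nu> \<Longrightarrow> pot \<nu> \<in> borel_measurable borel"
  using lsc_measurable[OF lsc_pot] by simp

lemma k_section_measurable: "(\<lambda>y. k (x, y)) \<in> borel_measurable borel"
  using lsc_measurable[OF lsc_section[OF lsc_k]] by simp

lemma energy_commute: "finite_radon \<mu> \<Longrightarrow> finite_radon \<nu> \<Longrightarrow> energy \<mu> \<nu> = energy \<nu> \<mu>"
  unfolding energy_iterated by (intro iterated_swap lc lsc_k k_sym) (auto simp: finite_radon_def)

lemma D_commute: "finite_radon \<mu> \<Longrightarrow> finite_radon \<nu> \<Longrightarrow> D \<mu> \<nu> = D \<nu> \<mu>"
  by (simp add: D_def energy_commute)

text \<open>Finite mass is traded for M = 0 because in Case II the signed measure that generates the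
  field may have parts of infinite mass.\<close>

lemma mutual_energy_nonneg:
  assumes "M = 0" "radon \<mu>" "radon \<nu>"
  shows "mutual_energy \<kappa> \<mu> \<nu> = enn2ereal (energy \<mu> \<nu>)"
proof -
  have *: "k = (\<lambda>z. e2ennreal (\<kappa> z))" by (rule ext) (unfold k_def, simp add: assms(1))
  have "0 \<le> \<kappa> z" for z using kappa_shift_nonneg[of z] unfolding assms(1) by simp
  then show ?thesis
    unfolding energy_iterated * by (intro prod_integral_nonneg lc lsc_k[unfolded *] assms(2,3))
qed

lemma mutual_energy_eq:
  assumes "finite_radon \<mu>" "finite_radon \<nu>"
  shows "mutual_energy \<kappa> \<mu> \<nu> = enn2ereal (energy \<mu> \<nu>) - ereal (M * measure \<mu> UNIV * measure \<nu> UNIV)"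
proof (cases "M = 0")
  case True
  then show ?thesis using mutual_energy_nonneg assms by (simp add: finite_radon_def)
next
  case False
  then have c: "compact (UNIV :: 'a set)" using M_cases by simp
  have "prod_integral \<mu> \<nu> (\<lambda>z. \<kappa> z + ereal M) = enn2ereal (energy \<mu> \<nu>)"
    unfolding energy_iterated k_def using assms lsc_k kappa_shift_nonneg
    by (intro prod_integral_nonneg lc) (auto simp: finite_radon_def k_def[abs_def])
  then show ?thesis
    using prod_integral_shift[OF c M_nonneg kappa_bound, of \<mu> \<nu>] assms by (simp add: finite_radon_def)
qed

lemma energy_splits_left:
  assumes "splits \<mu> \<alpha> \<beta>" "radon \<nu>"
  shows "energy \<mu> \<nu> = energy \<alpha> \<nu> + energy \<beta> \<nu>"
  unfolding energy_def by (intro nn_integral_splits[OF assms(1)] pot_measurable assms(2))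

lemma pot_splits:
  assumes "splits \<mu> \<alpha> \<beta>"
  shows "pot \<mu> x = pot \<alpha> x + pot \<beta> x"
  unfolding pot_def by (intro nn_integral_splits[OF assms] k_section_measurable)

lemma energy_splits_right:
  assumes "splits \<mu> \<alpha> \<beta>" "radon \<alpha>" "radon \<beta>" "sets \<nu> = sets borel"
  shows "energy \<nu> \<mu> = energy \<nu> \<alpha> + energy \<nu> \<beta>"
proof -
  have "pot \<alpha> \<in> borel_measurable \<nu>" "pot \<beta> \<in> borel_measurable \<nu>"
    using assms pot_measurable measurable_cong_sets by blast+
  then show ?thesis unfolding energy_def pot_splits[OF assms(1)] by (rule nn_integral_add)
qed

lemma measure_splits:
  assumes "splits \<mu> \<alpha> \<beta>" "finite_radon \<mu>" "finite_radon \<alpha>" "finite_radon \<beta>" "E \<in> sets borel"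
  shows "measure \<mu> E = measure \<alpha> E + measure \<beta> E"
  using assms finite_radonD(6)[OF assms(2), of E] finite_radonD(6)[OF assms(3), of E]
    finite_radonD(6)[OF assms(4), of E]
  by (simp add: splits_def flip: ennreal_plus)

lemma D_splits_left:
  assumes "splits \<mu> \<alpha> \<beta>" "finite_radon \<mu>" "finite_radon \<alpha>" "finite_radon \<beta>" "finite_radon \<nu>"
    "energy \<alpha> \<nu> < \<infinity>" "energy \<beta> \<nu> < \<infinity>"
  shows "D \<mu> \<nu> = D \<alpha> \<nu> + D \<beta> \<nu>"
  using assms energy_splits_left[OF assms(1), of \<nu>] measure_splits[OF assms(1-4), of UNIV]
  by (simp add: D_def enn2real_plus finite_radon_def algebra_simps)

lemma energy_scale_left: "radon \<nu> \<Longrightarrow> sets \<mu> = sets borel \<Longrightarrow> energy (scale_measure r \<mu>) \<nu> = r * energy \<mu> \<nu>"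
  unfolding energy_def using pot_measurable[of \<nu>] measurable_cong_sets[of \<mu> borel]
  by (subst nn_integral_scale_measure) auto

lemma D_scale_left:
  assumes "finite_radon \<mu>" "finite_radon \<nu>" "0 \<le> r"
  shows "D (scale_measure (ennreal r) \<mu>) \<nu> = r * D \<mu> \<nu>"
  using assms finite_radonD[OF assms(1)] finite_radonD[OF assms(2)]
  by (simp add: D_def energy_scale_left enn2real_mult algebra_simps)

text \<open>Finite total mass is included, so that the mass terms in \<open>D\<close> are never the
  default value of \<open>measure\<close>.\<close>

definition finite_energy :: "'a measure \<Rightarrow> bool" where
  "finite_energy \<mu> \<longleftrightarrow> finite_radon \<mu> \<and> energy \<mu> \<mu> < \<infinity>"

lemma energy_mono:
  assumes "sets \<mu>' = sets borel" "\<And>E. E \<in> sets borel \<Longrightarrow> emeasure \<mu> E \<le> emeasure \<mu>' E"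
    "sets \<mu> = sets borel"
    "sets \<nu>' = sets borel" "\<And>E. E \<in> sets borel \<Longrightarrow> emeasure \<nu> E \<le> emeasure \<nu>' E" "sets \<nu> = sets borel"
  shows "energy \<mu> \<nu> \<le> energy \<mu>' \<nu>'"
proof -
  have 1: "\<mu> \<le> \<mu>'" "\<nu> \<le> \<nu>'" using assms by (simp_all add: le_measure)
  have "energy \<mu> \<nu> \<le> energy \<mu> \<nu>'"
    unfolding energy_def pot_def using assms 1 by (intro nn_integral_mono nn_integral_mono_measure) auto
  also have "\<dots> \<le> energy \<mu>' \<nu>'"
    unfolding energy_def using assms 1 by (intro nn_integral_mono_measure) auto
  finally show ?thesis .
qed

lemma finite_energy_le:
  assumes "finite_energy \<mu>" "sets \<nu> = sets borel" "\<And>E. E \<in> sets borel \<Longrightarrow> emeasure \<nu> E \<le> emeasure \<mu> E"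
  shows "finite_energy \<nu>"
proof -
  have "energy \<nu> \<nu> \<le> energy \<mu> \<mu>"
    using assms finite_radonD(3) by (intro energy_mono) (auto simp: finite_energy_def)
  then show ?thesis
    using assms finite_radon_le[of \<mu> \<nu>] by (auto simp: finite_energy_def)
qed

lemma finite_energy_restrict:
  assumes "finite_energy \<mu>" "B \<in> sets borel"
  shows "finite_energy (restrict_measure \<mu> B)"
proof (rule finite_energy_le[OF assms(1)])
  have s: "sets \<mu> = sets borel" using assms(1) finite_radonD(3) by (auto simp: finite_energy_def)
  then show "sets (restrict_measure \<mu> B) = sets borel" by simp
  show "emeasure (restrict_measure \<mu> B) E \<le> emeasure \<mu> E" if "E \<in> sets borel" for E
    using that assms(2) s by (auto simp: emeasure_restrict_measure intro!: emeasure_mono)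
qed

lemma pos_finite_energy_iff:
  assumes "finite_radon \<mu>"
  shows "\<bar>mutual_energy \<kappa> \<mu> \<mu>\<bar> \<noteq> \<infinity> \<longleftrightarrow> energy \<mu> \<mu> < \<infinity>"
  unfolding mutual_energy_eq[OF assms assms] by (cases "energy \<mu> \<mu>") (auto simp: top_ereal_def)

text \<open>Positive definiteness is assumed for Jordan decompositions only, so the common part of the two
  measures has to be split off first.\<close>

lemma
  assumes \<mu>: "finite_energy \<mu>" and \<nu>: "finite_energy \<nu>"
  shows energy_finite: "energy \<mu> \<nu> < \<infinity>" and D_pos: "2 * D \<mu> \<nu> \<le> D \<mu> \<mu> + D \<nu> \<nu>"
proof -
  have fr: "finite_radon \<mu>" "finite_radon \<nu>" using assms by (auto simp: finite_energy_def)
  note s = finite_radonD(3)[OF fr(1)] finite_radonD(3)[OF fr(2)]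
  obtain Y where Y: "Y \<in> sets borel" "\<And>E. E \<in> sets borel \<Longrightarrow> E \<subseteq> Y \<Longrightarrow> emeasure \<nu> E \<le> emeasure \<mu> E"
      "\<And>E. E \<in> sets borel \<Longrightarrow> E \<inter> Y = {} \<Longrightarrow> emeasure \<mu> E \<le> emeasure \<nu> E"
    using finite_unsigned_Hahn_decomposition[of \<mu> \<nu>] finite_radonD(2)[OF fr(1)] finite_radonD(2)[OF fr(2)] s
    by auto
  let ?r = "restrict_measure"
  have Yc: "- Y \<in> sets borel" using Y(1) by auto
  note em = emeasure_restrict_measure[OF s(1) Y(1)] emeasure_restrict_measure[OF s(1) Yc]
    emeasure_restrict_measure[OF s(2) Y(1)] emeasure_restrict_measure[OF s(2) Yc]
  have fer: "finite_energy (?r \<mu> Y)" "finite_energy (?r \<mu> (-Y))" "finite_energy (?r \<nu> Y)" "finite_energy (?r \<nu> (-Y))"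
    using assms Y(1) Yc by (auto intro: finite_energy_restrict)
  have frr: "finite_radon (?r \<mu> Y)" "finite_radon (?r \<mu> (-Y))" "finite_radon (?r \<nu> Y)" "finite_radon (?r \<nu> (-Y))"
    using fer by (auto simp: finite_energy_def)
  \<comment> \<open>Subtraction within the halves of the Hahn decomposition: \<open>p\<close> is
    \<mu> - \<nu> on \<open>Y\<close> and, below, \<open>n\<close> is \<nu> - \<mu> off
    \<open>Y\<close>. They live on disjoint sets, so their infimum is 0.\<close>
  obtain p where p: "sets p = sets borel" "\<And>E. E \<in> sets borel \<Longrightarrow> emeasure \<mu> (E \<inter> Y) = emeasure \<nu> (E \<inter> Y) + emeasure p E"
    using measure_difference[of "?r \<nu> Y" "?r \<mu> Y"] s Y em finite_radonD(2)[OF frr(3)]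
    by (metis inf_le2 sets.Int sets_restrict_measure)
  obtain n where n: "sets n = sets borel" "\<And>E. E \<in> sets borel \<Longrightarrow> emeasure \<nu> (E \<inter> -Y) = emeasure \<mu> (E \<inter> -Y) + emeasure n E"
    using measure_difference[of "?r \<mu> (-Y)" "?r \<nu> (-Y)"] s Y Yc em finite_radonD(2)[OF frr(2)]
    by (metis Int_assoc compl_inf_bot inf_bot_right sets.Int sets_restrict_measure)
  \<comment> \<open>\<open>m\<close> is the infimum of \<mu> and \<nu>, so that \<mu> = p + m and
    \<nu> = n + m.\<close>
  obtain m where m: "splits m (?r \<nu> Y) (?r \<mu> (-Y))" "finite_radon m"
    using finite_radon_splits[OF frr(3,2)] .
  have part: "emeasure \<theta> E = emeasure \<theta> (E \<inter> Y) + emeasure \<theta> (E \<inter> - Y)"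
    if "sets \<theta> = sets borel" "E \<in> sets borel" for \<theta> E
    using that Y(1) Yc by (subst plus_emeasure) (auto intro!: arg_cong[of _ _ "emeasure \<theta>"])
  have sp: "splits \<mu> p m" "splits \<nu> n m"
    unfolding splits_def using s p n m em part by (auto simp: splits_def ac_simps)
  have le: "emeasure p E \<le> emeasure \<mu> E" "emeasure n E \<le> emeasure \<nu> E" "emeasure m E \<le> emeasure \<mu> E"
    if "E \<in> sets borel" for E
    using that sp by (auto simp: splits_def)
  have fe: "finite_energy p" "finite_energy n" "finite_energy m"
    using finite_energy_le[OF \<mu>] finite_energy_le[OF \<nu>] le p(1) n(1) finite_radonD(3)[OF m(2)] by blast+
  then have pnm: "finite_radon p" "finite_radon n" "finite_radon m"
    and self: "energy p p < \<infinity>" "energy n n < \<infinity>" "energy m m < \<infinity>" by (auto simp: finite_energy_def)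
  note rad = finite_radonD(1)[OF pnm(1)] finite_radonD(1)[OF pnm(2)] finite_radonD(1)[OF pnm(3)]
    finite_radonD(1)[OF fr(1)] finite_radonD(1)[OF fr(2)]
  have "energy p m \<le> energy \<mu> \<mu>" "energy n m \<le> energy \<nu> \<nu>"
    using le p(1) n(1) s finite_radonD(3)[OF m(2)] sp by (auto intro!: energy_mono simp: splits_def)
  then have cross: "energy p m < \<infinity>" "energy n m < \<infinity>"
    using assms by (auto simp: finite_energy_def intro: le_less_trans)
  have sr: "signed_radon p n"
    unfolding signed_radon_def
  proof (intro conjI rad allI impI)
    fix \<tau> assume \<tau>: "radon \<tau> \<and> \<tau> \<le> p \<and> \<tau> \<le> n"
    then have st: "sets \<tau> = sets borel" using radon_sets by auto
    have "emeasure \<tau> Y \<le> emeasure n Y" using \<tau> st n(1) by (intro le_measureD3) auto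
    moreover have "emeasure \<tau> (-Y) \<le> emeasure p (-Y)" using \<tau> st p(1) by (intro le_measureD3) auto
    moreover have "emeasure n Y = 0" "emeasure p (-Y) = 0"
      using n(2)[OF Y(1)] p(2)[OF Yc] by auto
    ultimately have "emeasure \<tau> UNIV = 0" using part[OF st, of UNIV] by simp
    then have "emeasure \<tau> E = 0" for E
      using emeasure_space[of \<tau> E] sets_eq_imp_space_eq[OF st] by simp
    then show "\<tau> = null_measure borel" using st by (intro measure_eqI) auto
  qed
  have "\<bar>mutual_energy \<kappa> p p\<bar> \<noteq> \<infinity>" "\<bar>mutual_energy \<kappa> n n\<bar> \<noteq> \<infinity>"
    using pos_finite_energy_iff pnm self by auto
  then have sd: "signed_energy_defined \<kappa> p n"
    unfolding signed_energy_defined_def by (cases "mutual_energy \<kappa> p p"; cases "mutual_energy \<kappa> n n") auto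
  have pos: "0 \<le> signed_energy \<kappa> p n" using pd sr sd by (auto simp: positive_definite_def)
  have Dval: "mutual_energy \<kappa> \<alpha> \<beta> = ereal (D \<alpha> \<beta>)" if "finite_radon \<alpha>" "finite_radon \<beta>" "energy \<alpha> \<beta> < \<infinity>" for \<alpha> \<beta>
    using that by (cases "energy \<alpha> \<beta>") (auto simp: mutual_energy_eq D_def)
  \<comment> \<open>The self-energies of \<open>p\<close> and \<open>n\<close> are finite, so an
    infinite mutual energy would make the signed energy equal to -\<infinity>.\<close>
  have pn: "energy p n < \<infinity>"
  proof (rule ccontr)
    assume "\<not> ?thesis"
    then have "mutual_energy \<kappa> p n = \<infinity>" using pnm by (simp add: mutual_energy_eq top_ereal_def less_top[symmetric])
    then show False using pos Dval[of p p] Dval[of n n] self pnm by (simp add: signed_energy_def)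
  qed
  then have pnD: "2 * D p n \<le> D p p + D n n"
    using pos pnm self by (simp add: signed_energy_def Dval)
  note com = energy_commute[OF pnm(1,2)] energy_commute[OF pnm(1,3)] energy_commute[OF pnm(2,3)]
  note fin = self cross pn com[symmetric]
  have e: "energy \<mu> x = energy p x + energy m x" "energy \<nu> x = energy n x + energy m x" if "radon x" for x
    using energy_splits_left[OF sp(1) that] energy_splits_left[OF sp(2) that] .
  have e': "energy x \<mu> = energy x p + energy x m" "energy x \<nu> = energy x n + energy x m" if "sets x = sets borel" for x
    using energy_splits_right[OF sp(1) rad(1,3) that] energy_splits_right[OF sp(2) rad(2,3) that] .
  show "energy \<mu> \<nu> < \<infinity>"
    using fin rad pnm[THEN finite_radonD(3)] by (simp add: e e' s)
  have ms: "measure \<mu> UNIV = measure p UNIV + measure m UNIV" "measure \<nu> UNIV = measure n UNIV + measure m UNIV"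
    using measure_splits[OF sp(1) fr(1) pnm(1,3), of UNIV] measure_splits[OF sp(2) fr(2) pnm(2,3), of UNIV] by auto
  \<comment> \<open>All terms containing \<open>m\<close> cancel in D(\<mu>, \<mu>) + D(\<nu>,
    \<nu>) - 2 D(\<mu>, \<nu>), which leaves the signed energy of (p, n).\<close>
  have "D \<mu> \<mu> = D p p + 2 * D p m + D m m" "D \<nu> \<nu> = D n n + 2 * D n m + D m m"
    "D \<mu> \<nu> = D p n + D p m + D n m + D m m"
    using fin rad pnm[THEN finite_radonD(3)]
    by (simp_all add: D_def e e' s ms enn2real_plus algebra_simps)
  then show "2 * D \<mu> \<nu> \<le> D \<mu> \<mu> + D \<nu> \<nu>" using pnD by simp
qed

end

section \<open>Extended integrals, potentials and capacity\<close>

text \<open>Potentials and energies arrive as a difference p - q that need not be the decomposition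
  into positive and negative part. In truncated subtraction those parts are p - q and q - p, and
  integrating (p - q) + q = (q - p) + p gives the value without subtracting infinities.\<close>

lemma eint_difference:
  assumes [measurable]: "p \<in> borel_measurable M" "q \<in> borel_measurable M"
    and f: "\<And>x. x \<in> space M \<Longrightarrow> f x = enn2ereal (p x) - enn2ereal (q x)"
    and q: "\<And>x. x \<in> space M \<Longrightarrow> q x < \<infinity>" "(\<integral>\<^sup>+x. q x \<partial>M) < \<infinity>"
  shows "eint M f = enn2ereal (\<integral>\<^sup>+x. p x \<partial>M) - enn2ereal (\<integral>\<^sup>+x. q x \<partial>M)"
    and "eint_finite M f \<longleftrightarrow> (\<integral>\<^sup>+x. p x \<partial>M) < \<infinity>" and "eint_defined M f"
proof -
  have pt: "e2ennreal (f x) = p x - q x" "e2ennreal (- f x) = q x - p x" "p x - q x + q x = q x - p x + p x"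
    if x: "x \<in> space M" for x
  proof -
    obtain b where b: "q x = ennreal b" "0 \<le> b" using q(1)[OF x] by (cases "q x") auto
    show "e2ennreal (f x) = p x - q x" "e2ennreal (- f x) = q x - p x" "p x - q x + q x = q x - p x + p x"
    proof (atomize (full), cases "p x")
      case (real a)
      have fx: "f x = ereal (a - b)" using f[OF x] b real by simp
      have "ennreal (a - b) + ennreal b = ennreal (b - a) + ennreal a"
        using b real by (cases "b \<le> a") (simp_all add: ennreal_neg flip: ennreal_plus)
      then show "e2ennreal (f x) = p x - q x \<and> e2ennreal (- f x) = q x - p x \<and> p x - q x + q x = q x - p x + p x"
        using b real by (simp add: fx ennreal_minus)
    next
      case top
      then show "e2ennreal (f x) = p x - q x \<and> e2ennreal (- f x) = q x - p x \<and> p x - q x + q x = q x - p x + p x"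
        using f[OF x] b by (simp add: e2ennreal_neg ennreal_top_minus)
    qed
  qed
  let ?F = "\<integral>\<^sup>+x. e2ennreal (f x) \<partial>M" and ?N = "\<integral>\<^sup>+x. e2ennreal (- f x) \<partial>M"
  let ?P = "\<integral>\<^sup>+x. p x \<partial>M" and ?Q = "\<integral>\<^sup>+x. q x \<partial>M"
  have F: "?F = (\<integral>\<^sup>+x. p x - q x \<partial>M)" "?N = (\<integral>\<^sup>+x. q x - p x \<partial>M)"
    by (simp_all add: pt cong: nn_integral_cong)
  have "?F + ?Q = (\<integral>\<^sup>+x. p x - q x + q x \<partial>M)" unfolding F by (intro nn_integral_add[symmetric]) measurable
  also have "\<dots> = (\<integral>\<^sup>+x. q x - p x + p x \<partial>M)" using pt by (intro nn_integral_cong) auto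
  also have "\<dots> = ?N + ?P" unfolding F by (intro nn_integral_add) measurable
  finally have eq: "?F + ?Q = ?N + ?P" .
  have "?N \<le> ?Q" unfolding F by (intro nn_integral_mono) (simp add: diff_le_self_ennreal)
  then have N: "?N < \<infinity>" using q(2) by (rule le_less_trans)
  obtain b c where bc: "?Q = ennreal b" "0 \<le> b" "?N = ennreal c" "0 \<le> c"
    using N q(2) by (cases ?Q; cases ?N) auto
  show "eint M f = enn2ereal ?P - enn2ereal ?Q"
    using eq bc unfolding eint_def
    by (cases ?F; cases ?P) (auto simp: ennreal_plus[symmetric] simp del: ennreal_plus)
  show "eint_finite M f \<longleftrightarrow> ?P < \<infinity>"
    using eq bc unfolding eint_finite_def by (cases ?F; cases ?P) (auto simp flip: ennreal_plus)
  show "eint_defined M f" using N by (simp add: eint_defined_def)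
qed

lemma eint_finite_real:
  assumes f: "f \<in> borel_measurable M" and fin: "eint_finite M f"
  shows "AE x in M. \<bar>f x\<bar> \<noteq> \<infinity>" "integrable M (\<lambda>x. real_of_ereal (f x))"
    "eint M f = ereal (\<integral>x. real_of_ereal (f x) \<partial>M)"
proof -
  have m[measurable]: "(\<lambda>x. e2ennreal (f x)) \<in> borel_measurable M" "(\<lambda>x. e2ennreal (- f x)) \<in> borel_measurable M"
    using f by measurable
  have 1: "AE x in M. e2ennreal (f x) \<noteq> \<infinity>" "AE x in M. e2ennreal (- f x) \<noteq> \<infinity>"
    using fin nn_integral_PInf_AE[OF m(1)] nn_integral_PInf_AE[OF m(2)] by (simp_all add: eint_finite_def less_top)
  show ae: "AE x in M. \<bar>f x\<bar> \<noteq> \<infinity>" using 1 by eventually_elim auto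
  have real: "(\<integral>\<^sup>+x. ennreal (real_of_ereal (f x)) \<partial>M) = (\<integral>\<^sup>+x. e2ennreal (f x) \<partial>M)"
    "(\<integral>\<^sup>+x. ennreal (- real_of_ereal (f x)) \<partial>M) = (\<integral>\<^sup>+x. e2ennreal (- f x) \<partial>M)"
    using ae by (auto intro!: nn_integral_cong_AE elim!: eventually_mono) 
  have [measurable]: "(\<lambda>x. real_of_ereal (f x)) \<in> borel_measurable M" using f by measurable
  show int: "integrable M (\<lambda>x. real_of_ereal (f x))"
    using fin real by (intro real_integrable_def[THEN iffD2]) (auto simp: eint_finite_def)
  show "eint M f = ereal (\<integral>x. real_of_ereal (f x) \<partial>M)"
    using fin unfolding eint_def real_lebesgue_integral_def[OF int] real eint_finite_def
    by (cases "\<integral>\<^sup>+x. e2ennreal (f x) \<partial>M"; cases "\<integral>\<^sup>+x. e2ennreal (- f x) \<partial>M") auto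
qed

lemma eint_finite_realI:
  assumes "integrable M (\<lambda>x. real_of_ereal (f x))" "AE x in M. \<bar>f x\<bar> \<noteq> \<infinity>"
  shows "eint_finite M f"
proof -
  have "(\<integral>\<^sup>+x. ennreal (real_of_ereal (f x)) \<partial>M) = (\<integral>\<^sup>+x. e2ennreal (f x) \<partial>M)"
    "(\<integral>\<^sup>+x. ennreal (- real_of_ereal (f x)) \<partial>M) = (\<integral>\<^sup>+x. e2ennreal (- f x) \<partial>M)"
    using assms(2) by (auto intro!: nn_integral_cong_AE elim!: eventually_mono)
  then show ?thesis using assms(1) by (auto simp: eint_finite_def real_integrable_def top.not_eq_extremum)
qed

lemma eint_cong_AE:
  assumes "AE x in M. f x = g x"
  shows "eint M f = eint M g" "eint_finite M f \<longleftrightarrow> eint_finite M g"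
proof -
  have "(\<integral>\<^sup>+x. e2ennreal (f x) \<partial>M) = (\<integral>\<^sup>+x. e2ennreal (g x) \<partial>M)"
    "(\<integral>\<^sup>+x. e2ennreal (- f x) \<partial>M) = (\<integral>\<^sup>+x. e2ennreal (- g x) \<partial>M)"
    using assms by (auto intro!: nn_integral_cong_AE)
  then show "eint M f = eint M g" "eint_finite M f \<longleftrightarrow> eint_finite M g"
    by (auto simp: eint_def eint_finite_def)
qed

text \<open>Inner regularity exhausts the complement of \<open>A\<close> by compact sets, the only
  sets that \<open>carried_by\<close> tests.\<close>

lemma carried_by_iff:
  assumes "radon \<nu>" "A \<in> sets borel"
  shows "carried_by \<nu> A \<longleftrightarrow> emeasure \<nu> (- A) = 0"
proof
  assume c: "carried_by \<nu> A"
  have "emeasure \<nu> K = 0" if K: "compact K" "K \<subseteq> - A" for K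
  proof -
    have "K - A = K" using K(2) by auto
    then have "K \<in> null_sets (completion \<nu>)" using c K(1) unfolding carried_by_def by metis
    moreover have "K \<in> sets \<nu>"
      using K(1) radon_sets[OF assms(1)] by (auto intro: borel_closed compact_imp_closed)
    ultimately show ?thesis using null_sets_completion_iff by blast
  qed
  then have "(SUP K \<in> {K. compact K \<and> K \<subseteq> - A}. emeasure \<nu> K) \<le> 0" by (intro SUP_least) auto
  then show "emeasure \<nu> (- A) = 0" using radon_inner[OF assms(1), of "- A"] assms(2) by simp
next
  assume 0: "emeasure \<nu> (- A) = 0"
  have s: "- A \<in> sets \<nu>" using assms radon_sets[OF assms(1)] by auto
  then have "- A \<in> null_sets (completion \<nu>)" using 0 by (simp add: null_sets_completion_iff null_setsI)
  then have "K - A \<in> null_sets (completion \<nu>)" for K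
    by (rule null_sets_completion_subset[rotated]) auto
  then show "carried_by \<nu> A" by (simp add: carried_by_def)
qed

text \<open>\<open>Q\<close> need not be Borel. The measurable \<open>main_part\<close> of its
  complement has only null compact subsets, hence is null by inner regularity; so all mass lies on
  \<open>Q\<close>.\<close>

lemma carried_by_prob:
  assumes \<nu>: "radon \<nu>" and c: "carried_by \<nu> Q" and 1: "emeasure (completion \<nu>) Q = 1"
  shows "finite_radon \<nu>" "AE x in \<nu>. x \<in> Q" "emeasure \<nu> UNIV = 1"
proof -
  have Q: "Q \<in> sets (completion \<nu>)" using 1 emeasure_notin_sets by fastforce
  have sp: "space \<nu> = UNIV" using radon_space[OF \<nu>] .
  then have Qc: "- Q \<in> sets (completion \<nu>)" using sets.compl_sets[OF Q] by (simp add: Compl_eq_Diff_UNIV)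
  define S where "S = main_part \<nu> (- Q)"
  have S: "S \<in> sets \<nu>" "S \<subseteq> - Q"
    unfolding S_def using main_part_sets[OF Qc] main_part_null_part_Un[OF Qc] by blast+
  have "emeasure \<nu> S = 0"
  proof -
    have "emeasure \<nu> K = 0" if K: "compact K" "K \<subseteq> S" for K
    proof -
      have "K - Q = K" using K(2) S(2) by auto
      then have "K \<in> null_sets (completion \<nu>)" using c K(1) unfolding carried_by_def by metis
      moreover have "K \<in> sets \<nu>"
        using K(1) radon_sets[OF \<nu>] by (auto intro: borel_closed compact_imp_closed)
      ultimately show ?thesis using null_sets_completion_iff by blast
    qed
    then have "(SUP K \<in> {K. compact K \<and> K \<subseteq> S}. emeasure \<nu> K) \<le> 0" by (intro SUP_least) auto
    then show ?thesis using radon_inner[OF \<nu>, of S] S(1) radon_sets[OF \<nu>] by simp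
  qed
  then have N: "- Q \<in> null_sets (completion \<nu>)" using Qc by (simp add: S_def null_setsI)
  then have "AE x in completion \<nu>. x \<notin> - Q" by (rule AE_not_in)
  then show "AE x in \<nu>. x \<in> Q" by (simp add: AE_completion_iff)
  have "emeasure (completion \<nu>) (Q \<union> - Q) = emeasure (completion \<nu>) Q"
    by (rule emeasure_Un_null_set[OF Q N])
  then show U: "emeasure \<nu> UNIV = 1" using 1 radon_sets[OF \<nu>] by (simp add: sp)
  show "finite_radon \<nu>" using U by (intro finite_radonI \<nu>) simp
qed

section \<open>Potentials, and capacity zero tested by measures of finite energy\<close>

context gauss_kernel
begin

text \<open>The second alternative admits infinite measures. There \<open>measure\<close> may return
  its default 0, which is harmless as it is multiplied by M = 0.\<close>

lemma potential_eq:
  assumes "finite_radon \<nu> \<or> M = 0 \<and> radon \<nu>"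
  shows "potential \<kappa> \<nu> x = enn2ereal (pot \<nu> x) - ereal (M * measure \<nu> UNIV)"
proof -
  have r: "radon \<nu>" using assms by (auto simp: finite_radon_def)
  have Q: "(\<integral>\<^sup>+y. ennreal M \<partial>\<nu>) = ennreal (M * measure \<nu> UNIV)"
  proof (cases "M = 0")
    case False
    then have "finite_radon \<nu>" using assms by simp
    then show ?thesis using finite_radonD(4,6)[of \<nu>] M_nonneg by (simp add: ennreal_mult)
  qed simp
  have "potential \<kappa> \<nu> x = enn2ereal (\<integral>\<^sup>+y. k (x, y) \<partial>\<nu>) - enn2ereal (\<integral>\<^sup>+y. ennreal M \<partial>\<nu>)"
    unfolding potential_def
  proof (rule eint_difference(1))
    show "(\<lambda>y. k (x, y)) \<in> borel_measurable \<nu>"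
      using k_section_measurable radon_sets[OF r] measurable_cong_sets by blast
    show "\<kappa> (x, y) = enn2ereal (k (x, y)) - enn2ereal (ennreal M)" for y using kappa_eq M_nonneg by simp
    show "(\<integral>\<^sup>+y. ennreal M \<partial>\<nu>) < \<infinity>" unfolding Q by simp
  qed simp_all
  then show ?thesis unfolding Q pot_def using M_nonneg by simp
qed

lemma pot_finite_AE:
  assumes "finite_energy \<mu>" "finite_energy \<nu>"
  shows "AE x in \<mu>. pot \<nu> x \<noteq> \<infinity>"
proof -
  have "pot \<nu> \<in> borel_measurable \<mu>"
    using assms pot_measurable[of \<nu>] measurable_cong_sets[of \<mu> borel]
    unfolding finite_energy_def by (metis finite_radonD(1,3))
  then show ?thesis
    using energy_finite[OF assms] unfolding energy_def by (intro nn_integral_PInf_AE) auto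
qed

text \<open>\<open>D_pos\<close> speaks of finite measures only. It is applied to restrictions of
  \<open>p\<close> to compact sets, with a bound independent of the set; each bump sees
  \<open>p\<close> only on the compact projection of its support.\<close>

lemma energy_infinite_measure:
  assumes "M = 0" "radon p" "energy p p < \<infinity>" and \<mu>: "finite_energy \<mu>"
  shows "energy \<mu> p < \<infinity>"
proof -
  have \<mu>r: "radon \<mu>" "finite_radon \<mu>" using \<mu> by (auto simp: finite_energy_def finite_radon_def)
  have D0: "D \<alpha> \<beta> = enn2real (energy \<alpha> \<beta>)" for \<alpha> \<beta>
  proof -
    have "M * measure \<alpha> UNIV * measure \<beta> UNIV = 0" using assms(1) by simp
    then show ?thesis unfolding D_def by linarith
  qed
  \<comment> \<open>The bound from \<open>D_pos\<close>: half the sum of the self-energies, where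
    restricting \<open>p\<close> does not increase its energy.\<close>
  define c where "c = (enn2real (energy \<mu> \<mu>) + enn2real (energy p p)) / 2"
  have "energy \<mu> (restrict_measure p C) \<le> ennreal c" if C: "compact C" for C
  proof -
    have Cb: "C \<in> sets borel" using C by (auto intro: borel_closed compact_imp_closed)
    let ?q = "restrict_measure p C"
    note em = emeasure_restrict_measure[OF radon_sets[OF assms(2)] Cb]
    have le: "energy ?q ?q \<le> energy p p"
      using radon_sets[OF assms(2)] Cb by (intro energy_mono) (auto simp: em intro!: emeasure_mono)
    have "finite_radon ?q"
      using radon_restrict[OF assms(2) Cb] radon_compact[OF assms(2) C] by (intro finite_radonI) (auto simp: em)
    then have q: "finite_energy ?q" using le assms(3) by (auto simp: finite_energy_def intro: le_less_trans)
    have "enn2real (energy ?q ?q) \<le> enn2real (energy p p)"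
      using le assms(3) by (intro enn2real_mono) auto
    then have "enn2real (energy \<mu> ?q) \<le> c"
      using D_pos[OF \<mu> q] unfolding D0 c_def by simp
    then show ?thesis using energy_finite[OF \<mu> q] by (cases "energy \<mu> ?q") (auto intro: ennreal_leI)
  qed note bound = this
  have "energy \<mu> p \<le> ennreal c"
    unfolding energy_iterated iterated_SUP_bumps[OF lc lsc_k \<mu>r(1) assms(2)]
  proof (rule SUP_least)
    fix h assume "h \<in> bumps k"
    then have h: "h \<in> Cc" "\<And>z. 0 \<le> h z" "\<And>z. ennreal (h z) \<le> k z" by (auto simp: bumps_def)
    obtain K where K: "continuous_on UNIV h" "compact K" "\<And>z. z \<notin> K \<Longrightarrow> h z = 0" using CcE[OF h(1)] by metis
    have C: "compact (snd ` K)" by (intro compact_continuous_image K continuous_intros)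
    then have Cb: "snd ` K \<in> sets borel" by (auto intro: borel_closed compact_imp_closed)
    let ?q = "restrict_measure p (snd ` K)"
    have "(\<integral>\<^sup>+y. ennreal (h (x, y)) \<partial>p) = (\<integral>\<^sup>+y. ennreal (h (x, y)) \<partial>?q)" for x
    proof -
      have "(\<lambda>y. h (x, y)) \<in> borel_measurable borel"
        by (intro borel_measurable_continuous_onI continuous_on_compose2[OF K(1)] continuous_intros) auto
      then have "(\<integral>\<^sup>+y. ennreal (h (x, y)) \<partial>?q) = (\<integral>\<^sup>+y. ennreal (h (x, y)) * indicator (snd ` K) y \<partial>p)"
        by (intro nn_integral_restrict_measure radon_sets[OF assms(2)] Cb) measurable
      also have "\<dots> = (\<integral>\<^sup>+y. ennreal (h (x, y)) \<partial>p)"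
      proof (rule nn_integral_cong)
        fix y
        have "h (x, y) = 0" if "y \<notin> snd ` K" using that by (intro K(3)) force
        then show "ennreal (h (x, y)) * indicator (snd ` K) y = ennreal (h (x, y))"
          by (cases "y \<in> snd ` K") auto
      qed
      finally show ?thesis ..
    qed
    then have "ennreal (\<integral>x. \<integral>y. h (x, y) \<partial>p \<partial>\<mu>) = (\<integral>\<^sup>+x. \<integral>\<^sup>+y. ennreal (h (x, y)) \<partial>?q \<partial>\<mu>)"
      using Cc_nn_integral(2)[OF h(1,2) \<mu>r(1) assms(2)] by simp
    also have "\<dots> \<le> energy \<mu> ?q"
      unfolding energy_def pot_def using h(3) by (intro nn_integral_mono)
    also have "\<dots> \<le> ennreal c" by (rule bound[OF C])
    finally show "ennreal (\<integral>x. \<integral>y. h (x, y) \<partial>p \<partial>\<mu>) \<le> ennreal c" .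
  qed
  then show ?thesis by (auto intro: le_less_trans)
qed

lemma D_self_nonneg:
  assumes "finite_energy \<mu>"
  shows "0 \<le> D \<mu> \<mu>"
proof -
  have "finite_energy (null_measure borel)" by (rule finite_energy_le[OF assms]) auto
  then show ?thesis
    using D_pos[OF assms, of "null_measure borel"] by (simp add: D_def energy_def pot_def measure_def)
qed

lemma mutual_energy_D:
  assumes "finite_radon \<alpha>" "finite_radon \<beta>" "energy \<alpha> \<beta> < \<infinity>"
  shows "mutual_energy \<kappa> \<alpha> \<beta> = ereal (D \<alpha> \<beta>)"
  using assms by (cases "energy \<alpha> \<beta>") (auto simp: mutual_energy_eq D_def)

lemma capacity_members:
  assumes "\<nu> \<in> {\<nu> \<in> pos_finite_energy \<kappa> Q. emeasure (completion \<nu>) Q = 1}"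
  shows "finite_energy \<nu>" "AE x in \<nu>. x \<in> Q" "emeasure \<nu> UNIV = 1"
proof -
  have \<nu>: "radon \<nu>" "carried_by \<nu> Q" "\<bar>mutual_energy \<kappa> \<nu> \<nu>\<bar> \<noteq> \<infinity>" "emeasure (completion \<nu>) Q = 1"
    using assms by (auto simp: pos_finite_energy_def)
  note c = carried_by_prob[OF \<nu>(1,2,4)]
  show "finite_energy \<nu>" using \<nu>(3) pos_finite_energy_iff[OF c(1)] c(1) by (simp add: finite_energy_def)
  show "AE x in \<nu>. x \<in> Q" "emeasure \<nu> UNIV = 1" using c by auto
qed

text \<open>An empty class of competitors has infimum \<infinity>, hence capacity 0. So a property
  holds nearly everywhere as soon as no probability measure of finite energy lives on its
  exceptional set.\<close>

lemma capacity_zeroI: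
  assumes "\<And>\<nu>. finite_energy \<nu> \<Longrightarrow> (AE x in \<nu>. x \<in> Q) \<Longrightarrow> emeasure \<nu> UNIV = 1 \<Longrightarrow> False"
  shows "capacity \<kappa> Q = 0"
proof -
  have "{\<nu> \<in> pos_finite_energy \<kappa> Q. emeasure (completion \<nu>) Q = 1} = {}"
    using capacity_members[of _ Q] assms by blast
  then have "(INF \<nu> \<in> {\<nu> \<in> pos_finite_energy \<kappa> Q. emeasure (completion \<nu>) Q = 1}. mutual_energy \<kappa> \<nu> \<nu>) = \<infinity>"
    by (simp only: image_empty Inf_empty top_ereal_def)
  then show ?thesis by (simp add: capacity_def)
qed

text \<open>Otherwise the normalized restriction of \<mu> to \<open>E\<close> would compete for
  \<open>Q\<close> with finite energy and make the capacity positive.\<close>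

lemma capacity_zeroD:
  assumes "capacity \<kappa> Q = 0" and \<mu>: "finite_energy \<mu>" and E: "E \<in> sets borel" "E \<subseteq> Q"
  shows "emeasure \<mu> E = 0"
proof (rule ccontr)
  assume ne: "emeasure \<mu> E \<noteq> 0"
  let ?S = "{\<nu> \<in> pos_finite_energy \<kappa> Q. emeasure (completion \<nu>) Q = 1}"
  have fr: "finite_radon \<mu>" using \<mu> by (simp add: finite_energy_def)
  note s = finite_radonD(3)[OF fr]
  define m where "m = measure \<mu> E"
  have m: "0 < m" "emeasure \<mu> E = ennreal m"
    using ne finite_radonD(6)[OF fr, of E] by (auto simp: m_def zero_less_measure_iff less_le)
  define \<nu> where "\<nu> = scale_measure (ennreal (1 / m)) (restrict_measure \<mu> E)"
  have r: "finite_energy (restrict_measure \<mu> E)" by (rule finite_energy_restrict[OF \<mu> E(1)])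
  then have rr: "finite_radon (restrict_measure \<mu> E)" by (simp add: finite_energy_def)
  have \<nu>: "finite_radon \<nu>" unfolding \<nu>_def using m by (intro finite_radon_scale rr) auto
  note sn = finite_radonD(3)[OF \<nu>]
  have en: "emeasure \<nu> F = ennreal (1 / m) * emeasure \<mu> (F \<inter> E)" if "F \<in> sets borel" for F
    using emeasure_restrict_measure[OF s E(1) that] by (simp add: \<nu>_def)
  have "energy \<nu> \<nu> = ennreal (1 / m) * energy (restrict_measure \<mu> E) \<nu>"
    unfolding \<nu>_def using \<nu>[unfolded \<nu>_def] finite_radonD[OF rr] by (intro energy_scale_left) (auto simp: finite_radon_def)
  also have "energy (restrict_measure \<mu> E) \<nu> = ennreal (1 / m) * energy (restrict_measure \<mu> E) (restrict_measure \<mu> E)"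
    using energy_commute[OF rr \<nu>] finite_radonD[OF rr] energy_scale_left by (simp add: \<nu>_def)
  finally have efin: "energy \<nu> \<nu> < \<infinity>" using r by (auto simp: finite_energy_def ennreal_mult_less_top)
  have one: "ennreal (1 / m) * ennreal m = 1" using m(1) by (simp flip: ennreal_mult)
  have QE: "- E \<in> null_sets \<nu>" using en[of "- E"] E(1) sn by (auto intro: null_setsI)
  have QN: "- Q \<in> null_sets (completion \<nu>)"
    using QE E(2) by (intro null_sets_completion_subset[of "- Q" "- E"]) (auto simp: null_sets_completion_iff null_setsD2)
  have cb: "carried_by \<nu> Q"
    unfolding carried_by_def using QN by (auto intro: null_sets_completion_subset[rotated])
  have spc: "space (completion \<nu>) = UNIV" using finite_radonD(4)[OF \<nu>] by simp
  have QS: "Q \<in> sets (completion \<nu>)"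
    using sets.compl_sets[of "- Q" "completion \<nu>"] QN spc by (auto simp: Compl_eq_Diff_UNIV[symmetric])
  have "emeasure (completion \<nu>) (Q \<union> - Q) = emeasure (completion \<nu>) Q"
    by (rule emeasure_Un_null_set[OF QS QN])
  moreover have "emeasure (completion \<nu>) UNIV = emeasure \<nu> UNIV" using sn by simp
  ultimately have Q1: "emeasure (completion \<nu>) Q = 1" using en[of UNIV] m(2) one by simp
  have mem: "\<nu> \<in> ?S"
    using \<nu> cb Q1 efin pos_finite_energy_iff[OF \<nu>] by (auto simp: pos_finite_energy_def finite_radon_def)
  \<comment> \<open>Nonnegativity matters: \<open>inverse\<close> vanishes at -\<infinity> too, so
    zero capacity alone would not say that the infimum is \<infinity>.\<close>
  have "0 \<le> mutual_energy \<kappa> \<rho> \<rho>" if "\<rho> \<in> ?S" for \<rho>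
    using capacity_members(1)[OF that] D_self_nonneg[of \<rho>] mutual_energy_D[of \<rho> \<rho>] by (simp add: finite_energy_def)
  then have 0: "0 \<le> (INF \<nu>\<in>?S. mutual_energy \<kappa> \<nu> \<nu>)" by (intro INF_greatest)
  have "(INF \<nu>\<in>?S. mutual_energy \<kappa> \<nu> \<nu>) \<le> ereal (D \<nu> \<nu>)"
    using mem mutual_energy_D[OF \<nu> \<nu> efin] by (intro INF_lower2[of \<nu>]) auto
  then show False
    using 0 assms(1) unfolding capacity_def by (cases "INF \<nu>\<in>?S. mutual_energy \<kappa> \<nu> \<nu>") (auto split: if_splits)
qed

text \<open>In Case II the field is prescribed only off the set where both potentials are infinite.
  A measure of finite energy has finite mutual energy with \<open>p\<close>, so it does not charge
  that set.\<close>

lemma field_borel_version: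
  assumes cs: "field_case_I (Ipos \<union> Ineg) f \<or> field_case_II \<kappa> Ipos Ineg f" and i: "i \<in> Ipos \<union> Ineg"
  obtains f' Y where "f' \<in> borel_measurable borel" "Y \<in> sets borel" "\<And>x. x \<notin> Y \<Longrightarrow> f i x = f' x"
    "\<And>\<mu>. finite_energy \<mu> \<Longrightarrow> emeasure \<mu> Y = 0"
  using cs
proof
  assume "field_case_I (Ipos \<union> Ineg) f"
  then have "f i \<in> Psi" using i by (auto simp: field_case_I_def)
  then have "f i \<in> borel_measurable borel"
    by (intro borel_measurableI_greater) (auto simp: Psi_def)
  then show ?thesis by (intro that[of "f i" "{}"]) auto
next
  assume "field_case_II \<kappa> Ipos Ineg f"
  then obtain p n where pn: "signed_finite_energy \<kappa> p n"
    and f: "\<And>x. \<not> (potential \<kappa> p x = \<infinity> \<and> potential \<kappa> n x = \<infinity>) \<Longrightarrow>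
        f i x = plate_sign Ipos i * (potential \<kappa> p x - potential \<kappa> n x)"
    using i unfolding field_case_II_def by blast
  have rad: "radon p" "radon n" using pn by (auto simp: signed_finite_energy_def signed_radon_def)
  have fr: "finite_radon \<theta> \<or> M = 0 \<and> radon \<theta>" if "radon \<theta>" for \<theta> :: "'a measure"
  proof (cases "M = 0")
    case False
    then have "emeasure \<theta> UNIV < \<infinity>" using M_cases by (intro radon_compact[OF that]) simp
    then show ?thesis using finite_radonI[OF that] by simp
  qed (use that in simp)
  have [measurable]: "potential \<kappa> \<theta> \<in> borel_measurable borel" if "radon \<theta>" for \<theta>
  proof -
    have [measurable]: "pot \<theta> \<in> borel_measurable borel" using that by (rule pot_measurable)
    have "potential \<kappa> \<theta> = (\<lambda>x. enn2ereal (pot \<theta> x) - ereal (M * measure \<theta> UNIV))"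
      using potential_eq[OF fr[OF that]] by auto
    then show ?thesis by simp
  qed
  note [measurable] = this[OF rad(1)] this[OF rad(2)]
  define Y where "Y = {x. potential \<kappa> p x = \<infinity> \<and> potential \<kappa> n x = \<infinity>}"
  show ?thesis
  proof (rule that[of "\<lambda>x. plate_sign Ipos i * (potential \<kappa> p x - potential \<kappa> n x)" Y])
    show "(\<lambda>x. plate_sign Ipos i * (potential \<kappa> p x - potential \<kappa> n x)) \<in> borel_measurable borel" by measurable
    show Yb: "Y \<in> sets borel" unfolding Y_def by measurable
    show "f i x = plate_sign Ipos i * (potential \<kappa> p x - potential \<kappa> n x)" if "x \<notin> Y" for x
      using that f by (auto simp: Y_def)
    fix \<mu> assume \<mu>: "finite_energy \<mu>"
    \<comment> \<open>Whichever alternative of \<open>signed_energy_defined\<close> holds, finite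
      signed energy makes the sum of the self-energies finite, and then neither is
      \<infinity>.\<close>
    have "\<bar>mutual_energy \<kappa> p p + mutual_energy \<kappa> n n\<bar> \<noteq> \<infinity>"
      using pn unfolding signed_finite_energy_def signed_energy_defined_def signed_energy_def
      by (cases "mutual_energy \<kappa> p p"; cases "mutual_energy \<kappa> n n"; cases "mutual_energy \<kappa> p n") auto
    then have pfin: "mutual_energy \<kappa> p p \<noteq> \<infinity>" by auto
    have "energy \<mu> p < \<infinity>"
    proof (cases "M = 0")
      case True
      have "energy p p < \<infinity>"
        using pfin mutual_energy_nonneg[OF True rad(1) rad(1)] by (cases "energy p p") (auto simp: top_ereal_def)
      then show ?thesis by (rule energy_infinite_measure[OF True rad(1) _ \<mu>])
    next
      case False
      then have p: "finite_radon p" using fr[OF rad(1)] by auto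
      then have "energy p p < \<infinity>"
        using pfin mutual_energy_eq[OF p p] by (cases "energy p p") (auto simp: top_ereal_def)
      then show ?thesis using p \<mu> by (intro energy_finite) (auto simp: finite_energy_def)
    qed
    have \<mu>s: "sets \<mu> = sets borel" using \<mu> by (auto simp: finite_energy_def finite_radonD)
    have "pot p \<in> borel_measurable \<mu>" using pot_measurable[OF rad(1)] \<mu>s measurable_cong_sets by blast
    then have "AE x in \<mu>. pot p x \<noteq> \<infinity>"
      using \<open>energy \<mu> p < \<infinity>\<close> unfolding energy_def by (intro nn_integral_PInf_AE) auto
    then have "AE x in \<mu>. x \<notin> Y"
    proof eventually_elim
      case (elim x)
      then show ?case using potential_eq[OF fr[OF rad(1)], of x] by (cases "pot p x") (auto simp: Y_def)
    qed
    then show "emeasure \<mu> Y = 0" using Yb \<mu>s AE_iff_measurable[of Y \<mu> "\<lambda>x. x \<notin> Y"]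
      by (auto simp: sets_eq_imp_space_eq)
  qed
qed

end

section \<open>Vector measures\<close>

lemma nn_integral_count_space_Un:
  assumes "J \<inter> L = {}"
  shows "(\<integral>\<^sup>+i. F i \<partial>count_space (J \<union> L)) = (\<integral>\<^sup>+i. F i \<partial>count_space J) + (\<integral>\<^sup>+i. F i \<partial>count_space L)"
proof -
  have *: "(\<integral>\<^sup>+i. F i \<partial>count_space X) = (\<integral>\<^sup>+i. F i * indicator X i \<partial>count_space UNIV)" for X
    by (cases "X = UNIV") (simp_all add: nn_integral_count_space_indicator)
  have "(\<integral>\<^sup>+i. F i \<partial>count_space (J \<union> L)) = (\<integral>\<^sup>+i. F i * indicator J i + F i * indicator L i \<partial>count_space UNIV)"
    unfolding *[of "J \<union> L"] using assms by (auto intro!: nn_integral_cong split: split_indicator)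
  also have "\<dots> = (\<integral>\<^sup>+i. F i * indicator J i \<partial>count_space UNIV) + (\<integral>\<^sup>+i. F i * indicator L i \<partial>count_space UNIV)"
    by (rule nn_integral_add) auto
  finally show ?thesis unfolding *[of J] *[of L] .
qed

lemma nn_integral_count_space_Times:
  "(\<integral>\<^sup>+z. F z \<partial>count_space (J \<times> L)) = (\<integral>\<^sup>+i. \<integral>\<^sup>+j. F (i, j) \<partial>count_space L \<partial>count_space J)"
proof -
  have "(\<integral>\<^sup>+z. F z \<partial>count_space (J \<times> L)) = (\<integral>\<^sup>+z. F z * indicator (J \<times> L) z \<partial>count_space UNIV)"
    by (cases "J \<times> L = UNIV") (simp_all add: nn_integral_count_space_indicator)
  also have "\<dots> = (\<integral>\<^sup>+i. \<integral>\<^sup>+j. F (i, j) * indicator (J \<times> L) (i, j) \<partial>count_space UNIV \<partial>count_space UNIV)"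
    by (rule nn_integral_fst_count_space[symmetric])
  also have "\<dots> = (\<integral>\<^sup>+i. (\<integral>\<^sup>+j. F (i, j) \<partial>count_space L) * indicator J i \<partial>count_space UNIV)"
  proof (rule nn_integral_cong)
    fix i
    show "(\<integral>\<^sup>+j. F (i, j) * indicator (J \<times> L) (i, j) \<partial>count_space UNIV) = (\<integral>\<^sup>+j. F (i, j) \<partial>count_space L) * indicator J i"
    proof (cases "i \<in> J")
      case True
      then have "(\<integral>\<^sup>+j. F (i, j) * indicator (J \<times> L) (i, j) \<partial>count_space UNIV) = (\<integral>\<^sup>+j. F (i, j) * indicator L j \<partial>count_space UNIV)"
        by (intro nn_integral_cong) (auto split: split_indicator)
      then show ?thesis using True
        by (cases "L = UNIV") (simp_all add: nn_integral_count_space_indicator)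
    qed simp
  qed
  also have "\<dots> = (\<integral>\<^sup>+i. \<integral>\<^sup>+j. F (i, j) \<partial>count_space L \<partial>count_space J)"
    by (cases "J = UNIV") (simp_all add: nn_integral_count_space_indicator)
  finally show ?thesis .
qed

text \<open>Carries the summability assumption, stated by \<open>infsum\<close>, over to integrals
  with respect to \<open>count_space\<close>.\<close>

lemma nn_integral_count_space_le_infsum:
  fixes b :: "'i \<Rightarrow> ennreal"
  assumes "countable J"
  shows "(\<integral>\<^sup>+i. b i \<partial>count_space J) \<le> infsum b J"
proof (rule ccontr)
  assume "\<not> ?thesis"
  then have "infsum b J < (\<integral>\<^sup>+i. b i \<partial>count_space J)" by simp
  then obtain F where F: "finite F" "F \<subseteq> J" "infsum b J < (\<Sum>j\<in>F. b j)"
    by (rule count_space_finite_approx[OF assms])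
  have "(\<Sum>j\<in>F. b j) \<le> infsum b J"
    using F by (subst nonneg_infsum_complete) (auto intro: SUP_upper)
  then show False using F(3) by simp
qed

text \<open>Isolates one component; replacing that component then changes a single summand.\<close>

lemma splits_measure_sum:
  assumes s: "\<And>j. j \<in> J \<Longrightarrow> sets (N j) = sets borel" and "i \<in> J"
  shows "splits (measure_sum J N) (N i) (measure_sum (J - {i}) N)"
  unfolding splits_def
proof (intro conjI ballI)
  fix E :: "'b set" assume E: "E \<in> sets borel"
  have "(\<integral>\<^sup>+j. emeasure (N j) E \<partial>count_space J) = emeasure (N i) E + (\<integral>\<^sup>+j. emeasure (N j) E \<partial>count_space (J - {i}))"
    using nn_integral_count_space_Un[of "{i}" "J - {i}" "\<lambda>j. emeasure (N j) E"]
    by (simp add: nn_integral_count_space_finite insert_absorb[OF assms(2)])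
  then show "emeasure (measure_sum J N) E = emeasure (N i) E + emeasure (measure_sum (J - {i}) N) E"
    using emeasure_measure_sum[of J N E] emeasure_measure_sum[of "J - {i}" N E] s E by simp
qed (use assms in auto)

lemma emeasure_measure_sum_ge:
  assumes "\<And>j. j \<in> J \<Longrightarrow> sets (N j) = sets borel" "i \<in> J" "E \<in> sets borel"
  shows "emeasure (N i) E \<le> emeasure (measure_sum J N) E"
  using splits_measure_sum[OF assms(1,2)] assms(3) by (auto simp: splits_def)

lemma measure_sum_cong:
  "(\<And>j. j \<in> J \<Longrightarrow> N j = N' j) \<Longrightarrow> measure_sum J N = measure_sum J N'"
  unfolding measure_sum_def by (intro arg_cong[where f="measure_of UNIV (sets borel)"] ext nn_integral_cong) auto

text \<open>Both cases of the external field enter through a Borel function \<open>f' i\<close> that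
  agrees with \<open>f i\<close> off a Borel set \<open>Y i\<close> charged by no measure of finite
  energy. From here on the two cases are treated alike.\<close>

locale gauss_problem = gauss_kernel \<kappa> M
  for \<kappa> :: "'a::t2_space \<times> 'a \<Rightarrow> ereal" and M :: real +
  fixes Ipos Ineg I I0 :: "'i set" and A B :: "'i \<Rightarrow> 'a set" and a :: "'i \<Rightarrow> real"
    and g :: "'i \<Rightarrow> 'a \<Rightarrow> real" and f :: "'i \<Rightarrow> 'a \<Rightarrow> ereal" and \<xi> :: "'i \<Rightarrow> 'a measure"
    and f' :: "'i \<Rightarrow> 'a \<Rightarrow> ereal" and Y :: "'i \<Rightarrow> 'a set"
  assumes I: "I = Ipos \<union> Ineg"
    and condenser: "generalized_condenser Ipos Ineg A"
    and a_pos: "\<And>i. i \<in> I \<Longrightarrow> 0 < a i"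
    and g: "\<And>i. i \<in> I \<Longrightarrow> continuous_on UNIV (g i) \<and> (\<forall>x. 0 < g i x)"
    and I0: "I0 \<subseteq> I"
    and \<xi>: "\<And>i. i \<in> I0 \<Longrightarrow> radon (\<xi> i) \<and> carried_by (\<xi> i) (A i)
           \<and> ereal (a i) < eint (\<xi> i) (\<lambda>x. ereal (g i x))"
    and nearly_closed: "nearly_closed_via \<kappa> I A B"
    and summable: "(\<Sum>\<^sub>\<infinity>i\<in>I. ennreal (a i) / ennreal (INF x \<in> A i. g i x)) < \<infinity>"
    and \<xi>_energy: "\<And>i K. i \<in> I0 \<Longrightarrow> compact K \<Longrightarrow> K \<subseteq> finite_part f A i \<Longrightarrow>
           restrict_measure (\<xi> i) K \<in> pos_finite_energy \<kappa> UNIV"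
    and \<xi>_finite_part: "\<And>i. i \<in> I0 \<Longrightarrow> AE x in \<xi> i. x \<notin> A i - finite_part f A i"
    and f_lower: "\<And>i. i \<in> I \<Longrightarrow> \<exists>c::real. \<forall>x \<in> B i. ereal c \<le> f i x"
    and f': "\<And>i. i \<in> I \<Longrightarrow> f' i \<in> borel_measurable borel"
    and Y: "\<And>i. i \<in> I \<Longrightarrow> Y i \<in> sets borel"
    and f_eq: "\<And>i x. i \<in> I \<Longrightarrow> x \<notin> Y i \<Longrightarrow> f i x = f' i x"
    and Y_null: "\<And>i \<mu>. i \<in> I \<Longrightarrow> finite_energy \<mu> \<Longrightarrow> emeasure \<mu> (Y i) = 0"
begin

lemma disjoint: "Ipos \<inter> Ineg = {}" and countable_I: "countable I"
  and A_borel: "i \<in> I \<Longrightarrow> A i \<in> sets borel"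
  using condenser by (auto simp: generalized_condenser_def I)

definition sgn_of :: "'i \<Rightarrow> real" where "sgn_of i = (if i \<in> Ipos then 1 else - 1)"

definition field :: "'i \<Rightarrow> 'a measure \<Rightarrow> real" where
  "field i \<nu> = (\<integral>x. real_of_ereal (f' i x) \<partial>\<nu>)"

text \<open>The admissibility conditions link different components only through the convergence of
  series, so components can be varied one at a time.\<close>

definition component :: "'i \<Rightarrow> 'a measure \<Rightarrow> bool" where
  "component i \<nu> \<longleftrightarrow> finite_energy \<nu> \<and> emeasure \<nu> (- A i) = 0
     \<and> (\<integral>\<^sup>+x. ennreal (g i x) \<partial>\<nu>) = ennreal (a i)
     \<and> (i \<in> I0 \<longrightarrow> (\<forall>E \<in> sets borel. emeasure \<nu> E \<le> emeasure (\<xi> i) E))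
     \<and> (AE x in \<nu>. \<bar>f' i x\<bar> \<noteq> \<infinity>) \<and> integrable \<nu> (\<lambda>x. real_of_ereal (f' i x))"

abbreviation pos_part :: "('i \<Rightarrow> 'a measure) \<Rightarrow> 'a measure" where "pos_part \<equiv> measure_sum Ipos"
abbreviation neg_part :: "('i \<Rightarrow> 'a measure) \<Rightarrow> 'a measure" where "neg_part \<equiv> measure_sum Ineg"

text \<open>The energy of the signed measure \<open>pos_part \<mu>\<close> minus
  \<open>neg_part \<mu>\<close>, expanded by bilinearity so that only positive measures
  occur.\<close>

definition total_energy :: "('i \<Rightarrow> 'a measure) \<Rightarrow> real" where
  "total_energy \<mu> = D (pos_part \<mu>) (pos_part \<mu>) + D (neg_part \<mu>) (neg_part \<mu>) - 2 * D (pos_part \<mu>) (neg_part \<mu>)"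

text \<open>Once the total mass is finite, finite energy of the unsigned sum of all components is
  equivalent to absolute convergence of the double series of signed mutual energies.\<close>

definition admissible' :: "('i \<Rightarrow> 'a measure) \<Rightarrow> bool" where
  "admissible' \<mu> \<longleftrightarrow> (\<forall>i\<in>I. component i (\<mu> i)) \<and> finite_energy (measure_sum I \<mu>)
     \<and> integrable (count_space I) (\<lambda>i. field i (\<mu> i))"

text \<open>A vanishing infimum would make a_i / 0 = \<open>top\<close> a term of the convergent
  series.\<close>

lemma g_inf_pos:
  assumes "i \<in> I"
  shows "0 < (INF x \<in> A i. g i x)"
proof (rule ccontr)
  assume "\<not> ?thesis"
  then have "ennreal (INF x \<in> A i. g i x) = 0" by (simp add: ennreal_neg)
  then have "ennreal (a i) / ennreal (INF x \<in> A i. g i x) = top"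
    using a_pos[OF assms] by (simp add: ennreal_divide_zero)
  moreover have "(\<integral>\<^sup>+i. ennreal (a i) / ennreal (INF x \<in> A i. g i x) \<partial>count_space I) < \<infinity>"
    using nn_integral_count_space_le_infsum[OF countable_I] summable by (rule le_less_trans)
  ultimately show False
    using nn_integral_ge_point[OF assms, of "\<lambda>i. ennreal (a i) / ennreal (INF x \<in> A i. g i x)"] by simp
qed

lemma g_measurable: "i \<in> I \<Longrightarrow> sets \<nu> = sets borel \<Longrightarrow> (\<lambda>x. ennreal (g i x)) \<in> borel_measurable \<nu>"
  using g[of i] borel_measurable_continuous_onI[of "g i"] measurable_cong_sets[of \<nu> borel] by auto

lemma eint_g:
  assumes "i \<in> I"
  shows "eint \<nu> (\<lambda>x. ereal (g i x)) = enn2ereal (\<integral>\<^sup>+x. ennreal (g i x) \<partial>\<nu>)"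
  using g[OF assms] by (simp add: eint_def ennreal_neg less_imp_le zero_ennreal.rep_eq)

text \<open>Chebyshev's inequality: g_i is at least its infimum on the set that carries
  \<nu>.\<close>

lemma mass_bound:
  assumes i: "i \<in> I" and s: "sets \<nu> = sets borel" and 0: "emeasure \<nu> (- A i) = 0"
    and int: "(\<integral>\<^sup>+x. ennreal (g i x) \<partial>\<nu>) = ennreal (a i)"
  shows "emeasure \<nu> UNIV \<le> ennreal (a i) / ennreal (INF x \<in> A i. g i x)"
proof -
  define b where "b = (INF x \<in> A i. g i x)"
  have b: "0 < b" using g_inf_pos[OF i] by (simp add: b_def)
  have Ab: "A i \<in> sets \<nu>" "- A i \<in> sets \<nu>" using A_borel[OF i] s by auto
  have "emeasure \<nu> (A i \<union> - A i) = emeasure \<nu> (A i)"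
    using Ab 0 by (intro emeasure_Un_null_set) auto
  then have "ennreal b * emeasure \<nu> UNIV = (\<integral>\<^sup>+x. ennreal b * indicator (A i) x \<partial>\<nu>)"
    using Ab by (simp add: nn_integral_cmult_indicator)
  also have "\<dots> \<le> (\<integral>\<^sup>+x. ennreal (g i x) \<partial>\<nu>)"
  proof (rule nn_integral_mono)
    fix x
    have "bdd_below (g i ` A i)" using g[OF i] by (intro bdd_belowI[of _ 0]) (auto intro: less_imp_le)
    then have "b \<le> g i x" if "x \<in> A i" unfolding b_def using that by (rule cINF_lower)
    then show "ennreal b * indicator (A i) x \<le> ennreal (g i x)"
      by (auto split: split_indicator intro: ennreal_leI)
  qed
  finally have "emeasure \<nu> UNIV * ennreal b \<le> ennreal (a i)" using int by (simp add: mult.commute)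
  then have "emeasure \<nu> UNIV * ennreal b / ennreal b \<le> ennreal (a i) / ennreal b"
    by (rule divide_right_mono_ennreal)
  then show ?thesis unfolding b_def[symmetric] using b by (simp add: mult_divide_eq_ennreal)
qed

lemma total_mass:
  assumes "\<And>i. i \<in> I \<Longrightarrow> sets (\<mu> i) = sets borel \<and> emeasure (\<mu> i) (- A i) = 0
    \<and> (\<integral>\<^sup>+x. ennreal (g i x) \<partial>\<mu> i) = ennreal (a i)"
  shows "(\<integral>\<^sup>+i. emeasure (\<mu> i) UNIV \<partial>count_space I) < \<infinity>"
proof -
  have "(\<integral>\<^sup>+i. emeasure (\<mu> i) UNIV \<partial>count_space I)
      \<le> (\<integral>\<^sup>+i. ennreal (a i) / ennreal (INF x \<in> A i. g i x) \<partial>count_space I)"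
    using assms mass_bound by (intro nn_integral_mono) auto
  also have "\<dots> < \<infinity>"
    using nn_integral_count_space_le_infsum[OF countable_I] summable by (rule le_less_trans)
  finally show ?thesis .
qed

lemma finite_radon_parts:
  assumes "\<And>i. i \<in> I \<Longrightarrow> finite_radon (\<mu> i)" "(\<integral>\<^sup>+i. emeasure (\<mu> i) UNIV \<partial>count_space I) < \<infinity>" "J \<subseteq> I"
  shows "finite_radon (measure_sum J \<mu>)"
proof (rule finite_radon_measure_sum)
  show "countable J" using assms(3) countable_I countable_subset by blast
  have "I = J \<union> (I - J)" using assms(3) by auto
  then have "(\<integral>\<^sup>+i. emeasure (\<mu> i) UNIV \<partial>count_space I) = (\<integral>\<^sup>+i. emeasure (\<mu> i) UNIV \<partial>count_space J)
      + (\<integral>\<^sup>+i. emeasure (\<mu> i) UNIV \<partial>count_space (I - J))"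
    by (metis Diff_disjoint nn_integral_count_space_Un)
  then show "(\<integral>\<^sup>+i. emeasure (\<mu> i) UNIV \<partial>count_space J) < \<infinity>" using assms(2) by simp
qed (use assms in auto)

text \<open>Bilinearity for infinite sums. The inner sum is exchanged with the integral against each
  \<mu> i, for which \<open>L\<close> is countable.\<close>

lemma energy_measure_sum:
  assumes "countable L" and J: "\<And>j. j \<in> J \<Longrightarrow> finite_radon (\<mu> j)" and L: "\<And>j. j \<in> L \<Longrightarrow> finite_radon (\<nu> j)"
    "radon (measure_sum L \<nu>)"
  shows "energy (measure_sum J \<mu>) (measure_sum L \<nu>)
    = (\<integral>\<^sup>+i. \<integral>\<^sup>+j. energy (\<mu> i) (\<nu> j) \<partial>count_space L \<partial>count_space J)"
proof -
  have sJ: "sets (\<mu> j) = sets borel" if "j \<in> J" for j using J[OF that] finite_radonD(3) by blast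
  have sL: "sets (\<nu> j) = sets borel" if "j \<in> L" for j using L(1)[OF that] finite_radonD(3) by blast
  have "energy (measure_sum J \<mu>) (measure_sum L \<nu>) = (\<integral>\<^sup>+i. energy (\<mu> i) (measure_sum L \<nu>) \<partial>count_space J)"
    unfolding energy_def by (intro nn_integral_measure_sum sJ pot_measurable L(2))
  also have "\<dots> = (\<integral>\<^sup>+i. \<integral>\<^sup>+j. energy (\<mu> i) (\<nu> j) \<partial>count_space L \<partial>count_space J)"
  proof (rule nn_integral_cong)
    fix i assume "i \<in> space (count_space J)"
    then have i: "i \<in> J" by simp
    have "energy (\<mu> i) (measure_sum L \<nu>) = (\<integral>\<^sup>+x. \<integral>\<^sup>+j. pot (\<nu> j) x \<partial>count_space L \<partial>\<mu> i)"
      unfolding energy_def pot_def by (simp add: nn_integral_measure_sum[OF sL k_section_measurable])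
    also have "\<dots> = (\<integral>\<^sup>+j. energy (\<mu> i) (\<nu> j) \<partial>count_space L)"
      unfolding energy_def
    proof (rule nn_integral_count_space_nn_integral[OF assms(1)])
      fix j assume "j \<in> L"
      then show "pot (\<nu> j) \<in> borel_measurable (\<mu> i)"
        using L(1) pot_measurable measurable_cong_sets[OF sJ[OF i] refl] finite_radonD(1) by blast
    qed
    finally show "energy (\<mu> i) (measure_sum L \<nu>) = (\<integral>\<^sup>+j. energy (\<mu> i) (\<nu> j) \<partial>count_space L)" .
  qed
  finally show ?thesis .
qed

lemma plate_sign_cases: "plate_sign Ipos i * plate_sign Ipos j = (if (i \<in> Ipos) = (j \<in> Ipos) then 1 else - 1)"
  by (auto simp: plate_sign_def one_ereal_def)

section \<open>Energy and potential of a vector measure through its positive and negative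
  parts\<close>

context
  fixes \<mu> :: "'i \<Rightarrow> 'a measure"
  assumes fr: "\<And>i. i \<in> I \<Longrightarrow> finite_radon (\<mu> i)"
    and mass: "(\<integral>\<^sup>+i. emeasure (\<mu> i) UNIV \<partial>count_space I) < \<infinity>"
begin

lemma finite_radon_sub: "J \<subseteq> I \<Longrightarrow> finite_radon (measure_sum J \<mu>)"
  by (rule finite_radon_parts[OF fr mass])

lemma finite_radon_pn: "finite_radon (pos_part \<mu>)" "finite_radon (neg_part \<mu>)" "finite_radon (measure_sum I \<mu>)"
  by (intro finite_radon_sub; simp add: I)+

lemma sets_comp: "i \<in> I \<Longrightarrow> sets (\<mu> i) = sets borel"
  using fr finite_radonD(3) by blast

lemma emeasure_comp: "i \<in> I \<Longrightarrow> emeasure (\<mu> i) UNIV = ennreal (measure (\<mu> i) UNIV)"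
  using fr finite_radonD(6) by blast

lemma sum_split: "(\<integral>\<^sup>+i. F i \<partial>count_space I) = (\<integral>\<^sup>+i. F i \<partial>count_space Ipos) + (\<integral>\<^sup>+i. F i \<partial>count_space Ineg)"
  unfolding I by (rule nn_integral_count_space_Un[OF disjoint])

lemma finite_energy_components:
  assumes "finite_energy (measure_sum I \<mu>)"
  shows "i \<in> I \<Longrightarrow> finite_energy (\<mu> i)" "finite_energy (pos_part \<mu>)" "finite_energy (neg_part \<mu>)"
proof -
  show "i \<in> I \<Longrightarrow> finite_energy (\<mu> i)"
    using sets_comp emeasure_measure_sum_ge[of I \<mu> i] by (intro finite_energy_le[OF assms]) auto
  have s: "\<And>i. i \<in> Ipos \<Longrightarrow> sets (\<mu> i) = sets borel" "\<And>i. i \<in> Ineg \<Longrightarrow> sets (\<mu> i) = sets borel"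
    using sets_comp by (auto simp: I)
  show "finite_energy (pos_part \<mu>)" "finite_energy (neg_part \<mu>)"
    by (rule finite_energy_le[OF assms], simp,
        simp add: emeasure_measure_sum s emeasure_measure_sum[OF sets_comp] sum_split)+
qed

lemma mass_sum:
  assumes "J \<subseteq> I"
  shows "(\<integral>\<^sup>+i. ennreal (M * measure (\<mu> i) UNIV) \<partial>count_space J) = ennreal (M * measure (measure_sum J \<mu>) UNIV)"
proof -
  have "(\<integral>\<^sup>+i. ennreal (M * measure (\<mu> i) UNIV) \<partial>count_space J) = (\<integral>\<^sup>+i. ennreal M * emeasure (\<mu> i) UNIV \<partial>count_space J)"
    using assms M_nonneg by (intro nn_integral_cong) (auto simp: ennreal_mult emeasure_comp)
  also have "\<dots> = ennreal M * emeasure (measure_sum J \<mu>) UNIV"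
    using assms sets_comp by (simp add: nn_integral_cmult emeasure_measure_sum subset_eq)
  also have "\<dots> = ennreal (M * measure (measure_sum J \<mu>) UNIV)"
    using finite_radonD(6)[OF finite_radon_sub[OF assms], of UNIV] M_nonneg by (simp add: ennreal_mult)
  finally show ?thesis .
qed

lemma mass_sum2:
  assumes "J \<subseteq> I" "L \<subseteq> I"
  shows "(\<integral>\<^sup>+i. \<integral>\<^sup>+j. ennreal (M * measure (\<mu> i) UNIV * measure (\<mu> j) UNIV) \<partial>count_space L \<partial>count_space J)
    = ennreal (M * measure (measure_sum J \<mu>) UNIV * measure (measure_sum L \<mu>) UNIV)"
proof -
  have one: "(\<integral>\<^sup>+j. emeasure (\<mu> j) UNIV \<partial>count_space L) = ennreal (measure (measure_sum L \<mu>) UNIV)"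
    using assms(2) sets_comp finite_radonD(6)[OF finite_radon_sub[OF assms(2)], of UNIV]
    by (simp add: emeasure_measure_sum subset_eq)
  have "(\<integral>\<^sup>+i. \<integral>\<^sup>+j. ennreal (M * measure (\<mu> i) UNIV * measure (\<mu> j) UNIV) \<partial>count_space L \<partial>count_space J)
      = (\<integral>\<^sup>+i. ennreal (M * measure (\<mu> i) UNIV) * ennreal (measure (measure_sum L \<mu>) UNIV) \<partial>count_space J)"
  proof (rule nn_integral_cong)
    fix i
    have "(\<integral>\<^sup>+j. ennreal (M * measure (\<mu> i) UNIV * measure (\<mu> j) UNIV) \<partial>count_space L)
        = (\<integral>\<^sup>+j. ennreal (M * measure (\<mu> i) UNIV) * emeasure (\<mu> j) UNIV \<partial>count_space L)"
      using assms(2) M_nonneg by (intro nn_integral_cong) (auto simp: ennreal_mult emeasure_comp)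
    then show "(\<integral>\<^sup>+j. ennreal (M * measure (\<mu> i) UNIV * measure (\<mu> j) UNIV) \<partial>count_space L)
        = ennreal (M * measure (\<mu> i) UNIV) * ennreal (measure (measure_sum L \<mu>) UNIV)"
      by (simp add: nn_integral_cmult one)
  qed
  also have "\<dots> = ennreal (M * measure (measure_sum J \<mu>) UNIV) * ennreal (measure (measure_sum L \<mu>) UNIV)"
    by (simp add: nn_integral_multc mass_sum[OF assms(1)])
  finally show ?thesis using M_nonneg by (simp add: ennreal_mult)
qed

text \<open>Up to sign a term is e - c, with e the shifted energy and c the mass correction, and e
  \<le> |e - c| + c. The corrections are summable because the masses are.\<close>

lemma vector_energy_finite:
  assumes "eint_finite (count_space (I \<times> I)) (energy_terms \<kappa> Ipos \<mu>)"
  shows "finite_energy (measure_sum I \<mu>)"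
proof -
  let ?t = "energy_terms \<kappa> Ipos \<mu>"
  have le: "energy (\<mu> i) (\<mu> j) \<le> e2ennreal (?t (i, j)) + e2ennreal (- ?t (i, j))
      + ennreal (M * measure (\<mu> i) UNIV * measure (\<mu> j) UNIV)" if ij: "i \<in> I" "j \<in> I" for i j
  proof -
    define c where "c = M * measure (\<mu> i) UNIV * measure (\<mu> j) UNIV"
    have c: "0 \<le> c" using M_nonneg by (simp add: c_def)
    have t: "?t (i, j) = enn2ereal (energy (\<mu> i) (\<mu> j)) - ereal c
        \<or> ?t (i, j) = - (enn2ereal (energy (\<mu> i) (\<mu> j)) - ereal c)"
      unfolding case_prod_conv plate_sign_cases mutual_energy_eq[OF fr[OF ij(1)] fr[OF ij(2)]] c_def by auto
    show ?thesis
    proof (cases "energy (\<mu> i) (\<mu> j)")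
      case (real e)
      have "ennreal e \<le> ennreal (e - c) + ennreal c"
        using real c by (cases "c \<le> e") (auto simp flip: ennreal_plus intro: ennreal_leI le_add_same_cancel2 add_increasing)
      also have "\<dots> \<le> e2ennreal (?t (i, j)) + e2ennreal (- ?t (i, j)) + ennreal c"
        using t real c by (intro add_right_mono) auto
      finally show ?thesis using real by (simp add: c_def)
    next
      case top
      then show ?thesis using t c by (auto simp: c_def)
    qed
  qed
  have "energy (measure_sum I \<mu>) (measure_sum I \<mu>) = (\<integral>\<^sup>+z. energy (\<mu> (fst z)) (\<mu> (snd z)) \<partial>count_space (I \<times> I))"
    using finite_radonD(1)[OF finite_radon_pn(3)]
    by (simp add: energy_measure_sum[OF countable_I fr fr] nn_integral_count_space_Times)
  also have "\<dots> \<le> (\<integral>\<^sup>+z. e2ennreal (?t z) + e2ennreal (- ?t z)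
      + ennreal (M * measure (\<mu> (fst z)) UNIV * measure (\<mu> (snd z)) UNIV) \<partial>count_space (I \<times> I))"
    using le by (intro nn_integral_mono) auto
  also have "\<dots> = (\<integral>\<^sup>+z. e2ennreal (?t z) \<partial>count_space (I \<times> I)) + (\<integral>\<^sup>+z. e2ennreal (- ?t z) \<partial>count_space (I \<times> I))
      + (\<integral>\<^sup>+z. ennreal (M * measure (\<mu> (fst z)) UNIV * measure (\<mu> (snd z)) UNIV) \<partial>count_space (I \<times> I))"
    by (subst nn_integral_add; simp add: nn_integral_add)
  also have "\<dots> < \<infinity>"
    using assms by (simp add: eint_finite_def nn_integral_count_space_Times mass_sum2)
  finally show ?thesis using finite_radon_pn(3) by (simp add: finite_energy_def)
qed

text \<open>For \<open>eint_difference\<close> each term is put as p - q: \<open>p\<close> collects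
  the shifted energies of like-signed pairs and the mass corrections of opposite pairs,
  \<open>q\<close> the rest. Both sums are finite because the energies of the two parts are.\<close>

lemma vector_energy_value:
  assumes fe: "finite_energy (measure_sum I \<mu>)"
  shows "eint_finite (count_space (I \<times> I)) (energy_terms \<kappa> Ipos \<mu>)"
    and "vector_energy \<kappa> Ipos Ineg \<mu> = ereal (total_energy \<mu>)"
proof -
  let ?t = "energy_terms \<kappa> Ipos \<mu>" and ?S = "count_space (I \<times> I)"
  define e where "e i j = energy (\<mu> i) (\<mu> j)" for i j
  define m where "m i j = ennreal (M * measure (\<mu> i) UNIV * measure (\<mu> j) UNIV)" for i j
  define same where "same i j \<longleftrightarrow> (i \<in> Ipos) = (j \<in> Ipos)" for i j
  define p where "p z = (case z of (i, j) \<Rightarrow> if same i j then e i j else m i j)" for z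
  define q where "q z = (case z of (i, j) \<Rightarrow> if same i j then m i j else e i j)" for z
  let ?P = "pos_part \<mu>" and ?N = "neg_part \<mu>"
  note fpn = finite_energy_components(2,3)[OF fe]
  note fin = energy_finite[OF fpn(1,1)] energy_finite[OF fpn(1,2)] energy_finite[OF fpn(2,1)] energy_finite[OF fpn(2,2)]
  have en: "(\<integral>\<^sup>+i. \<integral>\<^sup>+j. e i j \<partial>count_space L \<partial>count_space J) = energy (measure_sum J \<mu>) (measure_sum L \<mu>)"
    if "J \<subseteq> I" "L \<subseteq> I" for J L
    unfolding e_def
  proof (rule energy_measure_sum[symmetric])
    show "radon (measure_sum L \<mu>)" using finite_radonD(1)[OF finite_radon_sub[OF that(2)]] .
  qed (use that fr countable_I in \<open>auto intro: countable_subset\<close>)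
  \<comment> \<open>The four sign blocks of I x I; the two diagonal blocks see only
    \<open>x\<close>, the other two only \<open>y\<close>.\<close>
  have blocks: "(\<integral>\<^sup>+z. (case z of (i, j) \<Rightarrow> if same i j then x i j else y i j) \<partial>?S)
      = (\<integral>\<^sup>+i. \<integral>\<^sup>+j. x i j \<partial>count_space Ipos \<partial>count_space Ipos) + (\<integral>\<^sup>+i. \<integral>\<^sup>+j. y i j \<partial>count_space Ineg \<partial>count_space Ipos)
      + ((\<integral>\<^sup>+i. \<integral>\<^sup>+j. y i j \<partial>count_space Ipos \<partial>count_space Ineg) + (\<integral>\<^sup>+i. \<integral>\<^sup>+j. x i j \<partial>count_space Ineg \<partial>count_space Ineg))"
    for x y :: "'i \<Rightarrow> 'i \<Rightarrow> ennreal"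
  proof -
    have neg: "i \<notin> Ipos" if "i \<in> Ineg" for i using that disjoint by auto
    have "(\<integral>\<^sup>+z. (case z of (i, j) \<Rightarrow> if same i j then x i j else y i j) \<partial>?S)
        = (\<integral>\<^sup>+i. (\<integral>\<^sup>+j. (if same i j then x i j else y i j) \<partial>count_space Ipos)
          + (\<integral>\<^sup>+j. (if same i j then x i j else y i j) \<partial>count_space Ineg) \<partial>count_space I)"
      by (simp add: nn_integral_count_space_Times sum_split[of "\<lambda>j. if same i j then x i j else y i j" for i])
    also have "\<dots> = (\<integral>\<^sup>+i. (\<integral>\<^sup>+j. x i j \<partial>count_space Ipos) + (\<integral>\<^sup>+j. y i j \<partial>count_space Ineg) \<partial>count_space Ipos)
        + (\<integral>\<^sup>+i. (\<integral>\<^sup>+j. y i j \<partial>count_space Ipos) + (\<integral>\<^sup>+j. x i j \<partial>count_space Ineg) \<partial>count_space Ineg)"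
      unfolding sum_split using neg
      by (intro arg_cong2[where f="(+)"] nn_integral_cong) (auto simp: same_def intro!: nn_integral_cong)
    finally show ?thesis by (simp add: nn_integral_add)
  qed
  have sub: "Ipos \<subseteq> I" "Ineg \<subseteq> I" by (auto simp: I)
  have intp: "(\<integral>\<^sup>+z. p z \<partial>?S) = energy ?P ?P + ennreal (M * measure ?P UNIV * measure ?N UNIV)
      + (ennreal (M * measure ?N UNIV * measure ?P UNIV) + energy ?N ?N)"
    unfolding p_def blocks using sub by (simp add: en m_def mass_sum2)
  have intq: "(\<integral>\<^sup>+z. q z \<partial>?S) = ennreal (M * measure ?P UNIV * measure ?P UNIV) + energy ?P ?N
      + (energy ?N ?P + ennreal (M * measure ?N UNIV * measure ?N UNIV))"
    unfolding q_def blocks using sub by (simp add: en m_def mass_sum2)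
  have t: "?t z = enn2ereal (p z) - enn2ereal (q z) \<and> q z < \<infinity>" if zI: "z \<in> I \<times> I" for z
  proof -
    obtain i j where z: "z = (i, j)" "i \<in> I" "j \<in> I" using zI by auto
    have "e i j < \<infinity>"
      unfolding e_def using z fe by (intro energy_finite finite_energy_components)
    then obtain r where r: "0 \<le> r" "e i j = ennreal r" by (cases "e i j") auto
    have "?t z = (if same i j then 1 else - 1) * (ereal r - ereal (M * measure (\<mu> i) UNIV * measure (\<mu> j) UNIV))"
      unfolding z(1) case_prod_conv plate_sign_cases mutual_energy_eq[OF fr[OF z(2)] fr[OF z(3)]] same_def
      using r by (simp add: e_def)
    then show ?thesis using r M_nonneg by (simp add: z p_def q_def m_def)
  qed
  have meas: "p \<in> borel_measurable ?S" "q \<in> borel_measurable ?S" by auto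
  have qfin: "(\<integral>\<^sup>+z. q z \<partial>?S) < \<infinity>" unfolding intq using fin by simp
  have pfin: "(\<integral>\<^sup>+z. p z \<partial>?S) < \<infinity>" unfolding intp using fin by simp
  note ed = eint_difference[OF meas, of ?t, OF _ _ qfin]
  show "eint_finite ?S ?t" using ed(2) t pfin by simp
  have "eint ?S ?t = enn2ereal (\<integral>\<^sup>+z. p z \<partial>?S) - enn2ereal (\<integral>\<^sup>+z. q z \<partial>?S)" using ed(1) t by simp
  also have "\<dots> = ereal (total_energy \<mu>)"
    unfolding intp intq total_energy_def D_def
    using fin energy_commute[OF finite_radon_pn(2,1)] M_nonneg
    by (cases "energy ?P ?P"; cases "energy ?N ?N"; cases "energy ?P ?N")
      (simp_all add: algebra_simps flip: ennreal_plus)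
  finally show "vector_energy \<kappa> Ipos Ineg \<mu> = ereal (total_energy \<mu>)" by (simp add: vector_energy_def I)
qed

text \<open>The same regrouping for a single row of the energy matrix; finiteness of both potentials
  at \<open>x\<close> takes the place of finite energy.\<close>

lemma vector_potential_value:
  assumes i: "i \<in> I" and x: "pot (pos_part \<mu>) x < \<infinity>" "pot (neg_part \<mu>) x < \<infinity>"
  shows "eint_defined (count_space I) (potential_terms \<kappa> Ipos \<mu> i x)"
    and "vector_potential \<kappa> Ipos Ineg \<mu> i x = ereal (sgn_of i *
      ((enn2real (pot (pos_part \<mu>) x) - M * measure (pos_part \<mu>) UNIV)
       - (enn2real (pot (neg_part \<mu>) x) - M * measure (neg_part \<mu>) UNIV)))"
proof -
  let ?t = "potential_terms \<kappa> Ipos \<mu> i x" and ?S = "count_space I"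
  define m where "m j = ennreal (M * measure (\<mu> j) UNIV)" for j
  define same where "same j \<longleftrightarrow> (i \<in> Ipos) = (j \<in> Ipos)" for j
  define p where "p j = (if same j then pot (\<mu> j) x else m j)" for j
  define q where "q j = (if same j then m j else pot (\<mu> j) x)" for j
  let ?P = "pos_part \<mu>" and ?N = "neg_part \<mu>"
  have neg: "j \<notin> Ipos" if "j \<in> Ineg" for j using that disjoint by auto
  have sub: "Ipos \<subseteq> I" "Ineg \<subseteq> I" by (auto simp: I)
  have ps: "(\<integral>\<^sup>+j. pot (\<mu> j) x \<partial>count_space J) = pot (measure_sum J \<mu>) x" if "J \<subseteq> I" for J
    unfolding pot_def using that sets_comp by (subst nn_integral_measure_sum[OF _ k_section_measurable]) auto
  have pj: "pot (\<mu> j) x < \<infinity>" if "j \<in> I" for j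
  proof -
    have "pot (\<mu> j) x \<le> (\<integral>\<^sup>+j. pot (\<mu> j) x \<partial>count_space I)" by (rule nn_integral_ge_point[OF that])
    also have "\<dots> < \<infinity>" unfolding sum_split ps[OF sub(1)] ps[OF sub(2)] using x by simp
    finally show ?thesis .
  qed
  have blocks: "(\<integral>\<^sup>+j. (if same j then a j else b j) \<partial>?S)
      = (if i \<in> Ipos then (\<integral>\<^sup>+j. a j \<partial>count_space Ipos) + (\<integral>\<^sup>+j. b j \<partial>count_space Ineg)
         else (\<integral>\<^sup>+j. b j \<partial>count_space Ipos) + (\<integral>\<^sup>+j. a j \<partial>count_space Ineg))" for a b :: "'i \<Rightarrow> ennreal"
    unfolding sum_split using neg by (auto simp: same_def intro!: arg_cong2[where f="(+)"] nn_integral_cong)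
  have intp: "(\<integral>\<^sup>+j. p j \<partial>?S) = (if i \<in> Ipos then pot ?P x + ennreal (M * measure ?N UNIV)
      else ennreal (M * measure ?P UNIV) + pot ?N x)"
    unfolding p_def blocks using sub by (simp add: ps mass_sum m_def[abs_def])
  have intq: "(\<integral>\<^sup>+j. q j \<partial>?S) = (if i \<in> Ipos then ennreal (M * measure ?P UNIV) + pot ?N x
      else pot ?P x + ennreal (M * measure ?N UNIV))"
    unfolding q_def blocks using sub by (simp add: ps mass_sum m_def[abs_def])
  have t: "?t j = enn2ereal (p j) - enn2ereal (q j) \<and> q j < \<infinity>" if j: "j \<in> I" for j
  proof -
    obtain r where r: "0 \<le> r" "pot (\<mu> j) x = ennreal r" using pj[OF j] by (cases "pot (\<mu> j) x") auto
    have "?t j = (if same j then 1 else - 1) * (ereal r - ereal (M * measure (\<mu> j) UNIV))"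
      unfolding plate_sign_cases same_def using potential_eq[of "\<mu> j" x] fr[OF j] r by simp
    then show ?thesis using r M_nonneg by (simp add: p_def q_def m_def)
  qed
  have meas: "p \<in> borel_measurable ?S" "q \<in> borel_measurable ?S" by auto
  have qfin: "(\<integral>\<^sup>+j. q j \<partial>?S) < \<infinity>" unfolding intq using x by simp
  note ed = eint_difference[OF meas, of ?t, OF _ _ qfin]
  show "eint_defined ?S ?t" using ed(3) t by simp
  have "eint ?S ?t = enn2ereal (\<integral>\<^sup>+j. p j \<partial>?S) - enn2ereal (\<integral>\<^sup>+j. q j \<partial>?S)" using ed(1) t by simp
  also have "\<dots> = ereal (sgn_of i * ((enn2real (pot ?P x) - M * measure ?P UNIV)
       - (enn2real (pot ?N x) - M * measure ?N UNIV)))"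
    unfolding intp intq sgn_of_def using x M_nonneg
    by (cases "pot ?P x"; cases "pot ?N x") (simp_all add: algebra_simps flip: ennreal_plus)
  finally show "vector_potential \<kappa> Ipos Ineg \<mu> i x = ereal (sgn_of i *
      ((enn2real (pot ?P x) - M * measure ?P UNIV) - (enn2real (pot ?N x) - M * measure ?N UNIV)))"
    by (simp add: vector_potential_def I)
qed

end

end

section \<open>Variation of a single component\<close>

lemma integral_count_space_Un:
  fixes F :: "'i \<Rightarrow> real"
  assumes "J \<inter> L = {}" "integrable (count_space J) F" "integrable (count_space L) F"
  shows "integrable (count_space (J \<union> L)) F"
    and "(\<integral>i. F i \<partial>count_space (J \<union> L)) = (\<integral>i. F i \<partial>count_space J) + (\<integral>i. F i \<partial>count_space L)"
proof -
  have r: "count_space X = restrict_space (count_space UNIV) X" for X :: "'i set"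
    by (simp add: restrict_count_space)
  have s: "integrable (count_space X) F \<longleftrightarrow> set_integrable (count_space UNIV) X F"
    "(\<integral>i. F i \<partial>count_space X) = set_lebesgue_integral (count_space UNIV) X F" for X
    unfolding r[of X] by (simp_all add: integrable_restrict_space integral_restrict_space
        set_integrable_def set_lebesgue_integral_def)
  show "integrable (count_space (J \<union> L)) F"
    using assms unfolding s by (intro set_integrable_Un) auto
  show "(\<integral>i. F i \<partial>count_space (J \<union> L)) = (\<integral>i. F i \<partial>count_space J) + (\<integral>i. F i \<partial>count_space L)"
    using assms unfolding s by (intro set_integral_Un) auto
qed

lemma integral_count_space_update:
  fixes F :: "'i \<Rightarrow> real"
  assumes "i \<in> J" "integrable (count_space J) F" "\<And>j. j \<noteq> i \<Longrightarrow> F' j = F j"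
  shows "integrable (count_space J) F'"
    and "(\<integral>j. F' j \<partial>count_space J) = (\<integral>j. F j \<partial>count_space J) + F' i - F i"
proof -
  have F': "F' = (\<lambda>j. F j + (F' i - F i) * indicator {i} j)"
    using assms(3) by (auto split: split_indicator)
  have fin: "emeasure (count_space J) {i} = 1" using assms(1) by simp
  have int: "integrable (count_space J) (\<lambda>j. (F' i - F i) * indicator {i} j)"
    using assms(1) fin by (intro integrable_mult_right integrable_real_indicator) auto
  show "integrable (count_space J) F'" by (subst F') (intro Bochner_Integration.integrable_add assms(2) int)
  have "(\<integral>j. F' j \<partial>count_space J) = (\<integral>j. F j \<partial>count_space J) + (\<integral>j. (F' i - F i) * indicator {i} j \<partial>count_space J)"
    by (subst F') (intro Bochner_Integration.integral_add assms(2) int)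
  also have "(\<integral>j. (F' i - F i) * indicator {i} j \<partial>count_space J) = F' i - F i"
    using assms(1) by (simp add: measure_def)
  finally show "(\<integral>j. F' j \<partial>count_space J) = (\<integral>j. F j \<partial>count_space J) + F' i - F i" by simp
qed

lemma integral_splits:
  fixes h :: "'a::topological_space \<Rightarrow> real"
  assumes s: "splits \<mu> \<alpha> \<beta>" and h: "h \<in> borel_measurable borel" "integrable \<alpha> h" "integrable \<beta> h"
  shows "integrable \<mu> h" and "(\<integral>x. h x \<partial>\<mu>) = (\<integral>x. h x \<partial>\<alpha>) + (\<integral>x. h x \<partial>\<beta>)"
proof -
  have sets: "sets \<mu> = sets borel" using s by (simp add: splits_def)
  have m: "h \<in> borel_measurable \<mu>" using h(1) sets measurable_cong_sets by blast
  have nn: "(\<integral>\<^sup>+x. ennreal (h x) \<partial>\<mu>) = (\<integral>\<^sup>+x. ennreal (h x) \<partial>\<alpha>) + (\<integral>\<^sup>+x. ennreal (h x) \<partial>\<beta>)"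
    "(\<integral>\<^sup>+x. ennreal (- h x) \<partial>\<mu>) = (\<integral>\<^sup>+x. ennreal (- h x) \<partial>\<alpha>) + (\<integral>\<^sup>+x. ennreal (- h x) \<partial>\<beta>)"
    using h(1) by (auto intro!: nn_integral_splits[OF s])
  show int: "integrable \<mu> h" using h m by (auto simp: real_integrable_def nn)
  show "(\<integral>x. h x \<partial>\<mu>) = (\<integral>x. h x \<partial>\<alpha>) + (\<integral>x. h x \<partial>\<beta>)"
    using h(2,3) unfolding real_lebesgue_integral_def[OF int] real_lebesgue_integral_def[OF h(2)]
      real_lebesgue_integral_def[OF h(3)] nn
    by (simp add: enn2real_plus real_integrable_def less_top)
qed

lemma integral_scale_measure:
  fixes h :: "'a \<Rightarrow> real"
  assumes "integrable \<mu> h" "0 \<le> r"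
  shows "integrable (scale_measure (ennreal r) \<mu>) h"
    and "(\<integral>x. h x \<partial>scale_measure (ennreal r) \<mu>) = r * (\<integral>x. h x \<partial>\<mu>)"
proof -
  have m: "h \<in> borel_measurable \<mu>" using assms by auto
  have nn: "(\<integral>\<^sup>+x. ennreal (h x) \<partial>scale_measure (ennreal r) \<mu>) = ennreal r * (\<integral>\<^sup>+x. ennreal (h x) \<partial>\<mu>)"
    "(\<integral>\<^sup>+x. ennreal (- h x) \<partial>scale_measure (ennreal r) \<mu>) = ennreal r * (\<integral>\<^sup>+x. ennreal (- h x) \<partial>\<mu>)"
    using m by (auto intro!: nn_integral_scale_measure)
  show int: "integrable (scale_measure (ennreal r) \<mu>) h"
    using assms by (auto simp: real_integrable_def nn ennreal_mult_eq_top_iff)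
  show "(\<integral>x. h x \<partial>scale_measure (ennreal r) \<mu>) = r * (\<integral>x. h x \<partial>\<mu>)"
    unfolding real_lebesgue_integral_def[OF int] real_lebesgue_integral_def[OF assms(1)] nn
    using assms(2) by (simp add: enn2real_mult algebra_simps)
qed

lemma quadratic_nonneg_imp_linear_nonneg:
  fixes b c :: real
  assumes "\<And>t. 0 < t \<Longrightarrow> t \<le> 1 \<Longrightarrow> 0 \<le> 2 * t * b + t^2 * c"
  shows "0 \<le> b"
proof (rule ccontr)
  assume "\<not> ?thesis"
  then have b: "b < 0" by simp
  \<comment> \<open>Chosen so that t c \<le> -b, whence 2 b + t c \<le> b < 0; the summand 1 covers
    c = 0.\<close>
  define t where "t = min 1 (- b / (\<bar>c\<bar> + 1))"
  have t: "0 < t" "t \<le> 1" "t \<le> - b / (\<bar>c\<bar> + 1)"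
    using b by (auto simp: t_def divide_neg_pos)
  have tb: "t * (\<bar>c\<bar> + 1) \<le> - b"
    using t(3) by (subst (asm) pos_le_divide_eq) auto
  have "t * c \<le> t * (\<bar>c\<bar> + 1)" using t(1) by (intro mult_left_mono) auto
  then have "2 * b + t * c < 0" using tb b by linarith
  then have "t * (2 * b + t * c) < 0" using t(1) by (simp add: mult_pos_neg)
  then show False using assms[OF t(1,2)] by (simp add: power2_eq_square algebra_simps)
qed

section \<open>Bilinearity of \<open>D\<close> on measures of finite energy\<close>

context gauss_kernel
begin

lemma finite_energyD:
  assumes "finite_energy \<mu>"
  shows "finite_radon \<mu>" "radon \<mu>" "sets \<mu> = sets borel" "space \<mu> = UNIV"
  using assms finite_radonD[of \<mu>] by (auto simp: finite_energy_def)

lemma D_sym: "finite_energy \<mu> \<Longrightarrow> finite_energy \<nu> \<Longrightarrow> D \<mu> \<nu> = D \<nu> \<mu>"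
  using D_commute finite_energyD(1) by blast

lemma finite_energy_splits:
  assumes "splits \<mu> \<alpha> \<beta>" "finite_energy \<alpha>" "finite_energy \<beta>"
  shows "finite_energy \<mu>"
proof -
  obtain \<mu>' where \<mu>': "splits \<mu>' \<alpha> \<beta>" "finite_radon \<mu>'"
    using finite_radon_splits finite_energyD(1) assms(2,3) by metis
  have "\<mu> = \<mu>'" using assms(1) \<mu>'(1) by (intro measure_eqI) (auto simp: splits_def)
  then have fr: "finite_radon \<mu>" using \<mu>' by simp
  have "energy \<mu> \<mu> = energy \<alpha> \<alpha> + energy \<alpha> \<beta> + (energy \<beta> \<alpha> + energy \<beta> \<beta>)"
    using energy_splits_left[OF assms(1) finite_radonD(1)[OF fr]]
      energy_splits_right[OF assms(1) finite_energyD(2)[OF assms(2)] finite_energyD(2)[OF assms(3)]]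
      finite_energyD(3) assms(2,3) by simp
  also have "\<dots> < \<infinity>" using energy_finite assms(2,3) by simp
  finally show ?thesis using fr by (simp add: finite_energy_def)
qed

lemma D_splits:
  assumes "splits \<mu> \<alpha> \<beta>" "finite_energy \<alpha>" "finite_energy \<beta>" "finite_energy \<nu>"
  shows "D \<mu> \<nu> = D \<alpha> \<nu> + D \<beta> \<nu>"
  using D_splits_left[OF assms(1)] finite_energyD(1)[OF finite_energy_splits[OF assms(1-3)]]
    finite_energyD(1) energy_finite assms by simp

lemma D_splits_self:
  assumes "splits \<mu> \<alpha> \<beta>" "finite_energy \<alpha>" "finite_energy \<beta>"
  shows "D \<mu> \<mu> = D \<alpha> \<alpha> + 2 * D \<alpha> \<beta> + D \<beta> \<beta>"
proof -
  note fe = finite_energy_splits[OF assms]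
  have "D \<mu> \<mu> = D \<alpha> \<mu> + D \<beta> \<mu>" by (rule D_splits[OF assms fe])
  then show ?thesis
    using D_splits[OF assms assms(2)] D_splits[OF assms assms(3)] D_sym[OF fe assms(2)] D_sym[OF fe assms(3)]
      D_sym[OF assms(2,3)] by simp
qed

lemma finite_energy_scale:
  assumes "finite_energy \<mu>" "0 \<le> r"
  shows "finite_energy (scale_measure (ennreal r) \<mu>)"
proof -
  note fr = finite_energyD[OF assms(1)]
  have s: "finite_radon (scale_measure (ennreal r) \<mu>)" by (rule finite_radon_scale[OF fr(1) assms(2)])
  have "energy (scale_measure (ennreal r) \<mu>) (scale_measure (ennreal r) \<mu>)
      = ennreal r * energy (scale_measure (ennreal r) \<mu>) \<mu>"
    using finite_radonD[OF s] fr energy_commute[OF s fr(1)] by (simp add: energy_scale_left)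
  also have "\<dots> = ennreal r * (ennreal r * energy \<mu> \<mu>)" using fr by (simp add: energy_scale_left)
  also have "\<dots> < \<infinity>" using assms(1) by (simp add: finite_energy_def ennreal_mult_less_top)
  finally show ?thesis using s by (simp add: finite_energy_def)
qed

lemma D_scale: "finite_energy \<mu> \<Longrightarrow> finite_energy \<nu> \<Longrightarrow> 0 \<le> r \<Longrightarrow> D (scale_measure (ennreal r) \<mu>) \<nu> = r * D \<mu> \<nu>"
  by (intro D_scale_left finite_energyD)

text \<open>\<open>enn2real\<close> alters the potential only where it is infinite, which is a
  \<nu>-null set because the mutual energy is finite.\<close>

lemma D_integral:
  assumes "finite_energy \<nu>" "finite_energy \<mu>"
  shows "integrable \<nu> (\<lambda>x. enn2real (pot \<mu> x) - M * measure \<mu> UNIV)"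
    and "(\<integral>x. enn2real (pot \<mu> x) - M * measure \<mu> UNIV \<partial>\<nu>) = D \<nu> \<mu>"
proof -
  note \<nu> = finite_energyD[OF assms(1)] and \<mu> = finite_energyD[OF assms(2)]
  interpret finite_measure \<nu> using finite_radonD(2)[OF \<nu>(1)] .
  have m: "pot \<mu> \<in> borel_measurable \<nu>" using pot_measurable[OF \<mu>(2)] \<nu>(3) measurable_cong_sets by blast
  have eq: "(\<integral>\<^sup>+x. ennreal (enn2real (pot \<mu> x)) \<partial>\<nu>) = energy \<nu> \<mu>"
    unfolding energy_def using pot_finite_AE[OF assms] by (intro nn_integral_cong_AE) (auto simp: less_top)
  have fin: "energy \<nu> \<mu> < \<infinity>" by (rule energy_finite[OF assms])
  have int: "integrable \<nu> (\<lambda>x. enn2real (pot \<mu> x))"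
    using m fin eq by (intro integrableI_nonneg) auto
  then show "integrable \<nu> (\<lambda>x. enn2real (pot \<mu> x) - M * measure \<mu> UNIV)" by simp
  have "(\<integral>x. enn2real (pot \<mu> x) \<partial>\<nu>) = enn2real (energy \<nu> \<mu>)"
    using m by (subst integral_eq_nn_integral) (auto simp: eq)
  then show "(\<integral>x. enn2real (pot \<mu> x) - M * measure \<mu> UNIV \<partial>\<nu>) = D \<nu> \<mu>"
    using int \<nu>(4) by (simp add: D_def algebra_simps)
qed

end

section \<open>Reduction to a real functional of finite measures\<close>

context gauss_problem
begin

lemma AE_f:
  assumes "i \<in> I" "finite_energy \<nu>"
  shows "AE x in \<nu>. x \<notin> Y i" "AE x in \<nu>. f i x = f' i x"
proof -
  have "Y i \<in> null_sets \<nu>"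
    using Y[OF assms(1)] Y_null[OF assms] finite_energyD(3)[OF assms(2)] by (auto intro: null_setsI)
  then show "AE x in \<nu>. x \<notin> Y i" by (rule AE_not_in)
  then show "AE x in \<nu>. f i x = f' i x" by eventually_elim (rule f_eq[OF assms(1)])
qed

lemma f'_measurable: "i \<in> I \<Longrightarrow> sets \<nu> = sets borel \<Longrightarrow> f' i \<in> borel_measurable \<nu>"
  using f'[of i] measurable_cong_sets[of \<nu> borel] by auto

lemma eint_field:
  assumes "i \<in> I" "finite_energy \<nu>"
  shows "eint_finite \<nu> (f i) \<longleftrightarrow> (AE x in \<nu>. \<bar>f' i x\<bar> \<noteq> \<infinity>) \<and> integrable \<nu> (\<lambda>x. real_of_ereal (f' i x))"
    and "eint_finite \<nu> (f i) \<Longrightarrow> eint \<nu> (f i) = ereal (field i \<nu>)"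
proof -
  note m = f'_measurable[OF assms(1) finite_energyD(3)[OF assms(2)]]
  note c = eint_cong_AE[OF AE_f(2)[OF assms]]
  show "eint_finite \<nu> (f i) \<longleftrightarrow> (AE x in \<nu>. \<bar>f' i x\<bar> \<noteq> \<infinity>) \<and> integrable \<nu> (\<lambda>x. real_of_ereal (f' i x))"
    unfolding c(2) using eint_finite_real(1,2)[OF m] eint_finite_realI[of \<nu> "f' i"] by blast
  show "eint \<nu> (f i) = ereal (field i \<nu>)" if "eint_finite \<nu> (f i)"
    using eint_finite_real(3)[OF m] that unfolding c field_def by blast
qed

lemma componentD:
  assumes "component i \<nu>"
  shows "finite_energy \<nu>" "finite_radon \<nu>" "sets \<nu> = sets borel" "emeasure \<nu> (- A i) = 0"
    "(\<integral>\<^sup>+x. ennreal (g i x) \<partial>\<nu>) = ennreal (a i)"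
    "AE x in \<nu>. \<bar>f' i x\<bar> \<noteq> \<infinity>" "integrable \<nu> (\<lambda>x. real_of_ereal (f' i x))"
    "i \<in> I0 \<Longrightarrow> E \<in> sets borel \<Longrightarrow> emeasure \<nu> E \<le> emeasure (\<xi> i) E"
  using assms finite_energyD[of \<nu>] by (auto simp: component_def)

lemma components_mass:
  assumes "\<And>i. i \<in> I \<Longrightarrow> component i (\<mu> i)"
  shows "(\<integral>\<^sup>+i. emeasure (\<mu> i) UNIV \<partial>count_space I) < \<infinity>"
  using assms componentD(3-5) by (intro total_mass) blast

lemma eint_sum_iff:
  assumes "\<And>i. i \<in> I \<Longrightarrow> h i = ereal (F i)"
  shows "eint_finite (count_space I) h \<longleftrightarrow> integrable (count_space I) F"
    and "integrable (count_space I) F \<Longrightarrow> eint (count_space I) h = ereal (\<integral>i. F i \<partial>count_space I)"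
proof -
  have c: "integrable (count_space I) (\<lambda>i. real_of_ereal (h i)) \<longleftrightarrow> integrable (count_space I) F"
    "(\<integral>i. real_of_ereal (h i) \<partial>count_space I) = (\<integral>i. F i \<partial>count_space I)"
    using assms by (auto intro!: Bochner_Integration.integrable_cong Bochner_Integration.integral_cong)
  show *: "eint_finite (count_space I) h \<longleftrightarrow> integrable (count_space I) F"
    using eint_finite_real(2)[of h "count_space I"] eint_finite_realI[of "count_space I" h] assms
    unfolding c(1) by (auto simp: AE_count_space)
  show "eint (count_space I) h = ereal (\<integral>i. F i \<partial>count_space I)" if "integrable (count_space I) F"
    using eint_finite_real(3)[of h "count_space I"] that unfolding c(2) * by simp
qed

text \<open>The order of the forward direction matters: the g-normalization bounds the masses,
  finite masses permit the energy computation, and finite energy of the components allows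
  \<open>f\<close> to be replaced by \<open>f'\<close>.\<close>

lemma admissible_iff:
  "\<mu> \<in> admissible \<kappa> f Ipos Ineg I0 \<xi> A a g \<longleftrightarrow> admissible' \<mu>"
proof
  assume "\<mu> \<in> admissible \<kappa> f Ipos Ineg I0 \<xi> A a g"
  then have r: "\<And>i. i \<in> I \<Longrightarrow> radon (\<mu> i)" "\<And>i. i \<in> I \<Longrightarrow> carried_by (\<mu> i) (A i)"
    and ef: "eint_finite (count_space (I \<times> I)) (energy_terms \<kappa> Ipos \<mu>)"
    and ga: "\<And>i. i \<in> I \<Longrightarrow> eint (\<mu> i) (\<lambda>x. ereal (g i x)) = ereal (a i)"
    and le: "\<And>i. i \<in> I0 \<Longrightarrow> \<mu> i \<le> \<xi> i"
    and ff: "\<And>i. i \<in> I \<Longrightarrow> eint_finite (\<mu> i) (f i)"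
      "eint_finite (count_space I) (\<lambda>i. eint (\<mu> i) (f i))"
    unfolding admissible_def vector_finite_energy_def I[symmetric] by auto
  have s: "sets (\<mu> i) = sets borel" if "i \<in> I" for i using radon_sets[OF r(1)[OF that]] .
  have nul: "emeasure (\<mu> i) (- A i) = 0" if "i \<in> I" for i
    using r that carried_by_iff A_borel by blast
  have ga': "(\<integral>\<^sup>+x. ennreal (g i x) \<partial>\<mu> i) = ennreal (a i)" if "i \<in> I" for i
    using arg_cong[OF ga[OF that], of e2ennreal] unfolding eint_g[OF that] by simp
  have mass: "(\<integral>\<^sup>+i. emeasure (\<mu> i) UNIV \<partial>count_space I) < \<infinity>"
    by (rule total_mass) (use s nul ga' in auto)
  have fr: "finite_radon (\<mu> i)" if "i \<in> I" for i
  proof (rule finite_radonI[OF r(1)[OF that]])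
    show "emeasure (\<mu> i) UNIV < \<infinity>"
      using nn_integral_ge_point[OF that, of "\<lambda>i. emeasure (\<mu> i) UNIV"] mass by (rule le_less_trans)
  qed
  have fe: "finite_energy (measure_sum I \<mu>)" by (rule vector_energy_finite[OF fr mass ef])
  have fei: "finite_energy (\<mu> i)" if "i \<in> I" for i
    by (rule finite_energy_components(1)[OF fr mass fe that])
  have comp: "component i (\<mu> i)" if i: "i \<in> I" for i
    unfolding component_def
  proof (intro conjI impI ballI)
    show "emeasure (\<mu> i) E \<le> emeasure (\<xi> i) E" if "i \<in> I0" "E \<in> sets borel" for E
      using le_measureD3[OF le[OF that(1)]] s[OF i] \<xi>[OF that(1)] radon_sets by metis
  qed (use i fei nul ga' ff(1) eint_field(1)[OF i fei[OF i]] in auto)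
  have "integrable (count_space I) (\<lambda>i. field i (\<mu> i))"
    using eint_sum_iff(1)[of "\<lambda>i. eint (\<mu> i) (f i)" "\<lambda>i. field i (\<mu> i)"] ff eint_field(2)[OF _ fei] by blast
  then show "admissible' \<mu>" using comp fe by (simp add: admissible'_def)
next
  assume "admissible' \<mu>"
  then have comp: "\<And>i. i \<in> I \<Longrightarrow> component i (\<mu> i)" and fe: "finite_energy (measure_sum I \<mu>)"
    and int: "integrable (count_space I) (\<lambda>i. field i (\<mu> i))" by (auto simp: admissible'_def)
  note mass = components_mass[OF comp]
  have fr: "finite_radon (\<mu> i)" if "i \<in> I" for i using comp[OF that] componentD(2) by blast
  have fei: "finite_energy (\<mu> i)" if "i \<in> I" for i using comp[OF that] componentD(1) by blast
  have ff: "eint_finite (\<mu> i) (f i)" if "i \<in> I" for i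
    using eint_field(1)[OF that fei[OF that]] componentD(6,7)[OF comp[OF that]] by blast
  have fs: "eint_finite (count_space I) (\<lambda>i. eint (\<mu> i) (f i))"
    using eint_sum_iff(1)[of "\<lambda>i. eint (\<mu> i) (f i)" "\<lambda>i. field i (\<mu> i)"] int ff eint_field(2)[OF _ fei] by blast
  have "radon (\<mu> i) \<and> carried_by (\<mu> i) (A i)" if "i \<in> I" for i
    using finite_radonD(1)[OF fr[OF that]] carried_by_iff A_borel[OF that] componentD(4)[OF comp[OF that]] by blast
  moreover have "eint (\<mu> i) (\<lambda>x. ereal (g i x)) = ereal (a i)" if "i \<in> I" for i
    using componentD(5)[OF comp[OF that]] a_pos[OF that] by (simp add: eint_g[OF that] less_imp_le)
  moreover have "\<mu> i \<le> \<xi> i" if "i \<in> I0" for i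
  proof -
    have i: "i \<in> I" using that I0 by auto
    have "sets (\<mu> i) = sets borel" "sets (\<xi> i) = sets borel"
      using componentD(3)[OF comp[OF i]] \<xi>[OF that] radon_sets by auto
    then show ?thesis using componentD(8)[OF comp[OF i] that] by (subst le_measure) auto
  qed
  ultimately show "\<mu> \<in> admissible \<kappa> f Ipos Ineg I0 \<xi> A a g"
    unfolding admissible_def vector_finite_energy_def I[symmetric]
    using vector_energy_value(1)[OF fr mass fe] ff fs by auto
qed

definition functional :: "('i \<Rightarrow> 'a measure) \<Rightarrow> real" where
  "functional \<mu> = total_energy \<mu> + 2 * (\<integral>i. field i (\<mu> i) \<partial>count_space I)"

context
  fixes \<mu> assumes adm: "admissible' \<mu>"
begin

lemma admD: "i \<in> I \<Longrightarrow> component i (\<mu> i)" "finite_energy (measure_sum I \<mu>)"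
    "integrable (count_space I) (\<lambda>i. field i (\<mu> i))"
  and adm_fr: "i \<in> I \<Longrightarrow> finite_radon (\<mu> i)"
  and adm_fe: "i \<in> I \<Longrightarrow> finite_energy (\<mu> i)"
  and adm_mass: "(\<integral>\<^sup>+i. emeasure (\<mu> i) UNIV \<partial>count_space I) < \<infinity>"
proof -
  show *: "i \<in> I \<Longrightarrow> component i (\<mu> i)" "finite_energy (measure_sum I \<mu>)"
    "integrable (count_space I) (\<lambda>i. field i (\<mu> i))" for i using adm by (auto simp: admissible'_def)
  show "i \<in> I \<Longrightarrow> finite_radon (\<mu> i)" "i \<in> I \<Longrightarrow> finite_energy (\<mu> i)" using componentD(1,2) *(1) by blast+
  show "(\<integral>\<^sup>+i. emeasure (\<mu> i) UNIV \<partial>count_space I) < \<infinity>" by (rule components_mass[OF *(1)])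
qed

lemma adm_parts: "finite_energy (pos_part \<mu>)" "finite_energy (neg_part \<mu>)"
  using finite_energy_components(2,3)[OF adm_fr adm_mass admD(2)] by auto

lemma gauss_functional_value: "gauss_functional \<kappa> f Ipos Ineg \<mu> = ereal (functional \<mu>)"
proof -
  have "eint (count_space I) (\<lambda>i. eint (\<mu> i) (f i)) = ereal (\<integral>i. field i (\<mu> i) \<partial>count_space I)"
  proof (rule eint_sum_iff(2)[OF _ admD(3)])
    fix i assume i: "i \<in> I"
    show "eint (\<mu> i) (f i) = ereal (field i (\<mu> i))"
      using eint_field[OF i adm_fe[OF i]] componentD(6,7)[OF admD(1)[OF i]] by blast
  qed
  then show ?thesis
    using vector_energy_value(2)[OF adm_fr adm_mass admD(2)]
    by (simp add: gauss_functional_def functional_def I[symmetric])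
qed

text \<open>Energies and mass corrections are summed separately, since each is a series of
  nonnegative terms with finite sum.\<close>

lemma D_measure_sum:
  assumes "J \<subseteq> I" "finite_energy \<nu>"
  shows "integrable (count_space J) (\<lambda>i. D (\<mu> i) \<nu>)"
    and "(\<integral>i. D (\<mu> i) \<nu> \<partial>count_space J) = D (measure_sum J \<mu>) \<nu>"
proof -
  have sJ: "sets (\<mu> i) = sets borel" if "i \<in> J" for i using assms(1) that componentD(3)[OF admD(1)] by blast
  have frJ: "finite_radon (measure_sum J \<mu>)"
    by (rule finite_radon_parts[OF adm_fr adm_mass assms(1)])
  have feJ: "finite_energy (measure_sum J \<mu>)"
  proof (rule finite_energy_le[OF admD(2)])
    fix E :: "'a set" assume E: "E \<in> sets borel"
    have "(\<integral>\<^sup>+i. emeasure (\<mu> i) E \<partial>count_space (J \<union> (I - J))) = (\<integral>\<^sup>+i. emeasure (\<mu> i) E \<partial>count_space J)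
      + (\<integral>\<^sup>+i. emeasure (\<mu> i) E \<partial>count_space (I - J))"
      by (rule nn_integral_count_space_Un) auto
    moreover have "J \<union> (I - J) = I" using assms(1) by auto
    ultimately show "emeasure (measure_sum J \<mu>) E \<le> emeasure (measure_sum I \<mu>) E"
      using sJ E componentD(3)[OF admD(1)] by (simp add: emeasure_measure_sum)
  qed simp
  have e: "(\<integral>\<^sup>+i. energy (\<mu> i) \<nu> \<partial>count_space J) = energy (measure_sum J \<mu>) \<nu>"
    unfolding energy_def
    by (rule nn_integral_measure_sum[symmetric, OF sJ pot_measurable[OF finite_energyD(2)[OF assms(2)]]])
  have efin: "energy (\<mu> i) \<nu> < \<infinity>" if "i \<in> J" for i
    using assms that adm_fe energy_finite by blast
  have e': "(\<integral>\<^sup>+i. ennreal (enn2real (energy (\<mu> i) \<nu>)) \<partial>count_space J) = energy (measure_sum J \<mu>) \<nu>"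
    unfolding e[symmetric] using efin by (intro nn_integral_cong) (simp add: less_top)
  have int1: "integrable (count_space J) (\<lambda>i. enn2real (energy (\<mu> i) \<nu>))"
    using energy_finite[OF feJ assms(2)] by (intro integrableI_nonneg) (auto simp: e')
  have val1: "(\<integral>i. enn2real (energy (\<mu> i) \<nu>) \<partial>count_space J) = enn2real (energy (measure_sum J \<mu>) \<nu>)"
    by (subst integral_eq_nn_integral) (auto simp: e')
  have m: "(\<integral>\<^sup>+i. ennreal (M * measure (\<mu> i) UNIV) \<partial>count_space J) = ennreal (M * measure (measure_sum J \<mu>) UNIV)"
    by (rule mass_sum[OF adm_fr adm_mass assms(1)])
  have int2: "integrable (count_space J) (\<lambda>i. M * measure (\<mu> i) UNIV)"
    using M_nonneg by (intro integrableI_nonneg) (auto simp: m)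
  have val2: "(\<integral>i. M * measure (\<mu> i) UNIV \<partial>count_space J) = M * measure (measure_sum J \<mu>) UNIV"
    using M_nonneg by (subst integral_eq_nn_integral) (auto simp: m)
  show "integrable (count_space J) (\<lambda>i. D (\<mu> i) \<nu>)"
    unfolding D_def by (intro Bochner_Integration.integrable_diff int1 integrable_mult_left int2)
  show "(\<integral>i. D (\<mu> i) \<nu> \<partial>count_space J) = D (measure_sum J \<mu>) \<nu>"
    unfolding D_def using int1 int2 val1 val2 by (simp add: integral_mult_left_zero)
qed

end

lemma solution_iff:
  "lam \<in> gauss_solutions \<kappa> f Ipos Ineg I0 \<xi> A a g \<longleftrightarrow>
    admissible' lam \<and> (\<forall>\<mu>. admissible' \<mu> \<longrightarrow> functional lam \<le> functional \<mu>)"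
proof -
  let ?S = "{\<mu>. admissible' \<mu>}"
  have S: "admissible \<kappa> f Ipos Ineg I0 \<xi> A a g = ?S" using admissible_iff by blast
  have v: "gauss_value \<kappa> f Ipos Ineg I0 \<xi> A a g = (INF \<mu>\<in>?S. ereal (functional \<mu>))"
    unfolding gauss_value_def S by (intro INF_cong refl gauss_functional_value) simp
  have "(ereal (functional lam) = (INF \<mu>\<in>?S. ereal (functional \<mu>))) \<longleftrightarrow> (\<forall>\<mu>. admissible' \<mu> \<longrightarrow> functional lam \<le> functional \<mu>)"
    if "admissible' lam"
  proof
    assume e: "ereal (functional lam) = (INF \<mu>\<in>?S. ereal (functional \<mu>))"
    show "\<forall>\<mu>. admissible' \<mu> \<longrightarrow> functional lam \<le> functional \<mu>"
      using INF_lower[of _ ?S "\<lambda>\<mu>. ereal (functional \<mu>)"] unfolding e[symmetric] by simp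
  next
    assume "\<forall>\<mu>. admissible' \<mu> \<longrightarrow> functional lam \<le> functional \<mu>"
    then show "ereal (functional lam) = (INF \<mu>\<in>?S. ereal (functional \<mu>))"
      using that by (intro antisym INF_greatest INF_lower2[of lam]) auto
  qed
  then show ?thesis
    unfolding gauss_solutions_def S v using gauss_functional_value by auto
qed

text \<open>\<open>derivative lam i \<nu>\<close> is the integral with respect to \<open>\<nu>\<close> of the \<open>i\<close>-th component of the weighted
  vector potential of \<open>lam\<close>, and \<open>test i \<nu>\<close> says that this integral exists.\<close>

definition test :: "'i \<Rightarrow> 'a measure \<Rightarrow> bool" where
  "test i \<nu> \<longleftrightarrow> finite_energy \<nu> \<and> (AE x in \<nu>. \<bar>f' i x\<bar> \<noteq> \<infinity>) \<and> integrable \<nu> (\<lambda>x. real_of_ereal (f' i x))"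

definition derivative :: "('i \<Rightarrow> 'a measure) \<Rightarrow> 'i \<Rightarrow> 'a measure \<Rightarrow> real" where
  "derivative lam i \<nu> = sgn_of i * (D \<nu> (pos_part lam) - D \<nu> (neg_part lam)) + field i \<nu>"

section \<open>Linearity of the derivative and expansion of the functional\<close>

lemma component_test: "component i \<nu> \<Longrightarrow> test i \<nu>"
  by (auto simp: component_def test_def)

lemma real_f'_measurable: "i \<in> I \<Longrightarrow> (\<lambda>x. real_of_ereal (f' i x)) \<in> borel_measurable borel"
  using f' by measurable

lemma AE_finite_iff:
  assumes "i \<in> I" "sets \<nu> = sets borel"
  shows "(AE x in \<nu>. \<bar>f' i x\<bar> \<noteq> \<infinity>) \<longleftrightarrow> emeasure \<nu> {x. \<bar>f' i x\<bar> = \<infinity>} = 0"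
proof -
  have [measurable]: "f' i \<in> borel_measurable borel" by (rule f'[OF assms(1)])
  have "{x. \<bar>f' i x\<bar> = \<infinity>} \<in> sets borel" by measurable
  then show ?thesis using assms(2) sets_eq_imp_space_eq[OF assms(2)] by (subst AE_iff_measurable[OF _ refl]) auto
qed

lemma test_splits:
  assumes i: "i \<in> I" and s: "splits \<nu> \<alpha> \<beta>" and t: "test i \<alpha>" "test i \<beta>"
  shows "test i \<nu>" and "admissible' lam \<Longrightarrow> derivative lam i \<nu> = derivative lam i \<alpha> + derivative lam i \<beta>"
proof -
  have fe: "finite_energy \<alpha>" "finite_energy \<beta>" using t by (auto simp: test_def)
  note sets = finite_energyD(3)[OF fe(1)] finite_energyD(3)[OF fe(2)]
  have s\<nu>: "sets \<nu> = sets borel" using s by (simp add: splits_def)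
  note int = integral_splits[OF s real_f'_measurable[OF i]]
  have [measurable]: "f' i \<in> borel_measurable borel" by (rule f'[OF i])
  have "{x. \<bar>f' i x\<bar> = \<infinity>} \<in> sets borel" by measurable
  then have "AE x in \<nu>. \<bar>f' i x\<bar> \<noteq> \<infinity>"
    using t s unfolding test_def AE_finite_iff[OF i s\<nu>] AE_finite_iff[OF i sets(1)] AE_finite_iff[OF i sets(2)]
    by (simp add: splits_def)
  then show "test i \<nu>" using t int(1) finite_energy_splits[OF s fe] by (simp add: test_def)
  assume "admissible' lam"
  note p = adm_parts[OF this]
  show "derivative lam i \<nu> = derivative lam i \<alpha> + derivative lam i \<beta>"
    unfolding derivative_def field_def using int(2) t
    by (simp add: test_def D_splits[OF s fe p(1)] D_splits[OF s fe p(2)] algebra_simps)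
qed

lemma test_scale:
  assumes i: "i \<in> I" and t: "test i \<nu>" and r: "0 \<le> r"
  shows "test i (scale_measure (ennreal r) \<nu>)"
    and "admissible' lam \<Longrightarrow> derivative lam i (scale_measure (ennreal r) \<nu>) = r * derivative lam i \<nu>"
proof -
  have fe: "finite_energy \<nu>" using t by (auto simp: test_def)
  note sets = finite_energyD(3)[OF fe]
  note int = integral_scale_measure[OF _ r, of \<nu> "\<lambda>x. real_of_ereal (f' i x)"]
  have "sets (scale_measure (ennreal r) \<nu>) = sets borel" using sets by simp
  then have "AE x in scale_measure (ennreal r) \<nu>. \<bar>f' i x\<bar> \<noteq> \<infinity>"
    using t AE_finite_iff[OF i] sets by (simp add: test_def)
  then show "test i (scale_measure (ennreal r) \<nu>)"
    using t int(1) finite_energy_scale[OF fe r] by (simp add: test_def)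
  assume "admissible' lam"
  note p = adm_parts[OF this]
  show "derivative lam i (scale_measure (ennreal r) \<nu>) = r * derivative lam i \<nu>"
    unfolding derivative_def field_def using int(2) t r
    by (simp add: test_def D_scale[OF fe p(1)] D_scale[OF fe p(2)] algebra_simps)
qed

text \<open>The expansion is exact: its last bracket is the energy of \<nu> - \<open>lam i\<close>.
  Only the part with the sign of \<open>i\<close> changes.\<close>

lemma replace_component:
  assumes lam: "admissible' lam" and i: "i \<in> I" and \<nu>: "component i \<nu>"
  shows "admissible' (lam(i := \<nu>))"
    and "functional (lam(i := \<nu>)) = functional lam + 2 * (derivative lam i \<nu> - derivative lam i (lam i))
      + (D \<nu> \<nu> - 2 * D (lam i) \<nu> + D (lam i) (lam i))"
proof -
  let ?\<mu> = "lam(i := \<nu>)"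
  have comp: "component j (?\<mu> j)" if "j \<in> I" for j using admD(1)[OF lam that] \<nu> by simp
  have sets: "sets (lam j) = sets borel" "sets (?\<mu> j) = sets borel" if "j \<in> I" for j
    using componentD(3) comp[OF that] admD(1)[OF lam that] by blast+
  have rest: "measure_sum (J - {i}) ?\<mu> = measure_sum (J - {i}) lam" for J
    by (rule measure_sum_cong) auto
  have sp: "splits (measure_sum J lam) (lam i) (measure_sum (J - {i}) lam)"
    "splits (measure_sum J ?\<mu>) \<nu> (measure_sum (J - {i}) lam)" if "i \<in> J" "J \<subseteq> I" for J
    using splits_measure_sum[of J lam i] splits_measure_sum[of J ?\<mu> i] sets that
    by (auto simp: rest subset_eq)
  have feR: "finite_energy (measure_sum (J - {i}) lam)" if "i \<in> J" "J \<subseteq> I" "finite_energy (measure_sum J lam)" for J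
    using sp(1)[OF that(1,2)] by (intro finite_energy_le[OF that(3)]) (auto simp: splits_def)
  have fe: "finite_energy \<nu>" "finite_energy (lam i)" using componentD(1) \<nu> adm_fe[OF lam i] by auto
  have int: "integrable (count_space I) (\<lambda>j. field j (?\<mu> j))"
    "(\<integral>j. field j (?\<mu> j) \<partial>count_space I) = (\<integral>j. field j (lam j) \<partial>count_space I) + field i \<nu> - field i (lam i)"
    using integral_count_space_update[OF i admD(3)[OF lam], of "\<lambda>j. field j (?\<mu> j)"] by simp_all
  have "finite_energy (measure_sum I ?\<mu>)"
    by (rule finite_energy_splits[OF sp(2)[OF i order_refl] fe(1) feR[OF i order_refl admD(2)[OF lam]]])
  then show "admissible' ?\<mu>" using comp int(1) by (simp add: admissible'_def)
  note parts = adm_parts[OF lam]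
  \<comment> \<open>\<open>S\<close> is the part containing component \<open>i\<close>,
    \<open>R\<close> the rest of that part, \<open>T\<close> the opposite part; in this generality
    it serves both signs of \<open>i\<close>.\<close>
  have key: "D S' S' + D T T - 2 * D S' T - (D S S + D T T - 2 * D S T)
      = 2 * (D \<nu> S - D \<nu> T - (D (lam i) S - D (lam i) T)) + (D \<nu> \<nu> - 2 * D (lam i) \<nu> + D (lam i) (lam i))"
    if s: "splits S (lam i) R" "splits S' \<nu> R" and fR: "finite_energy R" "finite_energy S" "finite_energy T" for S S' R T
    using D_splits_self[OF s(1) fe(2) fR(1)] D_splits_self[OF s(2) fe(1) fR(1)]
      D_splits[OF s(1) fe(2) fR(1,3)] D_splits[OF s(2) fe(1) fR(1,3)]
      D_splits[OF s(1) fe(2) fR(1) fe(1)] D_splits[OF s(1) fe(2) fR(1) fe(2)]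
      D_sym[OF fR(2) fe(1)] D_sym[OF fR(2) fe(2)] D_sym[OF fR(1) fe(1)] D_sym[OF fR(1) fe(2)]
    by (simp add: algebra_simps)
  have "total_energy ?\<mu> - total_energy lam
      = 2 * (sgn_of i * (D \<nu> (pos_part lam) - D \<nu> (neg_part lam))
          - sgn_of i * (D (lam i) (pos_part lam) - D (lam i) (neg_part lam)))
        + (D \<nu> \<nu> - 2 * D (lam i) \<nu> + D (lam i) (lam i))"
  proof (cases "i \<in> Ipos")
    case True
    then have ni: "i \<notin> Ineg" using disjoint by auto
    have N: "neg_part ?\<mu> = neg_part lam" using ni by (intro measure_sum_cong) auto
    have sub: "Ipos \<subseteq> I" by (simp add: I)
    show ?thesis
      using key[OF sp[OF True sub] feR[OF True sub parts(1)] parts(1,2)] True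
      by (simp add: total_energy_def N sgn_of_def algebra_simps)
  next
    case False
    then have ni: "i \<in> Ineg" using i by (simp add: I)
    have P: "pos_part ?\<mu> = pos_part lam" using False by (intro measure_sum_cong) auto
    have sub: "Ineg \<subseteq> I" by (simp add: I)
    have fN: "finite_energy (neg_part ?\<mu>)"
      by (rule finite_energy_splits[OF sp(2)[OF ni sub] fe(1) feR[OF ni sub parts(2)]])
    show ?thesis
      using key[OF sp[OF ni sub] feR[OF ni sub parts(2)] parts(2,1)] False
        D_sym[OF parts(1) fN] D_sym[OF parts]
      by (simp add: total_energy_def P sgn_of_def algebra_simps)
  qed
  then show "functional ?\<mu> = functional lam + 2 * (derivative lam i \<nu> - derivative lam i (lam i))
      + (D \<nu> \<nu> - 2 * D (lam i) \<nu> + D (lam i) (lam i))"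
    unfolding functional_def derivative_def int(2) by (simp add: algebra_simps)
qed

text \<open>The segment from \<open>lam i\<close> to \<nu> stays admissible by convexity, and the
  functional is quadratic along it. Minimality at t = 0 makes the linear coefficient
  nonnegative.\<close>

lemma first_variation:
  assumes lam: "admissible' lam" and opt: "\<And>\<mu>. admissible' \<mu> \<Longrightarrow> functional lam \<le> functional \<mu>"
    and i: "i \<in> I" and \<nu>: "component i \<nu>"
  shows "derivative lam i (lam i) \<le> derivative lam i \<nu>"
proof -
  let ?l = "lam i"
  have l: "component i ?l" by (rule admD(1)[OF lam i])
  note fe = componentD(1)[OF l] componentD(1)[OF \<nu>]
  have "0 \<le> 2 * t * (derivative lam i \<nu> - derivative lam i ?l) + t^2 * (D \<nu> \<nu> - 2 * D ?l \<nu> + D ?l ?l)"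
    if t: "0 < t" "t \<le> 1" for t
  proof -
    let ?s = "scale_measure (ennreal (1 - t)) ?l" and ?r = "scale_measure (ennreal t) \<nu>"
    have t': "0 \<le> 1 - t" "0 \<le> t" using t by auto
    note test = test_scale[OF i component_test[OF l] t'(1)] test_scale[OF i component_test[OF \<nu>] t'(2)]
    have fes: "finite_energy ?s" "finite_energy ?r" using fe t' by (auto intro: finite_energy_scale)
    obtain m where m: "splits m ?s ?r" using finite_radon_splits[OF finite_energyD(1)[OF fes(1)] finite_energyD(1)[OF fes(2)]] .
    have one: "ennreal (1 - t) * c + ennreal t * c = c" for c
      using t' by (simp flip: distrib_right ennreal_plus)
    have em: "emeasure m E = ennreal (1 - t) * emeasure ?l E + ennreal t * emeasure \<nu> E" if "E \<in> sets borel" for E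
      using m that by (simp add: splits_def)
    have sm: "sets m = sets borel" using m by (simp add: splits_def)
    note tm = test_splits[OF i m test(1,3)]
    have gb: "(\<lambda>x. ennreal (g i x)) \<in> borel_measurable borel" by (rule g_measurable[OF i refl])
    have "component i m"
      unfolding component_def
    proof (intro conjI impI ballI)
      show "emeasure m (- A i) = 0" using A_borel[OF i] componentD(4)[OF l] componentD(4)[OF \<nu>] by (simp add: em)
      have "(\<integral>\<^sup>+x. ennreal (g i x) \<partial>m) = ennreal (1 - t) * (\<integral>\<^sup>+x. ennreal (g i x) \<partial>?l) + ennreal t * (\<integral>\<^sup>+x. ennreal (g i x) \<partial>\<nu>)"
        using nn_integral_splits[OF m gb] g_measurable[OF i componentD(3)[OF l]] g_measurable[OF i componentD(3)[OF \<nu>]]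
        by (simp add: nn_integral_scale_measure)
      then show "(\<integral>\<^sup>+x. ennreal (g i x) \<partial>m) = ennreal (a i)"
        using componentD(5)[OF l] componentD(5)[OF \<nu>] one by simp
      show "emeasure m E \<le> emeasure (\<xi> i) E" if "i \<in> I0" "E \<in> sets borel" for E
      proof -
        have "emeasure m E \<le> ennreal (1 - t) * emeasure (\<xi> i) E + ennreal t * emeasure (\<xi> i) E"
          unfolding em[OF that(2)] using componentD(8)[OF l that] componentD(8)[OF \<nu> that]
          by (intro add_mono mult_left_mono) auto
        then show ?thesis using one by simp
      qed
    qed (use tm(1) in \<open>auto simp: test_def\<close>)
    note rc = replace_component[OF lam i this]
    have "D m m = (1 - t)^2 * D ?l ?l + 2 * (1 - t) * t * D ?l \<nu> + t^2 * D \<nu> \<nu>"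
      using D_splits_self[OF m fes] D_scale[OF fe(1) fes(1) t'(1)] D_scale[OF fe(2) fes(2) t'(2)] D_scale[OF fe(1) fes(2) t'(1)]
        D_sym[OF fe(1) fes(1)] D_sym[OF fe(2) fes(2)] D_sym[OF fe(1) fes(2)]
        D_scale[OF fe(1) fe(1) t'(1)] D_scale[OF fe(2) fe(2) t'(2)] D_scale[OF fe(2) fe(1) t'(2)] D_sym[OF fe]
      by (simp add: power2_eq_square algebra_simps)
    moreover have "D ?l m = (1 - t) * D ?l ?l + t * D ?l \<nu>"
      using D_splits[OF m fes fe(1)] D_sym[OF finite_energy_splits[OF m fes] fe(1)]
        D_scale[OF fe(1) fe(1) t'(1)] D_scale[OF fe(2) fe(1) t'(2)] D_sym[OF fe] by simp
    moreover have "derivative lam i m = (1 - t) * derivative lam i ?l + t * derivative lam i \<nu>"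
      using tm(2)[OF lam] test(2)[OF lam] test(4)[OF lam] by simp
    moreover have "functional lam \<le> functional (lam(i := m))" by (rule opt[OF rc(1)])
    ultimately show ?thesis unfolding rc(2) by (simp add: power2_eq_square algebra_simps)
  qed
  from quadratic_nonneg_imp_linear_nonneg[OF this] show ?thesis by simp
qed

text \<open>Convexity: the functional exceeds its linearization at \<open>lam\<close> by the energy
  of a difference, which is nonnegative.\<close>

lemma functional_convex:
  assumes lam: "admissible' lam" and \<mu>: "admissible' \<mu>"
    and le: "\<And>i. i \<in> I \<Longrightarrow> derivative lam i (lam i) \<le> derivative lam i (\<mu> i)"
  shows "functional lam \<le> functional \<mu>"
proof -
  let ?P = "pos_part lam" and ?N = "neg_part lam"
  note p = adm_parts[OF lam] and p' = adm_parts[OF \<mu>]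
  have sub: "Ipos \<subseteq> I" "Ineg \<subseteq> I" by (auto simp: I)
  have sum: "integrable (count_space I) (\<lambda>i. derivative lam i (\<nu> i)) \<and>
      (\<integral>i. derivative lam i (\<nu> i) \<partial>count_space I) = D (pos_part \<nu>) ?P - D (pos_part \<nu>) ?N
        - (D (neg_part \<nu>) ?P - D (neg_part \<nu>) ?N) + (\<integral>i. field i (\<nu> i) \<partial>count_space I)"
    if \<nu>: "admissible' \<nu>" for \<nu>
  proof -
    let ?F = "\<lambda>i. sgn_of i * (D (\<nu> i) ?P - D (\<nu> i) ?N)"
    note d = D_measure_sum[OF \<nu> sub(1) p(1)] D_measure_sum[OF \<nu> sub(1) p(2)]
      D_measure_sum[OF \<nu> sub(2) p(1)] D_measure_sum[OF \<nu> sub(2) p(2)]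
    have s: "i \<in> Ineg \<Longrightarrow> sgn_of i = - 1" "i \<in> Ipos \<Longrightarrow> sgn_of i = 1" for i
      using disjoint by (auto simp: sgn_of_def)
    have c: "integrable (count_space Ipos) ?F \<longleftrightarrow> integrable (count_space Ipos) (\<lambda>i. D (\<nu> i) ?P - D (\<nu> i) ?N)"
      "(\<integral>i. ?F i \<partial>count_space Ipos) = (\<integral>i. D (\<nu> i) ?P - D (\<nu> i) ?N \<partial>count_space Ipos)"
      "integrable (count_space Ineg) ?F \<longleftrightarrow> integrable (count_space Ineg) (\<lambda>i. - (D (\<nu> i) ?P - D (\<nu> i) ?N))"
      "(\<integral>i. ?F i \<partial>count_space Ineg) = (\<integral>i. - (D (\<nu> i) ?P - D (\<nu> i) ?N) \<partial>count_space Ineg)"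
      using s by (auto intro!: Bochner_Integration.integrable_cong Bochner_Integration.integral_cong)
    have 1: "integrable (count_space Ipos) ?F" "(\<integral>i. ?F i \<partial>count_space Ipos) = D (pos_part \<nu>) ?P - D (pos_part \<nu>) ?N"
      unfolding c using d by simp_all
    have 2: "integrable (count_space Ineg) ?F" "(\<integral>i. ?F i \<partial>count_space Ineg) = - (D (neg_part \<nu>) ?P - D (neg_part \<nu>) ?N)"
      unfolding c using d by simp_all
    note un = integral_count_space_Un[OF disjoint 1(1) 2(1), folded I]
    show ?thesis
      unfolding derivative_def using un admD(3)[OF \<nu>] 1(2) 2(2) by simp
  qed
  have mono: "(\<integral>i. derivative lam i (lam i) \<partial>count_space I) \<le> (\<integral>i. derivative lam i (\<mu> i) \<partial>count_space I)"
    using sum[OF lam] sum[OF \<mu>] le by (intro integral_mono) auto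
  \<comment> \<open>Crosswise sums: \<alpha> - \<beta> is the signed measure of \<mu> minus that of
    \<open>lam\<close>, so \<open>D_pos\<close> yields the nonnegative energy of this difference
    with positive measures alone.\<close>
  obtain \<alpha> where \<alpha>: "splits \<alpha> (pos_part \<mu>) ?N"
    using finite_radon_splits[OF finite_energyD(1)[OF p'(1)] finite_energyD(1)[OF p(2)]] .
  obtain \<beta> where \<beta>: "splits \<beta> (neg_part \<mu>) ?P"
    using finite_radon_splits[OF finite_energyD(1)[OF p'(2)] finite_energyD(1)[OF p(1)]] .
  note fe = finite_energy_splits[OF \<alpha> p'(1) p(2)] finite_energy_splits[OF \<beta> p'(2) p(1)]
  have "2 * D \<alpha> \<beta> \<le> D \<alpha> \<alpha> + D \<beta> \<beta>" by (rule D_pos[OF fe])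
  moreover have "D \<alpha> \<beta> = D (pos_part \<mu>) (neg_part \<mu>) + D (pos_part \<mu>) ?P + D (neg_part \<mu>) ?N + D ?P ?N"
    using D_splits[OF \<alpha> p'(1) p(2) fe(2)] D_splits[OF \<beta> p'(2) p(1) p'(1)] D_splits[OF \<beta> p'(2) p(1) p(2)]
      D_sym[OF fe(2) p'(1)] D_sym[OF fe(2) p(2)] D_sym[OF p'] D_sym[OF p(1) p'(1)] by simp
  moreover note D_splits_self[OF \<alpha> p'(1) p(2)] D_splits_self[OF \<beta> p'(2) p(1)]
  ultimately show ?thesis
    using mono sum[OF lam] sum[OF \<mu>] D_sym[OF p] unfolding functional_def total_energy_def
    by simp
qed

end

section \<open>The variational inequalities\<close>

lemma splits_restrict:
  assumes "sets \<mu> = sets borel" "B \<in> sets borel"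
  shows "splits \<mu> (restrict_measure \<mu> B) (restrict_measure \<mu> (- B))"
  unfolding splits_def
proof (intro conjI ballI)
  fix E :: "'a set" assume E: "E \<in> sets borel"
  have "emeasure \<mu> (E \<inter> B) + emeasure \<mu> (E \<inter> - B) = emeasure \<mu> ((E \<inter> B) \<union> (E \<inter> - B))"
    using assms E by (intro plus_emeasure) auto
  also have "(E \<inter> B) \<union> (E \<inter> - B) = E" by auto
  finally show "emeasure \<mu> E = emeasure (restrict_measure \<mu> B) E + emeasure (restrict_measure \<mu> (- B)) E"
    using assms E by (simp add: emeasure_restrict_measure)
qed (use assms in auto)

lemma AE_restrict_measure:
  assumes "sets \<mu> = sets borel" "B \<in> sets borel"
  shows "(AE x in restrict_measure \<mu> B. P x) \<longleftrightarrow> (AE x in \<mu>. x \<in> B \<longrightarrow> P x)"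
proof -
  have "0 < (indicator B x :: ennreal) \<longleftrightarrow> x \<in> B" for x by (simp split: split_indicator)
  then show ?thesis
    unfolding restrict_measure_def using assms by (subst AE_density) simp_all
qed

lemma AE_False_null:
  assumes "AE x in \<nu>. False"
  shows "emeasure \<nu> (space \<nu>) = 0"
  using assms AE_iff_measurable[of "space \<nu>" \<nu> "\<lambda>_. False"] by simp

text \<open>A Dedekind cut at the supremum of \<open>S\<close>; points above it fall into
  \<open>T\<close> by \<open>alt\<close>. It supplies the multiplier of a constrained
  component.\<close>

lemma threshold:
  fixes S T :: "real set"
  assumes down: "\<And>c d. d \<in> S \<Longrightarrow> c < d \<Longrightarrow> c \<in> S" and "S \<noteq> UNIV" "T \<noteq> UNIV"
    and alt: "\<And>c d. c < d \<Longrightarrow> c \<in> S \<or> d \<in> T"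
  shows "\<exists>w. (\<forall>c<w. c \<in> S) \<and> (\<forall>d>w. d \<in> T)"
proof -
  obtain c0 d0 where cd: "c0 \<notin> S" "d0 \<notin> T" using assms(2,3) by auto
  \<comment> \<open>\<open>S\<close> is nonempty because \<open>T\<close> is not everything, and
    bounded above because \<open>S\<close> is not everything; only then is \<open>Sup S\<close>
    meaningful.\<close>
  have "d0 - 1 \<in> S" using alt[of "d0 - 1" d0] cd by auto
  have bdd: "bdd_above S"
  proof (rule bdd_aboveI)
    show "s \<le> c0" if "s \<in> S" for s using down[OF that, of c0] cd by (meson not_le)
  qed
  show ?thesis
  proof (intro exI conjI allI impI)
    show "c \<in> S" if "c < Sup S" for c
      using that \<open>d0 - 1 \<in> S\<close> bdd down by (subst (asm) less_cSup_iff) auto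
    show "d \<in> T" if "Sup S < d" for d
    proof -
      \<comment> \<open>The midpoint lies outside \<open>S\<close> and still strictly below
        \<open>d\<close>, as \<open>alt\<close> requires.\<close>
      have "(Sup S + d) / 2 \<notin> S" using cSup_upper[OF _ bdd, of "(Sup S + d) / 2"] that by auto
      then show ?thesis using alt[of "(Sup S + d) / 2" d] that by auto
    qed
  qed
qed

context gauss_problem
begin

lemma constraint_restrict_energy:
  assumes i: "i \<in> I0" and K: "compact K" "K \<subseteq> finite_part f A i"
  shows "finite_energy (restrict_measure (\<xi> i) K)"
proof -
  have \<xi>i: "radon (\<xi> i)" using \<xi>[OF i] by auto
  have Kb: "K \<in> sets borel" using K(1) by (auto intro: borel_closed compact_imp_closed)
  have fr: "finite_radon (restrict_measure (\<xi> i) K)"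
    using radon_restrict[OF \<xi>i Kb] radon_compact[OF \<xi>i K(1)]
    by (intro finite_radonI) (simp_all add: emeasure_restrict_measure[OF radon_sets[OF \<xi>i] Kb])
  then show ?thesis
    using \<xi>_energy[OF i K] pos_finite_energy_iff[OF fr] by (simp add: pos_finite_energy_def finite_energy_def)
qed

text \<open>\<xi> i may have infinite energy, but its restrictions to compact sets on which the
  field is finite do not. So every compact part, off \<open>N\<close>, of a set ignored by finite
  energies is null, and inner regularity concludes without a countable exhaustion of the
  space.\<close>

lemma constraint_null_sets:
  assumes i: "i \<in> I0"
  obtains N where "N \<in> sets borel" "emeasure (\<xi> i) N = 0" "A i - N \<subseteq> finite_part f A i"
    "- A i \<subseteq> N"
    "\<And>E. E \<in> sets borel \<Longrightarrow> (\<And>\<nu>. finite_energy \<nu> \<Longrightarrow> emeasure \<nu> E = 0) \<Longrightarrow> emeasure (\<xi> i) E = 0"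
proof -
  have iI: "i \<in> I" using i I0 by auto
  have \<xi>i: "radon (\<xi> i)" and c: "carried_by (\<xi> i) (A i)" using \<xi>[OF i] by auto
  note s = radon_sets[OF \<xi>i] and sp = radon_space[OF \<xi>i]
  obtain N0 where N0': "{x \<in> space (\<xi> i). \<not> x \<notin> A i - finite_part f A i} \<subseteq> N0"
      "emeasure (\<xi> i) N0 = 0" "N0 \<in> sets (\<xi> i)"
    by (rule AE_E[OF \<xi>_finite_part[OF i]])
  then have N0: "N0 \<in> sets borel" "emeasure (\<xi> i) N0 = 0" "A i - finite_part f A i \<subseteq> N0"
    unfolding s sp by blast+
  define N where "N = N0 \<union> - A i"
  have Ab: "A i \<in> sets borel" by (rule A_borel[OF iI])
  have N: "N \<in> sets borel" using N0(1) Ab by (simp add: N_def)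
  have "- A i \<in> null_sets (\<xi> i)" "N0 \<in> null_sets (\<xi> i)"
    using c carried_by_iff[OF \<xi>i Ab] N0 s Ab by (intro null_setsI; simp)+
  then have "N \<in> null_sets (\<xi> i)" unfolding N_def by (intro null_sets.Un)
  then have N_null: "emeasure (\<xi> i) N = 0" by (rule null_setsD1)
  have NA: "A i - N \<subseteq> finite_part f A i" using N0(3) by (auto simp: N_def)
  have null: "emeasure (\<xi> i) E = 0" if E: "E \<in> sets borel" "\<And>\<nu>. finite_energy \<nu> \<Longrightarrow> emeasure \<nu> E = 0" for E
  proof (rule ccontr)
    assume "emeasure (\<xi> i) E \<noteq> 0"
    moreover have "emeasure (\<xi> i) E = emeasure (\<xi> i) (E - N)"
      using E(1) s \<open>N \<in> null_sets (\<xi> i)\<close> by (intro emeasure_Diff_null_set[symmetric]) simp_all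
    ultimately have "0 < emeasure (\<xi> i) (E - N)" by (simp add: zero_less_iff_neq_zero)
    then obtain K where K: "compact K" "K \<subseteq> E - N" "0 < emeasure (\<xi> i) K"
      using radon_inner_less[OF \<xi>i, of "E - N" 0] E(1) N by auto
    have Kb: "K \<in> sets borel" using K(1) by (auto intro: borel_closed compact_imp_closed)
    have "K \<subseteq> finite_part f A i" using K(2) NA by (auto simp: N_def)
    then have "emeasure (restrict_measure (\<xi> i) K) E = 0"
      by (intro E(2) constraint_restrict_energy[OF i K(1)])
    moreover have "E \<inter> K = K" using K(2) by auto
    ultimately show False using K(3) emeasure_restrict_measure[OF s Kb E(1)] by simp
  qed
  show ?thesis by (rule that[OF N N_null NA _ null]) (simp add: N_def)
qed

section \<open>The weighted potential of a fixed admissible vector measure\<close>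

context
  fixes lam :: "'i \<Rightarrow> 'a measure"
  assumes lam: "admissible' lam"
begin

definition pot_diff :: "'a \<Rightarrow> real" where
  "pot_diff x = (enn2real (pot (pos_part lam) x) - M * measure (pos_part lam) UNIV)
    - (enn2real (pot (neg_part lam) x) - M * measure (neg_part lam) UNIV)"

definition wreal :: "'i \<Rightarrow> 'a \<Rightarrow> real" where
  "wreal i x = sgn_of i * pot_diff x + real_of_ereal (f' i x)"

text \<open>Every measure of finite energy is concentrated on this Borel set. The field may still be
  infinite there, and \<open>wreal\<close> represents the weighted potential only where it is
  not.\<close>

definition good :: "'i \<Rightarrow> 'a set" where
  "good i = {x. pot (pos_part lam) x \<noteq> \<infinity> \<and> pot (neg_part lam) x \<noteq> \<infinity> \<and> x \<notin> Y i}"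

abbreviation W :: "'i \<Rightarrow> 'a \<Rightarrow> ereal" where "W \<equiv> weighted_potential \<kappa> f Ipos Ineg lam"
abbreviation W_defined :: "'i \<Rightarrow> 'a \<Rightarrow> bool" where
  "W_defined \<equiv> weighted_potential_defined \<kappa> f Ipos Ineg lam"

lemma pot_pn_measurable [measurable]:
  "pot (pos_part lam) \<in> borel_measurable borel" "pot (neg_part lam) \<in> borel_measurable borel"
  using pot_measurable[OF finite_energyD(2)[OF adm_parts(1)[OF lam]]]
    pot_measurable[OF finite_energyD(2)[OF adm_parts(2)[OF lam]]] .

lemma pot_diff_measurable [measurable]: "pot_diff \<in> borel_measurable borel"
  unfolding pot_diff_def[abs_def] by measurable

lemma wreal_measurable: "i \<in> I \<Longrightarrow> wreal i \<in> borel_measurable borel"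
  unfolding wreal_def[abs_def] using real_f'_measurable[of i] by measurable

lemma good_borel: "i \<in> I \<Longrightarrow> good i \<in> sets borel"
  unfolding good_def using Y[of i] by measurable

lemma AE_good:
  assumes "i \<in> I" "finite_energy \<nu>"
  shows "AE x in \<nu>. x \<in> good i"
  using pot_finite_AE[OF assms(2) adm_parts(1)[OF lam]] pot_finite_AE[OF assms(2) adm_parts(2)[OF lam]]
    AE_f(1)[OF assms] by eventually_elim (simp add: good_def)

lemma W_good:
  assumes "i \<in> I" "x \<in> good i"
  shows "W_defined i x" "W i x = ereal (sgn_of i * pot_diff x) + f' i x"
proof -
  have x: "pot (pos_part lam) x < \<infinity>" "pot (neg_part lam) x < \<infinity>" "x \<notin> Y i"
    using assms(2) by (auto simp: good_def less_top)
  note v = vector_potential_value[OF adm_fr[OF lam] adm_mass[OF lam] assms(1) x(1,2)]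
  show "W_defined i x"
    using v unfolding weighted_potential_defined_def I[symmetric] by simp
  show "W i x = ereal (sgn_of i * pot_diff x) + f' i x"
    using v(2) f_eq[OF assms(1) x(3)] by (simp add: weighted_potential_def pot_diff_def)
qed

lemma W_good_real:
  assumes "i \<in> I" "x \<in> good i" "\<bar>f' i x\<bar> \<noteq> \<infinity>"
  shows "W i x = ereal (wreal i x)"
  using W_good(2)[OF assms(1,2)] assms(3) by (cases "f' i x") (auto simp: wreal_def)

lemma derivative_integral:
  assumes "i \<in> I" "test i \<nu>"
  shows "integrable \<nu> (wreal i)" "derivative lam i \<nu> = (\<integral>x. wreal i x \<partial>\<nu>)"
proof -
  have fe: "finite_energy \<nu>" and int: "integrable \<nu> (\<lambda>x. real_of_ereal (f' i x))" using assms(2) by (auto simp: test_def)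
  note d = D_integral[OF fe adm_parts(1)[OF lam]] D_integral[OF fe adm_parts(2)[OF lam]]
  have u: "integrable \<nu> pot_diff" "(\<integral>x. pot_diff x \<partial>\<nu>) = D \<nu> (pos_part lam) - D \<nu> (neg_part lam)"
    unfolding pot_diff_def[abs_def] using Bochner_Integration.integrable_diff[OF d(1,3)]
      Bochner_Integration.integral_diff[OF d(1,3)] d(2,4) by auto
  show "integrable \<nu> (wreal i)"
    unfolding wreal_def[abs_def] using u(1) int by simp
  show "derivative lam i \<nu> = (\<integral>x. wreal i x \<partial>\<nu>)"
    unfolding wreal_def[abs_def] derivative_def field_def using u int by simp
qed

lemma integrable_g:
  assumes i: "i \<in> I" and s: "sets \<nu> = sets borel" and b: "(\<integral>\<^sup>+x. ennreal (g i x) \<partial>\<nu>) = ennreal b" "0 \<le> b"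
  shows "integrable \<nu> (g i)" "(\<integral>x. g i x \<partial>\<nu>) = b"
proof -
  have m: "g i \<in> borel_measurable \<nu>"
    using g[OF i] borel_measurable_continuous_onI measurable_cong_sets[OF s refl] by blast
  have 0: "0 \<le> g i x" for x using g[OF i] by (auto intro: less_imp_le)
  show "integrable \<nu> (g i)" using m 0 b by (intro integrableI_nonneg) auto
  show "(\<integral>x. g i x \<partial>\<nu>) = b" using m 0 b by (subst integral_eq_nn_integral) auto
qed

lemma derivative_le:
  assumes i: "i \<in> I" and t: "test i \<nu>" and b: "(\<integral>\<^sup>+x. ennreal (g i x) \<partial>\<nu>) = ennreal b" "0 \<le> b"
    and ae: "AE x in \<nu>. wreal i x \<le> r * g i x"
  shows "derivative lam i \<nu> \<le> r * b"
proof -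
  have s: "sets \<nu> = sets borel" using t finite_energyD(3) by (auto simp: test_def)
  note gi = integrable_g[OF i s b]
  have "(\<integral>x. wreal i x \<partial>\<nu>) \<le> (\<integral>x. r * g i x \<partial>\<nu>)"
    using derivative_integral(1)[OF i t] gi(1) ae by (intro integral_mono_AE) auto
  then show ?thesis using derivative_integral(2)[OF i t] gi(2) by simp
qed

lemma derivative_ge:
  assumes i: "i \<in> I" and t: "test i \<nu>" and b: "(\<integral>\<^sup>+x. ennreal (g i x) \<partial>\<nu>) = ennreal b" "0 \<le> b"
    and ae: "AE x in \<nu>. r * g i x \<le> wreal i x"
  shows "r * b \<le> derivative lam i \<nu>"
proof -
  have s: "sets \<nu> = sets borel" using t finite_energyD(3) by (auto simp: test_def)
  note gi = integrable_g[OF i s b]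
  have "(\<integral>x. r * g i x \<partial>\<nu>) \<le> (\<integral>x. wreal i x \<partial>\<nu>)"
    using derivative_integral(1)[OF i t] gi(1) ae by (intro integral_mono_AE) auto
  then show ?thesis using derivative_integral(2)[OF i t] gi(2) by simp
qed

text \<open>Positivity of g_i at every point turns nonzero mass into a nonzero g_i-integral, so that
  pieces of a measure can be normalized.\<close>

lemma g_integral_pos:
  assumes i: "i \<in> I" and s: "sets \<nu> = sets borel" and ne: "emeasure \<nu> UNIV \<noteq> 0"
    and fin: "(\<integral>\<^sup>+x. ennreal (g i x) \<partial>\<nu>) < \<infinity>"
  obtains b where "0 < b" "(\<integral>\<^sup>+x. ennreal (g i x) \<partial>\<nu>) = ennreal b"
proof -
  obtain b where b: "0 \<le> b" "(\<integral>\<^sup>+x. ennreal (g i x) \<partial>\<nu>) = ennreal b"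
    using fin by (cases "\<integral>\<^sup>+x. ennreal (g i x) \<partial>\<nu>") auto
  have "b \<noteq> 0"
  proof
    assume "b = 0"
    then have "AE x in \<nu>. ennreal (g i x) = 0"
      using b g_measurable[OF i s] by (simp add: nn_integral_0_iff_AE)
    then have "AE x in \<nu>. False"
    proof eventually_elim
      case (elim x)
      moreover have "0 < g i x" using g[OF i] by simp
      ultimately show ?case by (simp add: ennreal_eq_0_iff)
    qed
    from AE_False_null[OF this] show False using ne sets_eq_imp_space_eq[OF s] by simp
  qed
  then show ?thesis using that b by simp
qed

lemma g_integral_bounded:
  assumes i: "i \<in> I" and \<nu>: "finite_radon \<nu>" and bd: "AE x in \<nu>. g i x \<le> n"
  shows "(\<integral>\<^sup>+x. ennreal (g i x) \<partial>\<nu>) < \<infinity>"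
proof -
  have "(\<integral>\<^sup>+x. ennreal (g i x) \<partial>\<nu>) \<le> (\<integral>\<^sup>+x. ennreal n \<partial>\<nu>)"
    using bd by (intro nn_integral_mono_AE) (auto intro: ennreal_leI elim!: eventually_mono)
  also have "\<dots> < \<infinity>" using finite_radonD(4)[OF \<nu>] finite_radonD(5)[OF \<nu>, of UNIV] by (simp add: ennreal_mult_less_top)
  finally show ?thesis .
qed

lemma test_bounded:
  assumes i: "i \<in> I" and fe: "finite_energy \<nu>" and bd: "AE x in \<nu>. \<bar>f' i x\<bar> \<noteq> \<infinity> \<and> \<bar>real_of_ereal (f' i x)\<bar> \<le> n"
  shows "test i \<nu>"
proof -
  interpret finite_measure \<nu> using finite_radonD(2)[OF finite_energyD(1)[OF fe]] .
  have "(\<lambda>x. real_of_ereal (f' i x)) \<in> borel_measurable \<nu>"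
    using real_f'_measurable[OF i] measurable_cong_sets[OF finite_energyD(3)[OF fe] refl] by blast
  then have "integrable \<nu> (\<lambda>x. real_of_ereal (f' i x))"
    using bd by (intro integrable_const_bound[of _ n]) (auto elim!: eventually_mono)
  then show ?thesis using fe bd by (auto simp: test_def elim!: eventually_mono)
qed

lemma test_restrict:
  assumes i: "i \<in> I" and t: "test i \<nu>" and H: "H \<in> sets borel"
  shows "test i (restrict_measure \<nu> H)"
proof -
  have fe: "finite_energy \<nu>" and int: "integrable \<nu> (\<lambda>x. real_of_ereal (f' i x))"
    and ae: "AE x in \<nu>. \<bar>f' i x\<bar> \<noteq> \<infinity>" using t by (auto simp: test_def)
  note s = finite_energyD(3)[OF fe]
  have m: "(\<lambda>x. real_of_ereal (f' i x)) \<in> borel_measurable \<nu>"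
    using real_f'_measurable[OF i] measurable_cong_sets[OF s refl] by blast
  have le: "(\<integral>\<^sup>+x. ennreal (h x) \<partial>restrict_measure \<nu> H) \<le> (\<integral>\<^sup>+x. ennreal (h x) \<partial>\<nu>)"
    if "h \<in> borel_measurable borel" for h :: "'a \<Rightarrow> real"
    using that by (subst nn_integral_restrict_measure[OF s H])
      (auto intro!: nn_integral_mono split: split_indicator)
  note mb = real_f'_measurable[OF i]
  have "integrable (restrict_measure \<nu> H) (\<lambda>x. real_of_ereal (f' i x))"
    unfolding real_integrable_def
  proof (intro conjI)
    show "(\<lambda>x. real_of_ereal (f' i x)) \<in> borel_measurable (restrict_measure \<nu> H)"
      using mb s measurable_cong_sets[of "restrict_measure \<nu> H" borel] by auto
    show "(\<integral>\<^sup>+x. ennreal (real_of_ereal (f' i x)) \<partial>restrict_measure \<nu> H) \<noteq> \<infinity>"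
      "(\<integral>\<^sup>+x. ennreal (- real_of_ereal (f' i x)) \<partial>restrict_measure \<nu> H) \<noteq> \<infinity>"
      using le[OF mb] le[OF borel_measurable_uminus[OF mb]] int
      by (auto simp: real_integrable_def top_unique)
  qed
  moreover have "AE x in restrict_measure \<nu> H. \<bar>f' i x\<bar> \<noteq> \<infinity>"
    unfolding AE_restrict_measure[OF s H] using ae by eventually_elim simp
  ultimately show ?thesis using finite_energy_restrict[OF fe H] by (simp add: test_def)
qed

text \<open>A bathtub principle. The set where W < w g is null for \<xi> - \<lambda>, so on it
  \<lambda> = \<xi> dominates every competitor, while W \<le> w g holds \<lambda>-a.e. Hence
  \<lambda> collects all the negative values of W - w g that the constraint permits, and no positive
  ones.\<close>

lemma sufficient_constrained:
  assumes i: "i \<in> I0" and \<mu>: "component i \<mu>"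
    and lower: "AE x in radon_diff (\<xi> i) (lam i). W_defined i x \<and> W i x \<ge> ereal (w * g i x)"
    and upper: "AE x in lam i. W_defined i x \<and> W i x \<le> ereal (w * g i x)"
  shows "derivative lam i (lam i) \<le> derivative lam i \<mu>"
proof -
  let ?l = "lam i" and ?\<tau> = "radon_diff (\<xi> i) (lam i)"
  have iI: "i \<in> I" using i I0 by auto
  have l: "component i ?l" by (rule admD(1)[OF lam iI])
  note fe = componentD(1)[OF l] componentD(1)[OF \<mu>]
  note s = componentD(3)[OF l] componentD(3)[OF \<mu>]
  have \<xi>i: "radon (\<xi> i)" using \<xi>[OF i] by simp
  note rd = radon_difference[OF \<xi>i componentD(2)[OF l] componentD(8)[OF l i]]
  define h where "h x = wreal i x - w * g i x" for x
  have [measurable]: "wreal i \<in> borel_measurable borel" "f' i \<in> borel_measurable borel" "good i \<in> sets borel"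
    using wreal_measurable f' good_borel iI by auto
  have [measurable]: "g i \<in> borel_measurable borel" using g[OF iI] borel_measurable_continuous_onI by blast
  have hm[measurable]: "h \<in> borel_measurable borel" unfolding h_def[abs_def] by measurable
  have hm': "h \<in> borel_measurable \<theta>" if "sets \<theta> = sets borel" for \<theta>
    using hm measurable_cong_sets[OF that refl] by blast
  define E where "E = {x \<in> good i. \<bar>f' i x\<bar> \<noteq> \<infinity> \<and> h x < 0}"
  have E: "E \<in> sets borel" unfolding E_def by measurable
  have st: "sets ?\<tau> = sets borel" using radon_sets[OF rd(1)] .
  have "AE x in ?\<tau>. x \<notin> E"
    using lower by eventually_elim (auto simp: E_def h_def W_good_real[OF iI])
  then have "emeasure ?\<tau> E = 0"
    using E st sets_eq_imp_space_eq[OF st] by (subst (asm) AE_iff_measurable[of E]) auto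
  then have \<tau>0: "emeasure ?\<tau> F = 0" if "F \<subseteq> E" for F
    using emeasure_mono[OF that, of ?\<tau>] E st by simp
  \<comment> \<open>The constraint is saturated on \<open>E\<close>: there \<open>lam i\<close>
    coincides with \<xi> i.\<close>
  have leE: "emeasure \<mu> F \<le> emeasure ?l F" if "F \<in> sets borel" "F \<subseteq> E" for F
    using componentD(8)[OF \<mu> i that(1)] rd(2) that \<tau>0[OF that(2)] by (simp add: splits_def)
  have neg: "(\<integral>\<^sup>+x. ennreal (- h x) \<partial>\<theta>) = (\<integral>\<^sup>+x. ennreal (- h x) \<partial>restrict_measure \<theta> E)" if "component i \<theta>" for \<theta>
  proof -
    have "(\<integral>\<^sup>+x. ennreal (- h x) \<partial>\<theta>) = (\<integral>\<^sup>+x. ennreal (- h x) * indicator E x \<partial>\<theta>)"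
    proof (rule nn_integral_cong_AE)
      show "AE x in \<theta>. ennreal (- h x) = ennreal (- h x) * indicator E x"
        using AE_good[OF iI componentD(1)[OF that]] componentD(6)[OF that]
        by eventually_elim (auto simp: E_def ennreal_neg split: split_indicator)
    qed
    also have "\<dots> = (\<integral>\<^sup>+x. ennreal (- h x) \<partial>restrict_measure \<theta> E)"
      using E componentD(3)[OF that] by (subst nn_integral_restrict_measure) auto
    finally show ?thesis .
  qed
  have negle: "(\<integral>\<^sup>+x. ennreal (- h x) \<partial>\<mu>) \<le> (\<integral>\<^sup>+x. ennreal (- h x) \<partial>?l)"
    unfolding neg[OF \<mu>] neg[OF l]
  proof (rule nn_integral_mono_measure)
    show "restrict_measure \<mu> E \<le> restrict_measure ?l E"
      using s E leE by (subst le_measure) (auto simp: emeasure_restrict_measure)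
  qed (use s in simp)
  have "AE x in ?l. h x \<le> 0"
    using upper AE_good[OF iI fe(1)] componentD(6)[OF l]
    by eventually_elim (auto simp: h_def W_good_real[OF iI])
  then have pos0: "(\<integral>\<^sup>+x. ennreal (h x) \<partial>?l) = 0"
    using hm'[OF s(1)] by (subst nn_integral_0_iff_AE) (auto elim!: eventually_mono simp: ennreal_eq_0_iff)
  have a0: "0 \<le> a i" using a_pos[OF iI] by simp
  \<comment> \<open>Subtracting w g_i changes all derivatives by the same w a_i.\<close>
  have int: "integrable \<theta> h" "(\<integral>x. h x \<partial>\<theta>) = derivative lam i \<theta> - w * a i" if "component i \<theta>" for \<theta>
  proof -
    note gi = integrable_g[OF iI componentD(3,5)[OF that] a0]
    note di = derivative_integral[OF iI component_test[OF that]]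
    show "integrable \<theta> h" unfolding h_def[abs_def] using gi(1) di(1) by simp
    show "(\<integral>x. h x \<partial>\<theta>) = derivative lam i \<theta> - w * a i" unfolding h_def[abs_def] using gi di by simp
  qed
  have "(\<integral>x. h x \<partial>?l) = - enn2real (\<integral>\<^sup>+x. ennreal (- h x) \<partial>?l)"
    using pos0 by (simp add: real_lebesgue_integral_def[OF int(1)[OF l]])
  also have "\<dots> \<le> - enn2real (\<integral>\<^sup>+x. ennreal (- h x) \<partial>\<mu>)"
    using negle int(1)[OF l] by (simp add: enn2real_mono real_integrable_def less_top)
  also have "\<dots> \<le> (\<integral>x. h x \<partial>\<mu>)" by (simp add: real_lebesgue_integral_def[OF int(1)[OF \<mu>]])
  finally show ?thesis using int(2)[OF l] int(2)[OF \<mu>] by simp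
qed

text \<open>Both derivatives are compared with w a_i. The competitor has finite energy, so it does
  not charge Borel subsets of the exceptional set of zero capacity.\<close>

lemma sufficient_free:
  assumes i: "i \<in> I" and \<mu>: "component i \<mu>"
    and lower: "nearly_everywhere \<kappa> (A i) (\<lambda>x. W_defined i x \<and> W i x \<ge> ereal (w * g i x))"
    and eq: "AE x in lam i. W_defined i x \<and> W i x = ereal (w * g i x)"
  shows "derivative lam i (lam i) \<le> derivative lam i \<mu>"
proof -
  have l: "component i (lam i)" by (rule admD(1)[OF lam i])
  note fe = componentD(1)[OF l] componentD(1)[OF \<mu>]
  have a0: "0 \<le> a i" using a_pos[OF i] by simp
  have [measurable]: "wreal i \<in> borel_measurable borel" "f' i \<in> borel_measurable borel" "good i \<in> sets borel" "A i \<in> sets borel"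
    using wreal_measurable f' good_borel A_borel i by auto
  have [measurable]: "g i \<in> borel_measurable borel" using g[OF i] borel_measurable_continuous_onI by blast
  have "AE x in lam i. wreal i x \<le> w * g i x"
    using eq AE_good[OF i fe(1)] componentD(6)[OF l]
    by eventually_elim (auto simp: W_good_real[OF i])
  then have 1: "derivative lam i (lam i) \<le> w * a i"
    by (rule derivative_le[OF i component_test[OF l] componentD(5)[OF l] a0])
  define E where "E = {x \<in> A i. x \<in> good i \<and> \<bar>f' i x\<bar> \<noteq> \<infinity> \<and> wreal i x < w * g i x}"
  have E: "E \<in> sets borel" unfolding E_def by measurable
  have "emeasure \<mu> E = 0"
    using lower unfolding nearly_everywhere_def
  proof (rule capacity_zeroD[OF _ fe(2) E])
    show "E \<subseteq> {x \<in> A i. \<not> (W_defined i x \<and> W i x \<ge> ereal (w * g i x))}"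
      by (auto simp: E_def W_good_real[OF i])
  qed
  moreover have "E \<in> sets \<mu>" "- A i \<in> sets \<mu>" using E componentD(3)[OF \<mu>] by auto
  ultimately have "AE x in \<mu>. x \<notin> E" "AE x in \<mu>. x \<notin> - A i"
    using componentD(4)[OF \<mu>] by (intro AE_not_in null_setsI; simp)+
  then have "AE x in \<mu>. w * g i x \<le> wreal i x"
    using AE_good[OF i fe(2)] componentD(6)[OF \<mu>] by eventually_elim (auto simp: E_def)
  then have "w * a i \<le> derivative lam i \<mu>"
    by (rule derivative_ge[OF i component_test[OF \<mu>] componentD(5)[OF \<mu>] a0])
  with 1 show ?thesis by simp
qed

section \<open>Inequalities satisfied by a minimizer\<close>

context
  assumes opt: "\<And>\<mu>. admissible' \<mu> \<Longrightarrow> functional lam \<le> functional \<mu>"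
begin

text \<open>If a nonzero measure of finite energy lived where W < w g_i, a normalized piece of it
  would be an admissible component with smaller derivative than \<open>lam i\<close>, against
  \<open>first_variation\<close>.\<close>

lemma free_lower:
  assumes i: "i \<in> I - I0" and \<nu>: "finite_energy \<nu>" "emeasure \<nu> (- A i) = 0"
    and low: "AE x in \<nu>. W i x < ereal (derivative lam i (lam i) / a i * g i x)"
  shows "emeasure \<nu> UNIV = 0"
proof (rule ccontr)
  assume ne: "emeasure \<nu> UNIV \<noteq> 0"
  have iI: "i \<in> I" and i0: "i \<notin> I0" using i by auto
  define w where "w = derivative lam i (lam i) / a i"
  note s = finite_energyD(3)[OF \<nu>(1)]
  have [measurable]: "wreal i \<in> borel_measurable borel" "f' i \<in> borel_measurable borel"
    using wreal_measurable f' iI by auto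
  have [measurable]: "g i \<in> borel_measurable borel" using g[OF iI] borel_measurable_continuous_onI by blast
  have BA: "closed (B i)" "capacity \<kappa> ((A i - B i) \<union> (B i - A i)) = 0"
    using nearly_closed iI by (auto simp: nearly_closed_via_def)
  \<comment> \<open>The lower bound is known on \<open>B i\<close>, and \<nu> does not charge
    \<open>A i - B i\<close>, a Borel set of capacity zero. This rules out the value -\<infinity> of
    the field, while W < w g_i rules out \<infinity>.\<close>
  obtain c :: real where c: "\<And>x. x \<in> B i \<Longrightarrow> ereal c \<le> f i x" using f_lower[OF iI] by blast
  have "A i - B i \<in> sets borel" using A_borel[OF iI] BA(1) by auto
  then have "emeasure \<nu> (A i - B i) = 0" by (intro capacity_zeroD[OF BA(2) \<nu>(1)]) auto
  then have n1: "A i - B i \<in> null_sets \<nu>" using \<open>A i - B i \<in> sets borel\<close> s by (intro null_setsI) simp_all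
  have n2: "- A i \<in> null_sets \<nu>" using A_borel[OF iI] s \<nu>(2) by (intro null_setsI) simp_all
  have "AE x in \<nu>. x \<notin> A i - B i" "AE x in \<nu>. x \<notin> - A i" using AE_not_in[OF n1] AE_not_in[OF n2] .
  then have fin: "AE x in \<nu>. x \<in> A i \<and> \<bar>f' i x\<bar> \<noteq> \<infinity> \<and> wreal i x < w * g i x"
    using low AE_good[OF iI \<nu>(1)] AE_f(2)[OF iI \<nu>(1)]
  proof eventually_elim
    case (elim x)
    then have x: "x \<in> A i" "x \<in> B i" by auto
    have "f' i x \<noteq> - \<infinity>" using c[OF x(2)] elim(5) by auto
    moreover have "f' i x \<noteq> \<infinity>" using elim(3) W_good(2)[OF iI elim(4)] by auto
    ultimately have "\<bar>f' i x\<bar> \<noteq> \<infinity>" by (cases "f' i x") auto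
    then show ?case using x elim(3) W_good_real[OF iI elim(4)] by (simp add: w_def)
  qed
  \<comment> \<open>On \<open>E n\<close> field and weight are bounded, so test integrals exist, and
    W falls short of w g_i by at least g_i / (n + 1). Countably many such sets cover \<nu>-almost
    everything.\<close>
  define E where "E n = {x. \<bar>f' i x\<bar> \<noteq> \<infinity> \<and> \<bar>real_of_ereal (f' i x)\<bar> \<le> real n \<and> g i x \<le> real n
      \<and> wreal i x \<le> (w - 1 / Suc n) * g i x}" for n
  have E: "E n \<in> sets borel" for n unfolding E_def by measurable
  have "\<exists>n. emeasure \<nu> (E n) \<noteq> 0"
  proof (rule ccontr)
    assume "\<not> ?thesis"
    then have "E n \<in> null_sets \<nu>" for n using E s by (auto intro!: null_setsI)
    then have "AE x in \<nu>. \<forall>n. x \<notin> E n" unfolding AE_all_countable by (intro allI AE_not_in)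
    with fin have "AE x in \<nu>. False"
    proof eventually_elim
      case (elim x)
      define r where "r = (w * g i x - wreal i x) / g i x"
      have gx: "0 < g i x" using g[OF iI] by auto
      have r: "0 < r" using elim(1) gx by (simp add: r_def)
      obtain n where n: "max (max \<bar>real_of_ereal (f' i x)\<bar> (g i x)) (1 / r) < real n" using reals_Archimedean2 by blast
      have "1 / r < real (Suc n)" using n by simp
      then have "1 / real (Suc n) < r" using r by (simp add: field_simps)
      then have "1 / real (Suc n) * g i x < w * g i x - wreal i x"
        using gx by (simp add: r_def pos_less_divide_eq)
      then have "wreal i x \<le> (w - 1 / real (Suc n)) * g i x" by (simp add: left_diff_distrib)
      then have "x \<in> E n" using elim(1) n by (simp add: E_def)
      then show ?case using elim(2) by blast
    qed
    from AE_False_null[OF this] show False using ne sets_eq_imp_space_eq[OF s] by simp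
  qed
  then obtain n where n: "emeasure \<nu> (E n) \<noteq> 0" by blast
  let ?\<theta> = "restrict_measure \<nu> (E n)"
  have fe: "finite_energy ?\<theta>" by (rule finite_energy_restrict[OF \<nu>(1) E])
  note s\<theta> = finite_energyD(3)[OF fe]
  have aeE: "AE x in ?\<theta>. x \<in> E n" by (simp add: AE_restrict_measure[OF s E])
  have t: "test i ?\<theta>"
    by (rule test_bounded[OF iI fe, of "real n"]) (use aeE in eventually_elim, simp add: E_def)
  have "(\<integral>\<^sup>+x. ennreal (g i x) \<partial>?\<theta>) < \<infinity>"
    by (rule g_integral_bounded[OF iI finite_energyD(1)[OF fe], of "real n"]) (use aeE in eventually_elim, simp add: E_def)
  moreover have "emeasure ?\<theta> UNIV \<noteq> 0" using n emeasure_restrict_measure[OF s E, of UNIV n] by simp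
  ultimately obtain b where b: "0 < b" "(\<integral>\<^sup>+x. ennreal (g i x) \<partial>?\<theta>) = ennreal b"
    using g_integral_pos[OF iI s\<theta>] by blast
  have dle: "derivative lam i ?\<theta> \<le> (w - 1 / Suc n) * b"
    by (rule derivative_le[OF iI t b(2)]) (use b aeE in \<open>auto simp: E_def elim!: eventually_mono\<close>)
  \<comment> \<open>The factor that brings the g_i-integral to a_i; since \<open>i\<close> is free,
    no upper constraint can be violated by scaling.\<close>
  define r where "r = a i / b"
  have r: "0 < r" "r * b = a i" using a_pos[OF iI] b by (auto simp: r_def)
  let ?m = "scale_measure (ennreal r) ?\<theta>"
  have r0: "0 \<le> r" using r by simp
  note tm = test_scale[OF iI t r0]
  have comp: "component i ?m"
    unfolding component_def
  proof (intro conjI impI)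
    have "emeasure ?\<theta> (- A i) \<le> emeasure \<nu> (- A i)"
      using A_borel[OF iI] E s by (subst emeasure_restrict_measure) (auto intro!: emeasure_mono)
    then show "emeasure ?m (- A i) = 0" using \<nu>(2) by simp
    show "(\<integral>\<^sup>+x. ennreal (g i x) \<partial>?m) = ennreal (a i)"
      using g_measurable[OF iI s\<theta>] b r by (simp add: nn_integral_scale_measure flip: ennreal_mult)
  qed (use tm(1) i0 in \<open>auto simp: test_def\<close>)
  have "derivative lam i (lam i) \<le> derivative lam i ?m"
    by (rule first_variation[OF lam _ iI comp]) (rule opt)
  also have "\<dots> \<le> r * ((w - 1 / Suc n) * b)" using tm(2)[OF lam] dle r0 by (simp add: mult_left_mono)
  also have "\<dots> = (w - 1 / Suc n) * a i" by (simp only: mult.left_commute[of r] r(2))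
  also have "\<dots> < w * a i" using a_pos[OF iI] by simp
  also have "\<dots> = derivative lam i (lam i)" using a_pos[OF iI] by (simp add: w_def)
  finally show False by simp
qed

text \<open>Equality follows from the inequality: W - w g_i is nonnegative
  \<open>lam i\<close>-a.e., and its integral vanishes by the choice of \<open>w\<close>.\<close>

lemma necessary_free:
  assumes i: "i \<in> I - I0"
  defines "w \<equiv> derivative lam i (lam i) / a i"
  shows "nearly_everywhere \<kappa> (A i) (\<lambda>x. W_defined i x \<and> W i x \<ge> ereal (w * g i x))"
    and "AE x in lam i. W_defined i x \<and> W i x = ereal (w * g i x)"
proof -
  have iI: "i \<in> I" using i by auto
  show "nearly_everywhere \<kappa> (A i) (\<lambda>x. W_defined i x \<and> W i x \<ge> ereal (w * g i x))"
    unfolding nearly_everywhere_def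
  proof (rule capacity_zeroI)
    fix \<nu> assume \<nu>: "finite_energy \<nu>" "AE x in \<nu>. x \<in> {x \<in> A i. \<not> (W_defined i x \<and> W i x \<ge> ereal (w * g i x))}"
      "emeasure \<nu> UNIV = 1"
    note s = finite_energyD(3)[OF \<nu>(1)]
    have "AE x in \<nu>. x \<notin> - A i" using \<nu>(2) by eventually_elim auto
    then have "emeasure \<nu> (- A i) = 0"
      using A_borel[OF iI] s sets_eq_imp_space_eq[OF s] by (subst (asm) AE_iff_measurable[of "- A i"]) auto
    moreover have "AE x in \<nu>. W i x < ereal (w * g i x)"
      using \<nu>(2) AE_good[OF iI \<nu>(1)] by eventually_elim (use W_good(1)[OF iI] in auto)
    ultimately have "emeasure \<nu> UNIV = 0" unfolding w_def by (rule free_lower[OF i \<nu>(1)])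
    then show False using \<nu>(3) by simp
  qed
  let ?l = "lam i"
  have l: "component i ?l" by (rule admD(1)[OF lam iI])
  note s = componentD(3)[OF l] and fe = componentD(1)[OF l]
  have a0: "0 \<le> a i" using a_pos[OF iI] by simp
  have [measurable]: "wreal i \<in> borel_measurable borel" "f' i \<in> borel_measurable borel" "good i \<in> sets borel"
    using wreal_measurable f' good_borel iI by auto
  have [measurable]: "g i \<in> borel_measurable borel" using g[OF iI] borel_measurable_continuous_onI by blast
  define E where "E = {x \<in> good i. \<bar>f' i x\<bar> \<noteq> \<infinity> \<and> wreal i x < w * g i x}"
  have E: "E \<in> sets borel" unfolding E_def by measurable
  have "emeasure (restrict_measure ?l E) UNIV = 0"
  proof (rule free_lower[OF i finite_energy_restrict[OF fe E]])
    have "- A i \<in> sets borel" using A_borel[OF iI] by simp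
    then have "emeasure (restrict_measure ?l E) (- A i) = emeasure ?l (- A i \<inter> E)"
      by (rule emeasure_restrict_measure[OF s E])
    also have "\<dots> \<le> emeasure ?l (- A i)" using A_borel[OF iI] s by (intro emeasure_mono) simp_all
    finally show "emeasure (restrict_measure ?l E) (- A i) = 0" using componentD(4)[OF l] by simp
    have "W i x < ereal (w * g i x)" if "x \<in> E" for x
    proof -
      have x: "x \<in> good i" "\<bar>f' i x\<bar> \<noteq> \<infinity>" "wreal i x < w * g i x" using that by (simp_all add: E_def)
      show ?thesis unfolding W_good_real[OF iI x(1,2)] using x(3) by simp
    qed
    then show "AE x in restrict_measure ?l E. W i x < ereal (derivative lam i (lam i) / a i * g i x)"
      unfolding AE_restrict_measure[OF s E] w_def by (intro AE_I2 impI)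
  qed
  then have "emeasure ?l E = 0" using emeasure_restrict_measure[OF s E, of UNIV] by simp
  then have "AE x in ?l. x \<notin> E" using E s by (intro AE_not_in null_setsI) auto
  then have ge: "AE x in ?l. 0 \<le> wreal i x - w * g i x"
    using AE_good[OF iI fe] componentD(6)[OF l] by eventually_elim (auto simp: E_def)
  note gi = integrable_g[OF iI s componentD(5)[OF l] a0]
  note di = derivative_integral[OF iI component_test[OF l]]
  have int: "integrable ?l (\<lambda>x. wreal i x - w * g i x)" using gi(1) di(1) by simp
  have "(\<integral>x. wreal i x - w * g i x \<partial>?l) = 0" using gi di a_pos[OF iI] by (simp add: w_def)
  then have "AE x in ?l. wreal i x - w * g i x = 0"
    using integral_nonneg_eq_0_iff_AE[OF int ge] by simp
  then show "AE x in ?l. W_defined i x \<and> W i x = ereal (w * g i x)"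
    using AE_good[OF iI fe] componentD(6)[OF l]
    by eventually_elim (simp add: W_good_real[OF iI] W_good(1)[OF iI])
qed

text \<open>\<open>S\<close> holds the c with W \<ge> c g under \<xi> - \<lambda>, \<open>T\<close>
  the d with W \<le> d g under \<lambda>. If c < d with c not in \<open>S\<close> and d not in
  \<open>T\<close>, then moving g-mass from where W > d g to where W < c g, within the constraint,
  lowers the functional. So the two sets meet in a cut \<open>w\<close>.\<close>

lemma necessary_constrained:
  assumes i: "i \<in> I0"
  obtains w where "AE x in radon_diff (\<xi> i) (lam i). W_defined i x \<and> W i x \<ge> ereal (w * g i x)"
    "AE x in lam i. W_defined i x \<and> W i x \<le> ereal (w * g i x)"
proof -
  let ?l = "lam i"
  define \<tau> where "\<tau> = radon_diff (\<xi> i) ?l"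
  have iI: "i \<in> I" using i I0 by auto
  have l: "component i ?l" by (rule admD(1)[OF lam iI])
  note sl = componentD(3)[OF l] and fe = componentD(1)[OF l]
  have \<xi>i: "radon (\<xi> i)" using \<xi>[OF i] by simp
  note rd = radon_difference[OF \<xi>i componentD(2)[OF l] componentD(8)[OF l i], folded \<tau>_def]
  note s\<tau> = radon_sets[OF rd(1)] and s\<xi> = radon_sets[OF \<xi>i]
  have le\<xi>: "emeasure \<tau> E \<le> emeasure (\<xi> i) E" if "E \<in> sets borel" for E
    using rd(2) that by (simp add: splits_def)
  obtain N where N: "N \<in> sets borel" "emeasure (\<xi> i) N = 0" "A i - N \<subseteq> finite_part f A i" "- A i \<subseteq> N"
    and nul: "\<And>E. E \<in> sets borel \<Longrightarrow> (\<And>\<nu>. finite_energy \<nu> \<Longrightarrow> emeasure \<nu> E = 0) \<Longrightarrow> emeasure (\<xi> i) E = 0"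
    using constraint_null_sets[OF i] by blast
  have [measurable]: "wreal i \<in> borel_measurable borel" "f' i \<in> borel_measurable borel"
    using wreal_measurable f' iI by auto
  have [measurable]: "g i \<in> borel_measurable borel" using g[OF iI] borel_measurable_continuous_onI by blast
  have [measurable]: "N \<in> sets borel" "good i \<in> sets borel" using N(1) good_borel[OF iI] by auto
  have gpos: "0 < g i x" for x using g[OF iI] by auto
  have a0: "0 \<le> a i" using a_pos[OF iI] by simp
  \<comment> \<open>A Borel set of full \<tau>-measure on which field and potentials are finite and
    \<open>f i\<close> equals \<open>f' i\<close>.\<close>
  define R where "R = good i - N"
  have R: "R \<in> sets borel" unfolding R_def by measurable
  have Rf: "f i x = f' i x" "\<bar>f' i x\<bar> \<noteq> \<infinity>" "x \<in> A i" "x \<in> good i" "x \<in> finite_part f A i" if "x \<in> R" for x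
  proof -
    show x: "x \<in> A i" "x \<in> good i" "x \<in> finite_part f A i" using that N(3,4) by (auto simp: R_def)
    then have "x \<notin> Y i" by (simp add: good_def)
    then show eq: "f i x = f' i x" by (rule f_eq[OF iI])
    show "\<bar>f' i x\<bar> \<noteq> \<infinity>" using x(3) eq by (simp add: finite_part_def)
  qed
  have "emeasure (\<xi> i) (- good i) = 0"
  proof (rule nul)
    fix \<nu> assume \<nu>: "finite_energy \<nu>"
    note s = finite_energyD(3)[OF \<nu>]
    show "emeasure \<nu> (- good i) = 0"
      using AE_good[OF iI \<nu>] good_borel[OF iI] s sets_eq_imp_space_eq[OF s]
      by (subst (asm) AE_iff_measurable[of "- good i"]) auto
  qed measurable
  then have "emeasure \<tau> (- good i) = 0" "emeasure \<tau> N = 0"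
    using le\<xi>[of "- good i"] le\<xi>[of N] N(1,2) good_borel[OF iI] by simp_all
  then have "- good i \<in> null_sets \<tau>" "N \<in> null_sets \<tau>"
    using N(1) good_borel[OF iI] s\<tau> by (intro null_setsI; simp)+
  then have "- good i \<union> N \<in> null_sets \<tau>" by (intro null_sets.Un)
  moreover have "- R = - good i \<union> N" by (auto simp: R_def)
  ultimately have R0: "- R \<in> null_sets \<tau>" by simp
  have AE_R: "AE x in \<tau>. x \<in> R" using AE_not_in[OF R0] by simp
  define S where "S = {c. AE x in \<tau>. c * g i x \<le> wreal i x}"
  define T where "T = {d. AE x in ?l. wreal i x \<le> d * g i x}"
  have mu0: "AE x in \<theta>. x \<notin> E" if "sets \<theta> = sets borel" "E \<in> sets borel" "emeasure \<theta> E = 0" for \<theta> E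
    using that by (intro AE_not_in null_setsI) simp_all
  have lne: "emeasure ?l UNIV \<noteq> 0"
  proof
    assume "emeasure ?l UNIV = 0"
    then have "AE x in ?l. x \<notin> UNIV" by (intro mu0 sl) simp_all
    then have "AE x in ?l. ennreal (g i x) = 0" by (rule eventually_mono) simp
    then have "(\<integral>\<^sup>+x. ennreal (g i x) \<partial>?l) = 0" using g_measurable[OF iI sl] by (subst nn_integral_0_iff_AE) simp_all
    then show False using componentD(5)[OF l] a_pos[OF iI] by simp
  qed
  \<comment> \<open>Follows from the strict inequality between a_i and the g_i-integral of \<xi> i;
    it keeps \<open>S\<close> from containing every real, as \<open>lne\<close> does for
    \<open>T\<close>.\<close>
  have \<tau>ne: "emeasure \<tau> UNIV \<noteq> 0"
  proof
    assume "emeasure \<tau> UNIV = 0"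
    then have "AE x in \<tau>. x \<notin> UNIV" by (intro mu0 s\<tau>) simp_all
    then have "AE x in \<tau>. ennreal (g i x) = 0" by (rule eventually_mono) simp
    then have "(\<integral>\<^sup>+x. ennreal (g i x) \<partial>\<tau>) = 0" using g_measurable[OF iI s\<tau>] by (subst nn_integral_0_iff_AE) simp_all
    then have "(\<integral>\<^sup>+x. ennreal (g i x) \<partial>\<xi> i) = ennreal (a i)"
      using nn_integral_splits[OF rd(2) g_measurable[OF iI refl]] componentD(5)[OF l] by simp
    then show False using \<xi>[OF i] a0 by (simp add: eint_g[OF iI])
  qed
  have unbounded: False if s: "sets \<theta> = sets borel" and ne: "emeasure \<theta> UNIV \<noteq> 0"
    and all: "\<And>n. AE x in \<theta>. real n * g i x \<le> h x" for \<theta> and h :: "'a \<Rightarrow> real"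
  proof -
    have "AE x in \<theta>. \<forall>n. real n * g i x \<le> h x" using all by (simp add: AE_all_countable)
    then have "AE x in \<theta>. False"
    proof eventually_elim
      case (elim x)
      obtain n where "h x / g i x < real n" using reals_Archimedean2 by blast
      then have "h x < real n * g i x" using gpos[of x] by (simp add: pos_divide_less_eq)
      then show ?case using elim by (auto simp: not_le[symmetric])
    qed
    from AE_False_null[OF this] show False using ne sets_eq_imp_space_eq[OF s] by simp
  qed
  have alt: "c \<in> S \<or> d \<in> T" if cd: "c < d" for c d
  proof (rule ccontr)
    assume not: "\<not> ?thesis"
    \<comment> \<open>The cut-off at n makes the field bounded. A compact subset then carries a
      piece of \<xi> i of finite energy, and g_i is bounded on it by continuity.\<close>
    define E where "E n = {x \<in> R. wreal i x < c * g i x \<and> \<bar>real_of_ereal (f' i x)\<bar> \<le> real n}" for n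
    have E: "E n \<in> sets borel" for n unfolding E_def using R by measurable
    have "\<exists>n. emeasure \<tau> (E n) \<noteq> 0"
    proof (rule ccontr)
      assume "\<not> ?thesis"
      then have "AE x in \<tau>. \<forall>n. x \<notin> E n" unfolding AE_all_countable using E by (intro allI mu0 s\<tau>) simp_all
      then have "AE x in \<tau>. c * g i x \<le> wreal i x"
        using AE_R
      proof eventually_elim
        case (elim x)
        obtain n where n: "\<bar>real_of_ereal (f' i x)\<bar> < real n" using reals_Archimedean2 by blast
        have "x \<notin> E n" using elim(1) by blast
        then show ?case using elim(2) n by (simp add: E_def)
      qed
      then show False using not by (simp add: S_def)
    qed
    then obtain n where "0 < emeasure \<tau> (E n)" by (auto simp: zero_less_iff_neq_zero)
    then obtain K where K: "compact K" "K \<subseteq> E n" "0 < emeasure \<tau> K"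
      using radon_inner_less[OF rd(1) E[of n]] by blast
    have Kb: "K \<in> sets borel" using K(1) by (auto intro: borel_closed compact_imp_closed)
    have KR: "K \<subseteq> R" using K(2) by (auto simp: E_def)
    have Kf: "K \<subseteq> finite_part f A i" using KR Rf(5) by auto
    let ?\<theta> = "restrict_measure \<tau> K"
    note em\<tau> = emeasure_restrict_measure[OF s\<tau> Kb]
    have fe\<theta>: "finite_energy ?\<theta>"
      using s\<tau> Kb le\<xi> by (intro finite_energy_le[OF constraint_restrict_energy[OF i K(1) Kf]])
        (simp_all add: em\<tau> emeasure_restrict_measure[OF s\<xi> Kb])
    note s\<theta> = finite_energyD(3)[OF fe\<theta>]
    have aeK: "AE x in ?\<theta>. x \<in> K" by (simp add: AE_restrict_measure[OF s\<tau> Kb])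
    have "\<bar>f' i x\<bar> \<noteq> \<infinity> \<and> \<bar>real_of_ereal (f' i x)\<bar> \<le> real n" if "x \<in> K" for x
    proof
      show "\<bar>f' i x\<bar> \<noteq> \<infinity>" using that KR by (intro Rf(2)) blast
      have "x \<in> E n" using that K(2) by blast
      then show "\<bar>real_of_ereal (f' i x)\<bar> \<le> real n" unfolding E_def by blast
    qed
    with aeK have t\<theta>: "test i ?\<theta>"
      by (intro test_bounded[OF iI fe\<theta>, of "real n"]) (rule eventually_mono)
    have "bounded (g i ` K)"
      using g[OF iI] by (intro compact_imp_bounded compact_continuous_image K(1)) (auto intro: continuous_on_subset)
    then obtain m where m: "\<And>x. x \<in> K \<Longrightarrow> \<bar>g i x\<bar> \<le> m" by (auto simp: bounded_iff)
    have "(\<integral>\<^sup>+x. ennreal (g i x) \<partial>?\<theta>) < \<infinity>"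
      by (rule g_integral_bounded[OF iI finite_energyD(1)[OF fe\<theta>], of m])
        (use aeK in eventually_elim, use m in force)
    moreover have "emeasure ?\<theta> UNIV \<noteq> 0" using K(3) em\<tau>[of UNIV] by simp
    ultimately obtain b1 where b1: "0 < b1" "(\<integral>\<^sup>+x. ennreal (g i x) \<partial>?\<theta>) = ennreal b1"
      using g_integral_pos[OF iI s\<theta>] by blast
    have d1: "derivative lam i ?\<theta> \<le> c * b1"
    proof (rule derivative_le[OF iI t\<theta> b1(2)])
      show "AE x in ?\<theta>. wreal i x \<le> c * g i x"
        using aeK by eventually_elim (use K(2) in \<open>auto simp: E_def\<close>)
    qed (use b1 in simp)
    \<comment> \<open>Where W is too large for \<lambda>: mass of \<open>lam i\<close> is removed
      from here.\<close>
    define H where "H = {x. d * g i x < wreal i x}"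
    have H: "H \<in> sets borel" unfolding H_def by measurable
    have Hc: "- H \<in> sets borel" using H by simp
    let ?h = "restrict_measure ?l H" and ?k = "restrict_measure ?l (- H)"
    have "emeasure ?l H \<noteq> 0"
    proof
      assume "emeasure ?l H = 0"
      then have "AE x in ?l. x \<notin> H" by (intro mu0 sl H)
      then have "AE x in ?l. wreal i x \<le> d * g i x" by eventually_elim (simp add: H_def)
      then show False using not by (simp add: T_def)
    qed
    then have hne: "emeasure ?h UNIV \<noteq> 0" using emeasure_restrict_measure[OF sl H, of UNIV] by simp
    note th = test_restrict[OF iI component_test[OF l] H] and tk = test_restrict[OF iI component_test[OF l] Hc]
    have sh: "sets ?h = sets borel" "sets ?k = sets borel" using sl by simp_all
    have spl: "splits ?l ?h ?k" by (rule splits_restrict[OF sl H])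
    note gsum = nn_integral_splits[OF spl g_measurable[OF iI refl]]
    have gl: "(\<integral>\<^sup>+x. ennreal (g i x) \<partial>?h) + (\<integral>\<^sup>+x. ennreal (g i x) \<partial>?k) = ennreal (a i)"
      using gsum componentD(5)[OF l] by simp
    have "(\<integral>\<^sup>+x. ennreal (g i x) \<partial>?h) \<le> ennreal (a i)" "(\<integral>\<^sup>+x. ennreal (g i x) \<partial>?k) \<le> ennreal (a i)"
      unfolding gl[symmetric] by simp_all
    then have gfin: "(\<integral>\<^sup>+x. ennreal (g i x) \<partial>?h) < \<infinity>" "(\<integral>\<^sup>+x. ennreal (g i x) \<partial>?k) < \<infinity>"
      by (auto intro: le_less_trans)
    obtain b2 where b2: "0 < b2" "(\<integral>\<^sup>+x. ennreal (g i x) \<partial>?h) = ennreal b2"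
      by (rule g_integral_pos[OF iI sh(1) hne gfin(1)])
    obtain b3 where b3: "0 \<le> b3" "(\<integral>\<^sup>+x. ennreal (g i x) \<partial>?k) = ennreal b3"
      using gfin(2) by (cases "\<integral>\<^sup>+x. ennreal (g i x) \<partial>?k") auto
    have ab: "a i = b2 + b3" using gl b2 b3 a0 by (simp flip: ennreal_plus)
    have d2: "d * b2 \<le> derivative lam i ?h"
    proof (rule derivative_ge[OF iI th b2(2)])
      show "AE x in ?h. d * g i x \<le> wreal i x" by (simp add: AE_restrict_measure[OF sl H] H_def)
    qed (use b2 in simp)
    \<comment> \<open>The amount of g_i-mass exchanged: the fraction \<open>t1\<close> of \<tau> on
      \<open>K\<close> is added and the fraction \<open>t2\<close> of \<open>lam i\<close> on
      \<open>H\<close> removed, each with g_i-integral \<open>s\<close>. The minimum keeps both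
      fractions at most 1.\<close>
    define s where "s = min b1 b2"
    have s: "0 < s" "s \<le> b1" "s \<le> b2" using b1 b2 by (auto simp: s_def)
    define t1 t2 where "t1 = s / b1" and "t2 = s / b2"
    have t: "0 < t1" "t1 \<le> 1" "0 < t2" "t2 \<le> 1" "t1 * b1 = s" "t2 * b2 = s"
      using s b1 b2 by (auto simp: t1_def t2_def)
    have t': "0 \<le> t1" "0 \<le> 1 - t2" using t by auto
    let ?u = "scale_measure (ennreal t1) ?\<theta>" and ?v = "scale_measure (ennreal (1 - t2)) ?h"
    note tu = test_scale[OF iI t\<theta> t'(1)] and tv = test_scale[OF iI th t'(2)]
    have fr: "finite_radon ?u" "finite_radon ?v" "finite_radon ?k"
      using tu(1) tv(1) tk by (auto simp: test_def finite_energyD)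
    obtain \<nu>0 where \<nu>0: "splits \<nu>0 ?k ?v" "finite_radon \<nu>0" using finite_radon_splits[OF fr(3,2)] .
    obtain \<nu> where \<nu>: "splits \<nu> \<nu>0 ?u" "finite_radon \<nu>" using finite_radon_splits[OF \<nu>0(2) fr(1)] .
    note t0 = test_splits[OF iI \<nu>0(1) tk tv(1)]
    note tn = test_splits[OF iI \<nu>(1) t0(1) tu(1)]
    have em: "emeasure \<nu> F = emeasure ?l (F \<inter> - H) + ennreal (1 - t2) * emeasure ?l (F \<inter> H) + ennreal t1 * emeasure \<tau> (F \<inter> K)"
      if "F \<in> sets borel" for F
      using \<nu>0(1) \<nu>(1) that by (simp add: splits_def em\<tau> emeasure_restrict_measure[OF sl H] emeasure_restrict_measure[OF sl Hc])
    have comp: "component i \<nu>"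
      unfolding component_def
    proof (intro conjI impI ballI)
      have "emeasure ?l (- A i \<inter> F) = 0" for F
        using componentD(4)[OF l] emeasure_mono[of "- A i \<inter> F" "- A i" ?l] A_borel[OF iI] sl by simp
      moreover have "- A i \<inter> K = {}" using KR Rf(3) by auto
      ultimately show "emeasure \<nu> (- A i) = 0" using A_borel[OF iI] by (simp add: em)
      have "(\<integral>\<^sup>+x. ennreal (g i x) \<partial>\<nu>) = ennreal b3 + ennreal (1 - t2) * ennreal b2 + ennreal t1 * ennreal b1"
        using nn_integral_splits[OF \<nu>(1) g_measurable[OF iI refl]] nn_integral_splits[OF \<nu>0(1) g_measurable[OF iI refl]]
          g_measurable[OF iI s\<theta>] g_measurable[OF iI sh(1)] b1 b2 b3 by (simp add: nn_integral_scale_measure)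
      also have "\<dots> = ennreal (b3 + (1 - t2) * b2 + t1 * b1)"
        using b1 b2 b3 t' by (simp add: ennreal_mult ennreal_plus)
      also have "b3 + (1 - t2) * b2 + t1 * b1 = a i" using t(5,6) ab by (simp add: algebra_simps)
      finally show "(\<integral>\<^sup>+x. ennreal (g i x) \<partial>\<nu>) = ennreal (a i)" .
      fix F :: "'a set" assume F: "F \<in> sets borel"
      have one: "ennreal r * x \<le> x" if "r \<le> 1" for r x
        using mult_right_mono[OF ennreal_leI[OF that], of x] by simp
      \<comment> \<open>At most \<tau> is added to at most \<open>lam i\<close>, and these two sum
        to \<xi> i.\<close>
      have "emeasure \<nu> F \<le> emeasure ?l (F \<inter> - H) + emeasure ?l (F \<inter> H) + emeasure \<tau> (F \<inter> K)"
        unfolding em[OF F] using t by (intro add_mono one) simp_all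
      also have "\<dots> \<le> emeasure ?l F + emeasure \<tau> F"
      proof (rule add_mono)
        have "emeasure ?l F = emeasure ?h F + emeasure ?k F" using spl F by (simp add: splits_def)
        then show "emeasure ?l (F \<inter> - H) + emeasure ?l (F \<inter> H) \<le> emeasure ?l F"
          using F by (simp add: emeasure_restrict_measure[OF sl H] emeasure_restrict_measure[OF sl Hc] add.commute)
        show "emeasure \<tau> (F \<inter> K) \<le> emeasure \<tau> F" using F s\<tau> by (intro emeasure_mono) simp_all
      qed
      also have "\<dots> = emeasure (\<xi> i) F" using rd(2) F by (simp add: splits_def)
      finally show "emeasure \<nu> F \<le> emeasure (\<xi> i) F" .
    qed (use tn(1) in \<open>auto simp: test_def\<close>)
    have "derivative lam i ?l \<le> derivative lam i \<nu>"
      by (rule first_variation[OF lam _ iI comp]) (rule opt)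
    also have "\<dots> = derivative lam i ?k + (1 - t2) * derivative lam i ?h + t1 * derivative lam i ?\<theta>"
      using tn(2)[OF lam] t0(2)[OF lam] tu(2)[OF lam] tv(2)[OF lam] by simp
    also have "derivative lam i ?k = derivative lam i ?l - derivative lam i ?h"
      using test_splits(2)[OF iI spl th tk lam] by simp
    finally have "t2 * derivative lam i ?h \<le> t1 * derivative lam i ?\<theta>" by (simp add: algebra_simps)
    moreover have "t2 * (d * b2) \<le> t2 * derivative lam i ?h" using d2 t by (intro mult_left_mono) auto
    moreover have "t1 * derivative lam i ?\<theta> \<le> t1 * (c * b1)" using d1 t by (intro mult_left_mono) auto
    \<comment> \<open>The added piece contributes at most c s and the removed one at least d s, so
      minimality contradicts c < d.\<close>
    ultimately have "d * (t2 * b2) \<le> c * (t1 * b1)" by (simp add: ac_simps)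
    then have "d * s \<le> c * s" using t(5,6) by simp
    then show False using cd s(1) by simp
  qed
  have SU: "S \<noteq> UNIV"
  proof
    assume "S = UNIV"
    then have "AE x in \<tau>. real n * g i x \<le> wreal i x" for n by (auto simp: S_def)
    from unbounded[OF s\<tau> \<tau>ne this] show False .
  qed
  have TU: "T \<noteq> UNIV"
  proof
    assume "T = UNIV"
    have "AE x in ?l. real n * g i x \<le> - wreal i x" for n
    proof -
      have "- real n \<in> T" using \<open>T = UNIV\<close> by simp
      then have "AE x in ?l. wreal i x \<le> (- real n) * g i x" unfolding T_def by (rule CollectD)
      then show ?thesis by eventually_elim simp
    qed
    from unbounded[OF sl lne this] show False .
  qed
  have down: "c \<in> S" if "d \<in> S" "c < d" for c d
  proof -
    have "c * g i x \<le> d * g i x" for x using that(2) gpos[of x] by (simp add: less_imp_le mult_right_mono)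
    moreover have "AE x in \<tau>. d * g i x \<le> wreal i x" using that(1) by (simp add: S_def)
    ultimately have "AE x in \<tau>. c * g i x \<le> wreal i x" by (auto elim!: eventually_mono intro: order_trans)
    then show ?thesis by (simp add: S_def)
  qed
  have "\<exists>w. (\<forall>c<w. c \<in> S) \<and> (\<forall>d>w. d \<in> T)"
  proof (rule threshold[of S T])
    show "S \<noteq> UNIV" "T \<noteq> UNIV" by (fact SU TU)+
    show "c \<in> S" if "d \<in> S" "c < d" for c d using that by (rule down)
    show "c \<in> S \<or> d \<in> T" if "c < d" for c d using that by (rule alt)
  qed
  then obtain w where w: "\<And>c. c < w \<Longrightarrow> c \<in> S" "\<And>d. w < d \<Longrightarrow> d \<in> T" by blast
  \<comment> \<open>The cut covers only c < w and d > w. Approximation by 1 / (n + 1) reaches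
    \<open>w\<close> itself with countably many null sets.\<close>
  have lim: "w * y \<le> z" if "\<And>n. (w - 1 / Suc n) * y \<le> z" for w y z :: real
  proof (rule LIMSEQ_le_const2)
    have "(\<lambda>n. (w - inverse (real (Suc n))) * y) \<longlonglongrightarrow> (w - 0) * y"
      by (intro tendsto_intros LIMSEQ_inverse_real_of_nat)
    then show "(\<lambda>n. (w - 1 / Suc n) * y) \<longlonglongrightarrow> w * y" by (simp add: inverse_eq_divide)
  qed (use that in blast)
  have "AE x in \<tau>. \<forall>n. (w - 1 / Suc n) * g i x \<le> wreal i x"
    unfolding AE_all_countable using w(1) by (simp add: S_def)
  then have "AE x in \<tau>. W_defined i x \<and> W i x \<ge> ereal (w * g i x)"
    using AE_R
  proof eventually_elim
    case (elim x)
    then show ?case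
      using lim[of w "g i x" "wreal i x"] Rf(2,4)[OF elim(2)] W_good_real[OF iI] W_good(1)[OF iI] by simp
  qed
  moreover have "AE x in ?l. \<forall>n. wreal i x \<le> (w + 1 / Suc n) * g i x"
    unfolding AE_all_countable using w(2) by (simp add: T_def)
  then have "AE x in ?l. W_defined i x \<and> W i x \<le> ereal (w * g i x)"
    using AE_good[OF iI fe] componentD(6)[OF l]
  proof eventually_elim
    case (elim x)
    have "(- w - 1 / Suc n) * g i x \<le> - wreal i x" for n
      using elim(1)[rule_format, of n] by (simp add: algebra_simps)
    then have "(- w) * g i x \<le> - wreal i x" by (rule lim)
    then show ?case using elim(2,3) W_good_real[OF iI] W_good(1)[OF iI] by simp
  qed
  ultimately show ?thesis using that[of w] unfolding \<tau>_def by blast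
qed

end

end

lemma solution_characterization:
  assumes lam: "admissible' lam"
  shows "lam \<in> gauss_solutions \<kappa> f Ipos Ineg I0 \<xi> A a g \<longleftrightarrow>
    (\<exists>w :: 'i \<Rightarrow> real.
      (\<forall>i \<in> I0.
        (AE x in radon_diff (\<xi> i) (lam i). weighted_potential_defined \<kappa> f Ipos Ineg lam i x
           \<and> weighted_potential \<kappa> f Ipos Ineg lam i x \<ge> ereal (w i * g i x))
        \<and> (AE x in lam i. weighted_potential_defined \<kappa> f Ipos Ineg lam i x
           \<and> weighted_potential \<kappa> f Ipos Ineg lam i x \<le> ereal (w i * g i x)))
      \<and> (\<forall>i \<in> I - I0.
        nearly_everywhere \<kappa> (A i) (\<lambda>x. weighted_potential_defined \<kappa> f Ipos Ineg lam i x
           \<and> weighted_potential \<kappa> f Ipos Ineg lam i x \<ge> ereal (w i * g i x))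
        \<and> (AE x in lam i. weighted_potential_defined \<kappa> f Ipos Ineg lam i x
           \<and> weighted_potential \<kappa> f Ipos Ineg lam i x = ereal (w i * g i x))))"
proof -
  show ?thesis (is "?sol \<longleftrightarrow> (\<exists>w. ?ineq w)")
  proof
    assume ?sol
    then have opt: "functional lam \<le> functional \<mu>" if "admissible' \<mu>" for \<mu>
      using that by (simp add: solution_iff)
    let ?lower = "\<lambda>i r x. weighted_potential_defined \<kappa> f Ipos Ineg lam i x
        \<and> weighted_potential \<kappa> f Ipos Ineg lam i x \<ge> ereal (r * g i x)"
    let ?upper = "\<lambda>i r x. weighted_potential_defined \<kappa> f Ipos Ineg lam i x
        \<and> weighted_potential \<kappa> f Ipos Ineg lam i x \<le> ereal (r * g i x)"
    have "\<forall>i\<in>I0. \<exists>r. (AE x in radon_diff (\<xi> i) (lam i). ?lower i r x) \<and> (AE x in lam i. ?upper i r x)"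
    proof
      fix i assume i: "i \<in> I0"
      show "\<exists>r. (AE x in radon_diff (\<xi> i) (lam i). ?lower i r x) \<and> (AE x in lam i. ?upper i r x)"
      proof (rule necessary_constrained[OF lam opt i])
        fix r
        assume "AE x in radon_diff (\<xi> i) (lam i). ?lower i r x" "AE x in lam i. ?upper i r x"
        then show ?thesis by blast
      qed
    qed
    then have "\<exists>w0. \<forall>i\<in>I0. (AE x in radon_diff (\<xi> i) (lam i). ?lower i (w0 i) x)
        \<and> (AE x in lam i. ?upper i (w0 i) x)" by (rule bchoice)
    then obtain w0 where w0: "\<forall>i\<in>I0. (AE x in radon_diff (\<xi> i) (lam i). ?lower i (w0 i) x)
        \<and> (AE x in lam i. ?upper i (w0 i) x)" ..
    define w where "w i = (if i \<in> I0 then w0 i else derivative lam i (lam i) / a i)" for i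
    have "?ineq w"
    proof (intro conjI ballI)
      fix i assume "i \<in> I0"
      then show "AE x in radon_diff (\<xi> i) (lam i). ?lower i (w i) x" "AE x in lam i. ?upper i (w i) x"
        using bspec[OF w0, of i] by (simp_all add: w_def)
    next
      fix i assume i: "i \<in> I - I0"
      then have "w i = derivative lam i (lam i) / a i" by (simp add: w_def)
      then show "nearly_everywhere \<kappa> (A i) (?lower i (w i))"
        "AE x in lam i. weighted_potential_defined \<kappa> f Ipos Ineg lam i x
          \<and> weighted_potential \<kappa> f Ipos Ineg lam i x = ereal (w i * g i x)"
        using necessary_free[OF lam opt i] by simp_all
    qed
    then show "\<exists>w. ?ineq w" by (rule exI[where P="?ineq"])
  next
    assume "\<exists>w. ?ineq w"
    then obtain w where w: "?ineq w" by (rule exE[where P="?ineq"])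
    have "derivative lam i (lam i) \<le> derivative lam i (\<mu> i)" if \<mu>: "admissible' \<mu>" and i: "i \<in> I" for \<mu> i
    proof (cases "i \<in> I0")
      case True
      have c: "component i (\<mu> i)" by (rule admD(1)[OF \<mu> i])
      have lower: "AE x in radon_diff (\<xi> i) (lam i). weighted_potential_defined \<kappa> f Ipos Ineg lam i x
          \<and> weighted_potential \<kappa> f Ipos Ineg lam i x \<ge> ereal (w i * g i x)"
        using bspec[OF conjunct1[OF w] True] by (rule conjunct1)
      have upper: "AE x in lam i. weighted_potential_defined \<kappa> f Ipos Ineg lam i x
          \<and> weighted_potential \<kappa> f Ipos Ineg lam i x \<le> ereal (w i * g i x)"
        using bspec[OF conjunct1[OF w] True] by (rule conjunct2)
      show ?thesis using lam True c lower upper by (rule sufficient_constrained)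
    next
      case False
      then have i0: "i \<in> I - I0" using i by simp
      have c: "component i (\<mu> i)" by (rule admD(1)[OF \<mu> i])
      have lower: "nearly_everywhere \<kappa> (A i) (\<lambda>x. weighted_potential_defined \<kappa> f Ipos Ineg lam i x
          \<and> weighted_potential \<kappa> f Ipos Ineg lam i x \<ge> ereal (w i * g i x))"
        using bspec[OF conjunct2[OF w] i0] by (rule conjunct1)
      have eq: "AE x in lam i. weighted_potential_defined \<kappa> f Ipos Ineg lam i x
          \<and> weighted_potential \<kappa> f Ipos Ineg lam i x = ereal (w i * g i x)"
        using bspec[OF conjunct2[OF w] i0] by (rule conjunct2)
      show ?thesis using lam i c lower eq by (rule sufficient_free)
    qed
    then have "functional lam \<le> functional \<mu>" if "admissible' \<mu>" for \<mu>
      using that by (intro functional_convex[OF lam])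
    then show ?sol using lam by (simp add: solution_iff)
  qed
qed

end

text \<open>If the kernel takes negative values, the space is compact, and finitely many of the open
  sets {\<kappa> > -n} cover the product.\<close>

lemma kernel_lower_bound:
  fixes \<kappa> :: "'a::t2_space \<times> 'a \<Rightarrow> ereal"
  assumes "energy_kernel \<kappa>"
  shows "\<exists>M\<ge>0. (\<forall>z. - ereal M \<le> \<kappa> z) \<and> (M = 0 \<or> compact (UNIV :: 'a set))"
proof (cases "\<forall>z. 0 \<le> \<kappa> z")
  case True
  then show ?thesis by (intro exI[of _ 0]) (simp add: zero_ereal_def[symmetric])
next
  case False
  then have c: "compact (UNIV :: ('a \<times> 'a) set)" and lsc: "\<And>c. open {z. c < \<kappa> z}" and ninf: "\<And>z. \<kappa> z \<noteq> - \<infinity>"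
    using assms by (auto simp: energy_kernel_def Psi_def)
  have cX: "compact (UNIV :: 'a set)"
    using compact_continuous_image[OF continuous_on_fst[OF continuous_on_id] c] by simp
  define U where "U n = {z. - ereal (real n) < \<kappa> z}" for n
  have "UNIV \<subseteq> (\<Union>n\<in>UNIV. U n)"
  proof
    fix z
    have "\<exists>n. - ereal (real n) < \<kappa> z"
    proof (cases "\<kappa> z")
      case (real r)
      obtain n where "- r < real n" using reals_Archimedean2 by blast
      then show ?thesis using real by (intro exI[of _ n]) simp
    qed (use ninf[of z] in simp_all)
    then show "z \<in> (\<Union>n\<in>UNIV. U n)" by (simp add: U_def)
  qed
  then obtain F where F: "finite F" "UNIV \<subseteq> (\<Union>n\<in>F. U n)"
    using compactE_image[OF c, of UNIV U] lsc unfolding U_def by auto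
  \<comment> \<open>The sum of the finite set \<open>F\<close> of natural numbers serves as an upper
    bound for its elements.\<close>
  have "- ereal (real (\<Sum>F)) \<le> \<kappa> z" for z
  proof -
    obtain n where n: "n \<in> F" "z \<in> U n" using F(2) by blast
    have "n \<le> \<Sum>F" using member_le_sum[OF n(1), of "\<lambda>n. n"] F(1) by simp
    then have "real n \<le> real (\<Sum>F)" by (rule of_nat_mono)
    then have "- ereal (real (\<Sum>F)) \<le> - ereal (real n)" by simp
    also have "\<dots> \<le> \<kappa> z" using n(2) by (simp add: U_def)
    finally show ?thesis .
  qed
  moreover have "0 \<le> real (\<Sum>F)" by (rule of_nat_0_le_iff)
  ultimately show ?thesis using cX by blast
qed

theorem theorem8p2:
  fixes \<kappa> :: "'a::t2_space \<times> 'a \<Rightarrow> ereal"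
    and Ipos Ineg I I0 :: "'i set"
    and A B :: "'i \<Rightarrow> 'a set"
    and a :: "'i \<Rightarrow> real"
    and g :: "'i \<Rightarrow> 'a \<Rightarrow> real"
    and f :: "'i \<Rightarrow> 'a \<Rightarrow> ereal"
    and \<xi> lam :: "'i \<Rightarrow> 'a measure"
  assumes "locally_compact_space (euclidean :: 'a topology)"
    and "energy_kernel \<kappa>"
    and "positive_definite \<kappa>"
    and "I = Ipos \<union> Ineg"
    and "generalized_condenser Ipos Ineg A"
    and "\<And>i. i \<in> I \<Longrightarrow> 0 < a i"
    and "\<And>i. i \<in> I \<Longrightarrow> continuous_on UNIV (g i) \<and> (\<forall>x. 0 < g i x)"
    and "\<And>i. i \<in> I \<Longrightarrow> universally_measurable (f i)"
    and "I0 \<subseteq> I"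
    and "\<And>i. i \<in> I0 \<Longrightarrow> radon (\<xi> i) \<and> carried_by (\<xi> i) (A i)
           \<and> ereal (a i) < eint (\<xi> i) (\<lambda>x. ereal (g i x))"
    and "admissible \<kappa> f Ipos Ineg I0 \<xi> A a g \<noteq> {}"
    and "(\<exists>C :: nat \<Rightarrow> 'a set. (\<forall>n. compact (C n)) \<and> (\<Union>n. C n) = UNIV)
           \<or> (\<forall>i \<in> I. 0 < (INF x \<in> A i. g i x))"
    and "field_case_I I f \<or> field_case_II \<kappa> Ipos Ineg f"
    and "nearly_closed_via \<kappa> I A B"
    and "(\<Sum>\<^sub>\<infinity>i\<in>I. ennreal (a i) / ennreal (INF x \<in> A i. g i x)) < \<infinity>"
    and "(SUP z \<in> (\<Union>i \<in> Ipos. B i) \<times> (\<Union>i \<in> Ineg. B i). \<kappa> z) < \<infinity>"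
    and "\<And>i. i \<in> I \<Longrightarrow> bdd_above (g i ` B i)"
    and "\<And>i K. i \<in> I0 \<Longrightarrow> compact K \<Longrightarrow> K \<subseteq> finite_part f A i \<Longrightarrow>
           restrict_measure (\<xi> i) K \<in> pos_finite_energy \<kappa> UNIV"
    and "\<And>i. i \<in> I0 \<Longrightarrow> AE x in \<xi> i. x \<notin> A i - finite_part f A i"
    and "\<And>i. i \<in> I \<Longrightarrow> \<exists>c::real. \<forall>x \<in> B i. ereal c \<le> f i x"
    and "lam \<in> admissible \<kappa> f Ipos Ineg I0 \<xi> A a g"
  shows "lam \<in> gauss_solutions \<kappa> f Ipos Ineg I0 \<xi> A a g \<longleftrightarrow>
    (\<exists>w :: 'i \<Rightarrow> real.
      (\<forall>i \<in> I0.
        (AE x in radon_diff (\<xi> i) (lam i). weighted_potential_defined \<kappa> f Ipos Ineg lam i x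
           \<and> weighted_potential \<kappa> f Ipos Ineg lam i x \<ge> ereal (w i * g i x))
        \<and> (AE x in lam i. weighted_potential_defined \<kappa> f Ipos Ineg lam i x
           \<and> weighted_potential \<kappa> f Ipos Ineg lam i x \<le> ereal (w i * g i x)))
      \<and> (\<forall>i \<in> I - I0.
        nearly_everywhere \<kappa> (A i) (\<lambda>x. weighted_potential_defined \<kappa> f Ipos Ineg lam i x
           \<and> weighted_potential \<kappa> f Ipos Ineg lam i x \<ge> ereal (w i * g i x))
        \<and> (AE x in lam i. weighted_potential_defined \<kappa> f Ipos Ineg lam i x
           \<and> weighted_potential \<kappa> f Ipos Ineg lam i x = ereal (w i * g i x))))"
proof -
  note lc = assms(1) and kernel = assms(2) and pd = assms(3) and I = assms(4)
  obtain M where M: "0 \<le> M" "\<And>z. - ereal M \<le> \<kappa> z" "M = 0 \<or> compact (UNIV :: 'a set)"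
    using kernel_lower_bound[OF kernel] by blast
  interpret gauss_kernel \<kappa> M by unfold_locales (fact lc kernel pd M)+
  \<comment> \<open>The two cases of the external field are merged here, before the choice of
    \<open>f'\<close> and \<open>Y\<close> for all indices.\<close>
  have "\<exists>h Z. h \<in> borel_measurable borel \<and> Z \<in> sets borel \<and> (\<forall>x. x \<notin> Z \<longrightarrow> f i x = h x)
      \<and> (\<forall>\<mu>. finite_energy \<mu> \<longrightarrow> emeasure \<mu> Z = 0)" if i: "i \<in> I" for i
  proof (rule field_borel_version[OF assms(13)[unfolded I] i[unfolded I]])
    fix h Z
    assume "h \<in> borel_measurable borel" "Z \<in> sets borel" "\<And>x. x \<notin> Z \<Longrightarrow> f i x = h x"
      "\<And>\<mu>. finite_energy \<mu> \<Longrightarrow> emeasure \<mu> Z = 0"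
    then show ?thesis by blast
  qed
  then obtain f' Y where f'Y: "\<And>i. i \<in> I \<Longrightarrow> f' i \<in> borel_measurable borel" "\<And>i. i \<in> I \<Longrightarrow> Y i \<in> sets borel"
      "\<And>i x. i \<in> I \<Longrightarrow> x \<notin> Y i \<Longrightarrow> f i x = f' i x"
      "\<And>i \<mu>. i \<in> I \<Longrightarrow> finite_energy \<mu> \<Longrightarrow> emeasure \<mu> (Y i) = 0" by metis
  interpret gauss_problem \<kappa> M Ipos Ineg I I0 A B a g f \<xi> f' Y
  proof unfold_locales
    fix i assume i: "i \<in> I"
    show "0 < a i" using i by (rule assms(6))
    show "continuous_on UNIV (g i) \<and> (\<forall>x. 0 < g i x)" using i by (rule assms(7))
    show "\<exists>c::real. \<forall>x \<in> B i. ereal c \<le> f i x" using i by (rule assms(20))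
    show "f' i \<in> borel_measurable borel" "Y i \<in> sets borel" using i by (rule f'Y)+
    show "f i x = f' i x" if "x \<notin> Y i" for x using i that by (rule f'Y)
    show "emeasure \<mu> (Y i) = 0" if "finite_energy \<mu>" for \<mu> using i that by (rule f'Y)
  next
    fix i assume i: "i \<in> I0"
    show "radon (\<xi> i) \<and> carried_by (\<xi> i) (A i) \<and> ereal (a i) < eint (\<xi> i) (\<lambda>x. ereal (g i x))"
      using i by (rule assms(10))
    show "restrict_measure (\<xi> i) K \<in> pos_finite_energy \<kappa> UNIV"
      if "compact K" "K \<subseteq> finite_part f A i" for K using i that by (rule assms(18))
    show "AE x in \<xi> i. x \<notin> A i - finite_part f A i" using i by (rule assms(19))
  qed (fact I assms(5) assms(9) assms(14) assms(15))+
  have lam: "admissible' lam" using assms(21) by (simp add: admissible_iff)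
  show ?thesis by (rule solution_characterization[OF lam])
qed

end
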